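(* Let $\widetilde{G} \rightrightarrows P$ be a $2d$-dimensional symplectic groupoid with source map $\widetilde{\alpha} \colon \widetilde{G} \to P$ and target map $\widetilde{\beta} \colon \widetilde{G} \to P$, and suppose $\Sigma \subset \widetilde{G}$ is a Lagrangian submanifold. Then the restricted source map $\widetilde{\alpha}|_\Sigma \colon \Sigma \to P$ is a local diffeomorphism if and only if the restricted target map $\widetilde{\beta}|_\Sigma \colon \Sigma \to P$ is a local diffeomorphism.
   Context: A Lie groupoid $G \rightrightarrows Q$ is a groupoid (small category in which every morphism is invertible; $Q$ is the set of objects, $G$ the set of morphisms) in which $G$ and $Q$ are smooth manifolds, the source $\alpha \colon G \to Q$ and target $\beta \colon G \to Q$ are submersions, and the multiplication $m \colon G_2 \to G$, $(g,h) \mapsto gh$, is smooth, where $G_2 = \{(g,h) \in G \times G : \beta(g) = \alpha(h)\}$. A symplectic groupoid is a Lie groupoid $\widetilde{G} \rightrightarrows P$ such that (1) $(\widetilde{G}, \widetilde{\omega})$ is a symplectic manifold, and (2) the graph of the multiplication $\widetilde{m} \colon \widetilde{G}_2 \to \widetilde{G}$ is a Lagrangian submanifold of $\widetilde{G}^- \times \widetilde{G}^- \times \widetilde{G}$, where $\widetilde{G}^- = (\widetilde{G}, -\widetilde{\omega})$. *)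

theory Defs
  imports "HOL-Analysis.Analysis"
begin

section \<open>Smooth maps between subsets of Euclidean spaces\<close>

text \<open>\<open>C\<^sup>k\<close> on an open set, by induction on \<open>k\<close> through directional derivatives.\<close>

primrec C_k_on_open ::
    "nat \<Rightarrow> 'a::euclidean_space set \<Rightarrow> ('a \<Rightarrow> 'b::euclidean_space) \<Rightarrow> bool" where
  "C_k_on_open 0 U f \<longleftrightarrow> continuous_on U f"
| "C_k_on_open (Suc k) U f \<longleftrightarrow>
     (\<forall>x\<in>U. f differentiable (at x)) \<and>
     (\<forall>v. C_k_on_open k U (\<lambda>x. frechet_derivative f (at x) v))"

text \<open>
  On an arbitrary subset, smooth means locally the restriction of a smooth map on an open set.
  It is applied to relatively open subsets of linear subspaces, where it agrees with
  smoothness in linear coordinates of the subspace.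
\<close>

definition smooth_on :: "'a::euclidean_space set \<Rightarrow> ('a \<Rightarrow> 'b::euclidean_space) \<Rightarrow> bool" where
  "smooth_on S f \<longleftrightarrow>
     (\<forall>x\<in>S. \<exists>U F. open U \<and> x \<in> U \<and> (\<forall>k. C_k_on_open k U F) \<and> (\<forall>y\<in>U \<inter> S. F y = f y))"

section \<open>Smooth manifolds\<close>

text \<open>
  A chart of dimension \<open>n\<close> takes values in an \<open>n\<close>-dimensional linear subspace (\<open>cmodel\<close>) of
  some Euclidean space, which plays the role of \<open>\<real>\<^sup>n\<close>. Since every type of class
  \<open>euclidean_space\<close> has positive dimension, this is what allows dimension 0; it also lets
  a submanifold be a manifold with the same type of charts as the ambient one.
\<close>

record ('m, 'e) chart =
  cdom :: "'m set"
  cmap :: "'m \<Rightarrow> 'e"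
  cmodel :: "'e set"

definition cimage :: "('m, 'e) chart \<Rightarrow> 'e set" where
  "cimage c = cmap c ` cdom c"

definition cinv :: "('m, 'e) chart \<Rightarrow> 'e \<Rightarrow> 'm" where
  "cinv c = inv_into (cdom c) (cmap c)"

definition is_chart :: "'m topology \<Rightarrow> nat \<Rightarrow> ('m, 'e::euclidean_space) chart \<Rightarrow> bool" where
  "is_chart X n c \<longleftrightarrow>
     openin X (cdom c) \<and>
     subspace (cmodel c) \<and> dim (cmodel c) = n \<and>
     openin (top_of_set (cmodel c)) (cimage c) \<and>
     homeomorphic_map (subtopology X (cdom c)) (top_of_set (cimage c)) (cmap c)"

definition compatible :: "('m, 'e::euclidean_space) chart \<Rightarrow> ('m, 'e) chart \<Rightarrow> bool" where
  "compatible c c' \<longleftrightarrow>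
     smooth_on (cmap c ` (cdom c \<inter> cdom c')) (cmap c' \<circ> cinv c) \<and>
     smooth_on (cmap c' ` (cdom c \<inter> cdom c')) (cmap c \<circ> cinv c')"

record ('m, 'e) manifold =
  mtop :: "'m topology"
  mdim :: nat
  atlas :: "('m, 'e) chart set"

abbreviation points :: "('m, 'e) manifold \<Rightarrow> 'm set" where
  "points M \<equiv> topspace (mtop M)"

definition smooth_manifold :: "('m, 'e::euclidean_space) manifold \<Rightarrow> bool" where
  "smooth_manifold M \<longleftrightarrow>
     Hausdorff_space (mtop M) \<and> second_countable (mtop M) \<and>
     (\<forall>c\<in>atlas M. is_chart (mtop M) (mdim M) c) \<and>
     (\<Union>c\<in>atlas M. cdom c) = points M \<and>
     (\<forall>c\<in>atlas M. \<forall>c'\<in>atlas M. compatible c c')"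

text \<open>The maximal atlas.\<close>

definition charts :: "('m, 'e::euclidean_space) manifold \<Rightarrow> ('m, 'e) chart set" where
  "charts M = {c. is_chart (mtop M) (mdim M) c \<and> (\<forall>c'\<in>atlas M. compatible c c')}"

definition smooth_map ::
    "('m, 'e::euclidean_space) manifold \<Rightarrow> ('n, 'f::euclidean_space) manifold \<Rightarrow> ('m \<Rightarrow> 'n) \<Rightarrow> bool"
where
  "smooth_map M N f \<longleftrightarrow>
     f ` points M \<subseteq> points N \<and>
     (\<forall>p\<in>points M. \<exists>c\<in>charts M. \<exists>c'\<in>charts N.
        p \<in> cdom c \<and> f ` cdom c \<subseteq> cdom c' \<and> smooth_on (cimage c) (cmap c' \<circ> f \<circ> cinv c))"

definition diffeomorphism ::
    "('m, 'e::euclidean_space) manifold \<Rightarrow> ('n, 'f::euclidean_space) manifold \<Rightarrow> ('m \<Rightarrow> 'n) \<Rightarrow> bool"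
where
  "diffeomorphism M N f \<longleftrightarrow>
     bij_betw f (points M) (points N) \<and> smooth_map M N f \<and>
     smooth_map N M (inv_into (points M) f)"

definition open_submanifold ::
    "('m, 'e::euclidean_space) manifold \<Rightarrow> 'm set \<Rightarrow> ('m, 'e) manifold" where
  "open_submanifold M U =
     \<lparr>mtop = subtopology (mtop M) U, mdim = mdim M, atlas = {c \<in> charts M. cdom c \<subseteq> U}\<rparr>"

definition local_diffeomorphism ::
    "('m, 'e::euclidean_space) manifold \<Rightarrow> ('n, 'f::euclidean_space) manifold \<Rightarrow> ('m \<Rightarrow> 'n) \<Rightarrow> bool"
where
  "local_diffeomorphism M N f \<longleftrightarrow>
     (\<forall>p\<in>points M. \<exists>U. openin (mtop M) U \<and> p \<in> U \<and> openin (mtop N) (f ` U) \<and>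
        diffeomorphism (open_submanifold M U) (open_submanifold N (f ` U)) f)"

definition prod_manifold ::
    "('m, 'e::euclidean_space) manifold \<Rightarrow> ('n, 'f::euclidean_space) manifold \<Rightarrow>
     ('m \<times> 'n, 'e \<times> 'f) manifold" where
  "prod_manifold M N =
     \<lparr>mtop = prod_topology (mtop M) (mtop N),
      mdim = mdim M + mdim N,
      atlas = {\<lparr>cdom = cdom c \<times> cdom c', cmap = map_prod (cmap c) (cmap c'),
                cmodel = cmodel c \<times> cmodel c'\<rparr> | c c'. c \<in> atlas M \<and> c' \<in> atlas N}\<rparr>"

text \<open>
  Embedded submanifolds: near each of its points, \<open>S\<close> is cut out by a \<open>k\<close>-dimensional
  linear subspace \<open>F\<close> in some chart of the maximal atlas of \<open>M\<close>. The restrictions of these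
  slice charts form the atlas of \<open>S\<close>.
\<close>

definition slice_chart ::
    "('m, 'e::euclidean_space) manifold \<Rightarrow> nat \<Rightarrow> 'm set \<Rightarrow> ('m, 'e) chart \<Rightarrow> 'e set \<Rightarrow> bool" where
  "slice_chart M k S c F \<longleftrightarrow>
     c \<in> charts M \<and> subspace F \<and> F \<subseteq> cmodel c \<and> dim F = k \<and>
     cmap c ` (cdom c \<inter> S) = cimage c \<inter> F"

definition embedded_submanifold ::
    "('m, 'e::euclidean_space) manifold \<Rightarrow> nat \<Rightarrow> 'm set \<Rightarrow> bool" where
  "embedded_submanifold M k S \<longleftrightarrow>
     S \<subseteq> points M \<and> (\<forall>p\<in>S. \<exists>c F. slice_chart M k S c F \<and> p \<in> cdom c)"

definition submanifold ::
    "('m, 'e::euclidean_space) manifold \<Rightarrow> nat \<Rightarrow> 'm set \<Rightarrow> ('m, 'e) manifold" where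
  "submanifold M k S =
     \<lparr>mtop = subtopology (mtop M) S, mdim = k,
      atlas = {\<lparr>cdom = cdom c \<inter> S, cmap = cmap c, cmodel = F\<rparr> | c F. slice_chart M k S c F}\<rparr>"

section \<open>Tangent vectors\<close>

text \<open>
  A tangent vector at \<open>p\<close> is an equivalence class of curves, smooth near time 0, that pass
  through \<open>p\<close> at time 0 and have the same velocity in all charts around \<open>p\<close>.
\<close>

type_synonym 'm tangent = "(real \<Rightarrow> 'm) set"

definition curve_at :: "('m, 'e::euclidean_space) manifold \<Rightarrow> 'm \<Rightarrow> (real \<Rightarrow> 'm) \<Rightarrow> bool" where
  "curve_at M p \<gamma> \<longleftrightarrow>
     \<gamma> 0 = p \<and>
     (\<exists>c\<in>charts M. \<exists>r>0. \<gamma> ` {-r<..<r} \<subseteq> cdom c \<and> smooth_on {-r<..<r} (cmap c \<circ> \<gamma>))"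

definition velocity :: "('m, 'e::euclidean_space) chart \<Rightarrow> (real \<Rightarrow> 'm) \<Rightarrow> 'e" where
  "velocity c \<gamma> = vector_derivative (cmap c \<circ> \<gamma>) (at 0)"

definition tangent_class ::
    "('m, 'e::euclidean_space) manifold \<Rightarrow> 'm \<Rightarrow> (real \<Rightarrow> 'm) \<Rightarrow> 'm tangent" where
  "tangent_class M p \<gamma> =
     {\<delta>. curve_at M p \<delta> \<and> (\<forall>c\<in>charts M. p \<in> cdom c \<longrightarrow> velocity c \<delta> = velocity c \<gamma>)}"

definition tangent_space :: "('m, 'e::euclidean_space) manifold \<Rightarrow> 'm \<Rightarrow> 'm tangent set" where
  "tangent_space M p = {tangent_class M p \<gamma> | \<gamma>. curve_at M p \<gamma>}"

definition zero_tangent :: "('m, 'e::euclidean_space) manifold \<Rightarrow> 'm \<Rightarrow> 'm tangent" where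
  "zero_tangent M p = tangent_class M p (\<lambda>_. p)"

text \<open>
  The differential \<open>T\<^sub>p f\<close> sends the class of \<open>\<gamma>\<close> to the class of \<open>f \<circ> \<gamma>\<close>. For smooth \<open>f\<close> all
  sets in the union are equal.
\<close>

definition tangent_map ::
    "('n, 'f::euclidean_space) manifold \<Rightarrow> ('m \<Rightarrow> 'n) \<Rightarrow> 'm \<Rightarrow> 'm tangent \<Rightarrow> 'n tangent" where
  "tangent_map N f p v = (\<Union>\<gamma>\<in>v. tangent_class N (f p) (f \<circ> \<gamma>))"

text \<open>
  The tangent vector at \<open>p\<close> with coordinates \<open>u\<close> in the chart \<open>c\<close>. For \<open>c\<close> in the maximal atlas
  and \<open>p \<in> cdom c\<close> this is a bijection from \<open>cmodel c\<close> onto \<open>tangent_space M p\<close>, and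
  it carries the vector space structure of \<open>tangent_space M p\<close>.
\<close>

definition tangent_of_coords ::
    "('m, 'e::euclidean_space) manifold \<Rightarrow> ('m, 'e) chart \<Rightarrow> 'm \<Rightarrow> 'e \<Rightarrow> 'm tangent" where
  "tangent_of_coords M c p u = {\<gamma>. curve_at M p \<gamma> \<and> velocity c \<gamma> = u}"

definition submersion ::
    "('m, 'e::euclidean_space) manifold \<Rightarrow> ('n, 'f::euclidean_space) manifold \<Rightarrow> ('m \<Rightarrow> 'n) \<Rightarrow> bool"
where
  "submersion M N f \<longleftrightarrow>
     smooth_map M N f \<and>
     (\<forall>p\<in>points M. tangent_map N f p ` tangent_space M p = tangent_space N (f p))"

text \<open>The tangent space of a submanifold, viewed inside that of the ambient manifold.\<close>

definition submanifold_tangent_space ::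
    "('m, 'e::euclidean_space) manifold \<Rightarrow> nat \<Rightarrow> 'm set \<Rightarrow> 'm \<Rightarrow> 'm tangent set" where
  "submanifold_tangent_space M k S p =
     tangent_map M id p ` tangent_space (submanifold M k S) p"

section \<open>Symplectic manifolds and Lagrangian submanifolds\<close>

type_synonym 'm form2 = "'m \<Rightarrow> 'm tangent \<Rightarrow> 'm tangent \<Rightarrow> real"

definition form_coords ::
    "('m, 'e::euclidean_space) manifold \<Rightarrow> 'm form2 \<Rightarrow> ('m, 'e) chart \<Rightarrow> 'e \<Rightarrow> 'e \<Rightarrow> 'e \<Rightarrow> real" where
  "form_coords M \<omega> c x u v =
     \<omega> (cinv c x) (tangent_of_coords M c (cinv c x) u) (tangent_of_coords M c (cinv c x) v)"

definition smooth_2form :: "('m, 'e::euclidean_space) manifold \<Rightarrow> 'm form2 \<Rightarrow> bool" where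
  "smooth_2form M \<omega> \<longleftrightarrow>
     (\<forall>c\<in>charts M.
        (\<forall>x\<in>cimage c. \<forall>u\<in>cmodel c. \<forall>v\<in>cmodel c. \<forall>w\<in>cmodel c. \<forall>a b.
           form_coords M \<omega> c x (a *\<^sub>R u + b *\<^sub>R v) w
             = a * form_coords M \<omega> c x u w + b * form_coords M \<omega> c x v w \<and>
           form_coords M \<omega> c x u v = - form_coords M \<omega> c x v u) \<and>
        (\<forall>u\<in>cmodel c. \<forall>v\<in>cmodel c. smooth_on (cimage c) (\<lambda>x. form_coords M \<omega> c x u v)))"

text \<open>
  \<open>d\<omega> = 0\<close>, by the coordinate formula for \<open>d\<omega>\<close> evaluated on constant vector fields
  \<open>u\<close>, \<open>v\<close>, \<open>w\<close>.
\<close>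

definition closed_2form :: "('m, 'e::euclidean_space) manifold \<Rightarrow> 'm form2 \<Rightarrow> bool" where
  "closed_2form M \<omega> \<longleftrightarrow>
     (\<forall>c\<in>charts M. \<forall>x\<in>cimage c. \<forall>u\<in>cmodel c. \<forall>v\<in>cmodel c. \<forall>w\<in>cmodel c.
        deriv (\<lambda>t. form_coords M \<omega> c (x + t *\<^sub>R u) v w) 0
      - deriv (\<lambda>t. form_coords M \<omega> c (x + t *\<^sub>R v) u w) 0
      + deriv (\<lambda>t. form_coords M \<omega> c (x + t *\<^sub>R w) u v) 0 = 0)"

definition nondegenerate_2form :: "('m, 'e::euclidean_space) manifold \<Rightarrow> 'm form2 \<Rightarrow> bool" where
  "nondegenerate_2form M \<omega> \<longleftrightarrow>
     (\<forall>p\<in>points M. \<forall>v\<in>tangent_space M p.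
        (\<forall>w\<in>tangent_space M p. \<omega> p v w = 0) \<longrightarrow> v = zero_tangent M p)"

definition symplectic_manifold :: "('m, 'e::euclidean_space) manifold \<Rightarrow> 'm form2 \<Rightarrow> bool" where
  "symplectic_manifold M \<omega> \<longleftrightarrow>
     smooth_manifold M \<and> smooth_2form M \<omega> \<and> closed_2form M \<omega> \<and> nondegenerate_2form M \<omega>"

definition symplectic_orthogonal ::
    "('m, 'e::euclidean_space) manifold \<Rightarrow> 'm form2 \<Rightarrow> 'm \<Rightarrow> 'm tangent set \<Rightarrow> 'm tangent set" where
  "symplectic_orthogonal M \<omega> p W = {v \<in> tangent_space M p. \<forall>w\<in>W. \<omega> p v w = 0}"

definition lagrangian_submanifold ::
    "('m, 'e::euclidean_space) manifold \<Rightarrow> 'm form2 \<Rightarrow> 'm set \<Rightarrow> bool" where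
  "lagrangian_submanifold M \<omega> S \<longleftrightarrow>
     (\<exists>k. embedded_submanifold M k S \<and>
        (\<forall>p\<in>S. symplectic_orthogonal M \<omega> p (submanifold_tangent_space M k S p)
                 = submanifold_tangent_space M k S p))"

definition opposite_form :: "'m form2 \<Rightarrow> 'm form2" where
  "opposite_form \<omega> = (\<lambda>p v w. - \<omega> p v w)"

definition pullback_form ::
    "('n, 'f::euclidean_space) manifold \<Rightarrow> ('m \<Rightarrow> 'n) \<Rightarrow> 'n form2 \<Rightarrow> 'm form2" where
  "pullback_form N f \<eta> = (\<lambda>p v w. \<eta> (f p) (tangent_map N f p v) (tangent_map N f p w))"

text \<open>The form of the product \<open>(M, \<omega>) \<times> (N, \<eta>)\<close> of symplectic manifolds.\<close>

definition prod_form ::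
    "('m, 'e::euclidean_space) manifold \<Rightarrow> 'm form2 \<Rightarrow> ('n, 'f::euclidean_space) manifold \<Rightarrow>
     'n form2 \<Rightarrow> ('m \<times> 'n) form2" where
  "prod_form M \<omega> N \<eta> = (\<lambda>p v w. pullback_form M fst \<omega> p v w + pullback_form N snd \<eta> p v w)"

section \<open>Symplectic groupoids\<close>

text \<open>
  The product \<open>m g h\<close> is relevant only for \<open>\<beta> g = \<alpha> h\<close>; \<open>\<epsilon> q\<close> is the identity at \<open>q\<close>.
\<close>

definition groupoid ::
    "'g set \<Rightarrow> 'q set \<Rightarrow> ('g \<Rightarrow> 'q) \<Rightarrow> ('g \<Rightarrow> 'q) \<Rightarrow> ('g \<Rightarrow> 'g \<Rightarrow> 'g) \<Rightarrow> ('q \<Rightarrow> 'g) \<Rightarrow> bool" where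
  "groupoid mor obj \<alpha> \<beta> m \<epsilon> \<longleftrightarrow>
     \<alpha> ` mor \<subseteq> obj \<and> \<beta> ` mor \<subseteq> obj \<and>
     (\<forall>g\<in>mor. \<forall>h\<in>mor. \<beta> g = \<alpha> h \<longrightarrow> m g h \<in> mor \<and> \<alpha> (m g h) = \<alpha> g \<and> \<beta> (m g h) = \<beta> h) \<and>
     (\<forall>g\<in>mor. \<forall>h\<in>mor. \<forall>k\<in>mor. \<beta> g = \<alpha> h \<and> \<beta> h = \<alpha> k \<longrightarrow> m (m g h) k = m g (m h k)) \<and>
     (\<forall>q\<in>obj. \<epsilon> q \<in> mor \<and> \<alpha> (\<epsilon> q) = q \<and> \<beta> (\<epsilon> q) = q) \<and>
     (\<forall>g\<in>mor. m (\<epsilon> (\<alpha> g)) g = g \<and> m g (\<epsilon> (\<beta> g)) = g) \<and>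
     (\<forall>g\<in>mor. \<exists>h\<in>mor. \<alpha> h = \<beta> g \<and> \<beta> h = \<alpha> g \<and> m g h = \<epsilon> (\<alpha> g) \<and> m h g = \<epsilon> (\<beta> g))"

definition composable_pairs :: "'g set \<Rightarrow> ('g \<Rightarrow> 'q) \<Rightarrow> ('g \<Rightarrow> 'q) \<Rightarrow> ('g \<times> 'g) set" where
  "composable_pairs mor \<alpha> \<beta> = {(g, h). g \<in> mor \<and> h \<in> mor \<and> \<beta> g = \<alpha> h}"

text \<open>
  For submersions \<open>\<alpha>\<close>, \<open>\<beta>\<close> the set of composable pairs is an embedded submanifold of \<open>G \<times> G\<close>,
  of dimension \<open>k = 2 * mdim G - mdim Q\<close> if it is nonempty; smoothness of the multiplication
  refers to this submanifold structure.
\<close>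

definition lie_groupoid ::
    "('g, 'e::euclidean_space) manifold \<Rightarrow> ('q, 'f::euclidean_space) manifold \<Rightarrow>
     ('g \<Rightarrow> 'q) \<Rightarrow> ('g \<Rightarrow> 'q) \<Rightarrow> ('g \<Rightarrow> 'g \<Rightarrow> 'g) \<Rightarrow> ('q \<Rightarrow> 'g) \<Rightarrow> bool" where
  "lie_groupoid G Q \<alpha> \<beta> m \<epsilon> \<longleftrightarrow>
     groupoid (points G) (points Q) \<alpha> \<beta> m \<epsilon> \<and>
     smooth_manifold G \<and> smooth_manifold Q \<and>
     submersion G Q \<alpha> \<and> submersion G Q \<beta> \<and>
     (\<exists>k. embedded_submanifold (prod_manifold G G) k (composable_pairs (points G) \<alpha> \<beta>) \<and>
          smooth_map (submanifold (prod_manifold G G) k (composable_pairs (points G) \<alpha> \<beta>)) G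
            (\<lambda>(g, h). m g h))"

definition multiplication_graph ::
    "'g set \<Rightarrow> ('g \<Rightarrow> 'q) \<Rightarrow> ('g \<Rightarrow> 'q) \<Rightarrow> ('g \<Rightarrow> 'g \<Rightarrow> 'g) \<Rightarrow> ('g \<times> 'g \<times> 'g) set" where
  "multiplication_graph mor \<alpha> \<beta> m =
     {(g, h, m g h) | g h. (g, h) \<in> composable_pairs mor \<alpha> \<beta>}"

definition symplectic_groupoid ::
    "('g, 'e::euclidean_space) manifold \<Rightarrow> ('q, 'f::euclidean_space) manifold \<Rightarrow>
     ('g \<Rightarrow> 'q) \<Rightarrow> ('g \<Rightarrow> 'q) \<Rightarrow> ('g \<Rightarrow> 'g \<Rightarrow> 'g) \<Rightarrow> ('q \<Rightarrow> 'g) \<Rightarrow> 'g form2 \<Rightarrow> bool" where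
  "symplectic_groupoid G P \<alpha> \<beta> m \<epsilon> \<omega> \<longleftrightarrow>
     lie_groupoid G P \<alpha> \<beta> m \<epsilon> \<and>
     symplectic_manifold G \<omega> \<and>
     lagrangian_submanifold
       (prod_manifold G (prod_manifold G G))
       (prod_form G (opposite_form \<omega>) (prod_manifold G G) (prod_form G (opposite_form \<omega>) G \<omega>))
       (multiplication_graph (points G) \<alpha> \<beta> m)"

end

theory Submission
  imports Defs
begin

text \<open>
  Let \<open>T\<close> denote tangent spaces and differentials. The heart of the matter is that in a symplectic groupoid the
  fibres of the source map and of the target map are symplectically orthogonal:
  \<open>\<omega> v w = 0\<close> if \<open>T \<beta> v = 0\<close> and \<open>T \<alpha> w = 0\<close>. Indeed, such \<open>v\<close> and \<open>w\<close> are velocities of curves \<open>\<gamma>\<close> in a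
  target fibre and \<open>\<delta>\<close> in a source fibre (\<open>submersion_fibre_curve\<close>). Both fit into curves
  \<open>(\<gamma>, h, \<gamma>)\<close> and \<open>(g, g\<inverse> \<cdot> \<delta>, \<delta>)\<close> in the graph of the multiplication, where \<open>h\<close> is the unit at \<open>\<beta> g\<close>,
  and the isotropy of the graph reads \<open>\<omega> v w = 0\<close> (\<open>source_target_fibres_orthogonal\<close>).

  Now suppose that \<open>\<alpha>\<close> restricts to a local diffeomorphism on the Lagrangian submanifold \<open>S\<close>. Then \<open>T \<alpha>\<close> maps
  \<open>T S\<close> bijectively onto the tangent space of the base (\<open>local_diffeomorphism_derivative_bij\<close>), so the base and \<open>S\<close> have
  the same dimension and \<open>T G\<close> is spanned by \<open>T S\<close> and the kernel of \<open>T \<alpha>\<close>. A vector of \<open>T S\<close> in the kernel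
  of \<open>T \<beta>\<close> is orthogonal to \<open>T S\<close>, which is isotropic, and to the kernel of \<open>T \<alpha>\<close>. It is thus orthogonal to
  everything and vanishes by nondegeneracy. Therefore \<open>T \<beta>\<close> is injective on \<open>T S\<close>, bijective by equality of
  dimensions, and the inverse function theorem makes \<open>\<beta>\<close> a local diffeomorphism on \<open>S\<close>
  (\<open>local_diffeomorphism_transfer\<close>, \<open>bij_derivative_imp_local_diffeomorphism\<close>). Orthogonality is symmetric, so source and
  target may be exchanged.

  The rest is the calculus that this argument takes for granted. Two tools carry it: the inverse function theorem
  with a smooth inverse (\<open>smooth_inverse_function\<close>), and the description of a smooth map in an arbitrary pair of charts
  together with its effect on velocities of curves (\<open>smooth_map_local_rep\<close>). Models of charts are linear
  subspaces of Euclidean spaces of unrelated dimension; an equation between models is solved by extending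
  the map to the whole surrounding space, by the identity in the directions transversal to the model.
\<close>

section \<open>Calculus of C^k maps on open sets\<close>

text \<open>
  The directional derivatives in the definition of \<open>C_k_on_open\<close> are taken in the whole space, so
  equality on an open set is inherited by all of them.
\<close>

lemma C_k_on_open_cong:
  assumes "open U" and "\<And>x. x \<in> U \<Longrightarrow> f x = g x" and "C_k_on_open k U f"
  shows "C_k_on_open k U g"
  using assms(2,3)
proof (induction k arbitrary: f g)
  case 0
  then show ?case by (auto cong: continuous_on_cong)
next
  case (Suc k)
  have d: "(g has_derivative frechet_derivative f (at x)) (at x)" if "x \<in> U" for x
  proof (rule has_derivative_transform_within_open[OF _ assms(1) that])
    show "(f has_derivative frechet_derivative f (at x)) (at x)"
      using that Suc.prems(2) frechet_derivative_works[of f "at x"] by auto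
  qed (use Suc.prems(1) in auto)
  then have eq: "frechet_derivative f (at x) = frechet_derivative g (at x)" if "x \<in> U" for x
    using that frechet_derivative_at by blast
  show ?case
    using d eq Suc.IH[of "\<lambda>x. frechet_derivative f (at x) v" "\<lambda>x. frechet_derivative g (at x) v" for v] Suc.prems(2)
    by (auto simp: differentiable_def)
qed

lemma C_k_on_open_SucI:
  assumes "open U"
    and "\<And>x. x \<in> U \<Longrightarrow> (f has_derivative f' x) (at x)"
    and "\<And>v. C_k_on_open k U (\<lambda>x. f' x v)"
  shows "C_k_on_open (Suc k) U f"
proof -
  have "frechet_derivative f (at x) = f' x" if "x \<in> U" for x
    using assms(2)[OF that] frechet_derivative_at by metis
  then show ?thesis
    using assms C_k_on_open_cong[OF assms(1), of "\<lambda>x. f' x v" "\<lambda>x. frechet_derivative f (at x) v" for v]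
    by (auto simp: differentiable_def)
qed

lemma C_k_on_open_Suc_has_derivative:
  assumes "C_k_on_open (Suc k) U f" "x \<in> U"
  shows "(f has_derivative frechet_derivative f (at x)) (at x)"
  using assms frechet_derivative_works[of f "at x"] by auto

lemma C_k_on_open_Suc_imp: "C_k_on_open (Suc k) U f \<Longrightarrow> C_k_on_open k U f"
proof (induction k arbitrary: f)
  case 0
  then show ?case
    by (auto intro!: continuous_at_imp_continuous_on differentiable_imp_continuous_within)
next
  case (Suc k)
  then show ?case by auto
qed

lemma C_k_on_open_subset: "C_k_on_open k U f \<Longrightarrow> V \<subseteq> U \<Longrightarrow> C_k_on_open k V f"
  by (induction k arbitrary: f) (auto intro: continuous_on_subset)

lemma C_k_on_open_const: "open U \<Longrightarrow> C_k_on_open k U (\<lambda>x. c)"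
proof (induction k arbitrary: c)
  case (Suc k)
  then show ?case by (intro C_k_on_open_SucI[where f' = "\<lambda>x v. 0"]) auto
qed auto

lemma C_k_on_open_linear_compose:
  assumes "open U" "bounded_linear L" "C_k_on_open k U f"
  shows "C_k_on_open k U (\<lambda>x. L (f x))"
  using assms(3)
proof (induction k arbitrary: f)
  case 0
  then show ?case using assms(2) by (auto intro: bounded_linear.continuous_on)
next
  case (Suc k)
  show ?case
  proof (rule C_k_on_open_SucI[OF assms(1)])
    fix x assume "x \<in> U"
    then show "((\<lambda>x. L (f x)) has_derivative (\<lambda>v. L (frechet_derivative f (at x) v))) (at x)"
      using bounded_linear.has_derivative[OF assms(2) C_k_on_open_Suc_has_derivative[OF Suc.prems]]
      by blast
  qed (use Suc in auto)
qed

lemma C_k_on_open_linear: "open U \<Longrightarrow> bounded_linear L \<Longrightarrow> C_k_on_open k U L"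
proof (induction k)
  case 0
  then show ?case by (auto intro: linear_continuous_on)
next
  case (Suc k)
  then show ?case
    by (intro C_k_on_open_SucI[where f' = "\<lambda>x. L"] bounded_linear_imp_has_derivative C_k_on_open_const)
qed

lemma C_k_on_open_add:
  assumes "open U"
  shows "C_k_on_open k U f \<Longrightarrow> C_k_on_open k U g \<Longrightarrow> C_k_on_open k U (\<lambda>x. f x + g x)"
proof (induction k arbitrary: f g)
  case 0
  then show ?case by (auto intro: continuous_intros)
next
  case (Suc k)
  then show ?case
    by (intro C_k_on_open_SucI[OF assms, where f' = "\<lambda>x v. frechet_derivative f (at x) v + frechet_derivative g (at x) v"])
       (auto intro!: has_derivative_add simp: frechet_derivative_works[symmetric])
qed

lemma C_k_on_open_sum:
  assumes "open U" "finite I" "\<And>i. i \<in> I \<Longrightarrow> C_k_on_open k U (f i)"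
  shows "C_k_on_open k U (\<lambda>x. \<Sum>i\<in>I. f i x)"
  using assms(2,3)
  by (induction I) (auto intro: C_k_on_open_add C_k_on_open_const assms(1))

lemma C_k_on_open_scaleR:
  fixes r :: "'a::euclidean_space \<Rightarrow> real" and f :: "'a \<Rightarrow> 'b::euclidean_space"
  assumes "open U"
  shows "C_k_on_open k U r \<Longrightarrow> C_k_on_open k U f \<Longrightarrow> C_k_on_open k U (\<lambda>x. r x *\<^sub>R f x)"
proof (induction k arbitrary: f r)
  case 0
  then show ?case by (auto intro: continuous_intros)
next
  case (Suc k)
  have 1: "C_k_on_open k U r" "C_k_on_open k U f"
    using Suc.prems C_k_on_open_Suc_imp by blast+
  show ?case
    using Suc 1
    by (intro C_k_on_open_SucI[OF assms, where f' = "\<lambda>x v. r x *\<^sub>R frechet_derivative f (at x) v + frechet_derivative r (at x) v *\<^sub>R f x"])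
       (auto intro!: has_derivative_scaleR C_k_on_open_add[OF assms] simp: frechet_derivative_works[symmetric])
qed

text \<open>
  The chain rule writes a directional derivative of \<open>f \<circ> g\<close> as a combination of the partial derivatives
  of \<open>f\<close>, composed with \<open>g\<close>, whose coefficients are the components of a directional derivative of \<open>g\<close>.
  All ingredients have one derivative less, which makes the induction on \<open>k\<close> work for arbitrary \<open>f\<close>.
\<close>

lemma C_k_on_open_compose:
  fixes f :: "'b::euclidean_space \<Rightarrow> 'c::euclidean_space" and g :: "'a::euclidean_space \<Rightarrow> 'b"
  assumes "open U" "open V" "g ` U \<subseteq> V" "C_k_on_open k U g" "C_k_on_open k V f"
  shows "C_k_on_open k U (\<lambda>x. f (g x))"
  using assms(4,5)
proof (induction k arbitrary: f)
  case 0
  then show ?case using assms(3) by (auto intro: continuous_on_compose2)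
next
  case (Suc k)
  let ?f' = "\<lambda>x. frechet_derivative f (at x)" and ?g' = "\<lambda>x. frechet_derivative g (at x)"
  have k: "C_k_on_open k U g" using Suc.prems C_k_on_open_Suc_imp by blast
  have f': "(f has_derivative ?f' (g x)) (at (g x))" and g': "(g has_derivative ?g' x) (at x)" if "x \<in> U" for x
    using Suc.prems assms(3) that by (auto simp: frechet_derivative_works[symmetric])
  have eq: "?f' (g x) (?g' x v) = (\<Sum>b\<in>Basis. (?g' x v \<bullet> b) *\<^sub>R ?f' (g x) b)" if "x \<in> U" for x v
  proof -
    have "linear (?f' (g x))" using f'[OF that] has_derivative_linear by blast
    then have "?f' (g x) (\<Sum>b\<in>Basis. (?g' x v \<bullet> b) *\<^sub>R b) = (\<Sum>b\<in>Basis. (?g' x v \<bullet> b) *\<^sub>R ?f' (g x) b)"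
      by (simp add: linear_sum linear_cmul)
    then show ?thesis by (simp add: euclidean_representation)
  qed
  show ?case
  proof (rule C_k_on_open_SucI[OF assms(1)])
    fix x assume x: "x \<in> U"
    show "((\<lambda>x. f (g x)) has_derivative (\<lambda>v. \<Sum>b\<in>Basis. (?g' x v \<bullet> b) *\<^sub>R ?f' (g x) b)) (at x)"
      using diff_chain_at[OF g'[OF x] f'[OF x]] eq[OF x] by (simp add: o_def)
  next
    fix v
    show "C_k_on_open k U (\<lambda>x. \<Sum>b\<in>Basis. (?g' x v \<bullet> b) *\<^sub>R ?f' (g x) b)"
      using Suc.prems
      by (intro C_k_on_open_sum C_k_on_open_scaleR assms(1) Suc.IH[OF k]
            C_k_on_open_linear_compose[OF assms(1) bounded_linear_inner_left]) auto
  qed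
qed

lemma C_k_on_open_Pair:
  assumes "open U" "C_k_on_open k U f" "C_k_on_open k U g"
  shows "C_k_on_open k U (\<lambda>x. (f x, g x))"
proof -
  have "C_k_on_open k U (\<lambda>x. (f x, 0) + (0, g x))"
    by (intro C_k_on_open_add assms C_k_on_open_linear_compose[where L = "\<lambda>x. (x, 0)"]
        C_k_on_open_linear_compose[where L = "\<lambda>x. (0, x)"] bounded_linear_Pair
        bounded_linear_ident bounded_linear_zero)
  then show ?thesis by simp
qed

section \<open>The smooth inverse function theorem\<close>

text \<open>
  Near \<open>x0\<close> the maps \<open>L x\<close> differ from
  \<open>L x0\<close> by a small amount on a basis, so they are bounded below by a fixed positive constant and the
  inverses are bounded by \<open>2 * K\<close>, twice a bound for \<open>M x0\<close>; then
  \<open>M x w - M x0 w = M x (L x0 u - L x u)\<close> with \<open>u = M x0 w\<close> tends to 0.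
\<close>

lemma inverse_family_continuous_at:
  fixes L :: "'a::euclidean_space \<Rightarrow> 'b::euclidean_space \<Rightarrow> 'c::euclidean_space"
  assumes "open U" "x0 \<in> U"
    and lin: "\<And>x. x \<in> U \<Longrightarrow> linear (L x)" "\<And>x. x \<in> U \<Longrightarrow> linear (M x)"
    and inv: "\<And>x w. x \<in> U \<Longrightarrow> L x (M x w) = w" "\<And>x w. x \<in> U \<Longrightarrow> M x (L x w) = w"
    and cont: "\<And>v. continuous_on U (\<lambda>x. L x v)"
  shows "isCont (\<lambda>x. M x w) x0"
proof -
  have contv: "isCont (\<lambda>x. L x v) x0" for v
    using cont[of v] assms(1,2) continuous_on_eq_continuous_at by blast
  obtain K where K: "K > 0" "\<And>w. norm (M x0 w) \<le> norm w * K"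
    using bounded_linear.pos_bounded[of "M x0"] lin(2)[OF assms(2)] linear_conv_bounded_linear by blast
  let ?h = "\<lambda>x. \<Sum>b\<in>Basis. norm (L x b - L x0 b)"
  have "isCont ?h x0"
    by (intro continuous_intros contv)
  then have "(?h \<longlongrightarrow> 0) (at x0)" by (simp add: isCont_def)
  then have "eventually (\<lambda>x. ?h x < 1 / (2 * K)) (at x0)"
    by (rule order_tendstoD) (use K in auto)
  moreover have "eventually (\<lambda>x. x \<in> U) (at x0)"
    using assms(1,2) by (metis eventually_at_topological)
  ultimately have bd: "eventually (\<lambda>x. \<forall>w. norm (M x w) \<le> 2 * K * norm w) (at x0)"
  proof eventually_elim
    case (elim x)
    show ?case
    proof
      fix w
      define v where "v = M x w"
      have "L x v - L x0 v = (\<Sum>b\<in>Basis. (v \<bullet> b) *\<^sub>R (L x b - L x0 b))"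
      proof -
        have "L y v = (\<Sum>b\<in>Basis. (v \<bullet> b) *\<^sub>R L y b)" if "y \<in> U" for y
        proof -
          have "L y (\<Sum>b\<in>Basis. (v \<bullet> b) *\<^sub>R b) = (\<Sum>b\<in>Basis. (v \<bullet> b) *\<^sub>R L y b)"
            using lin(1)[OF that] by (simp add: linear_sum linear_cmul)
          then show ?thesis by (simp add: euclidean_representation)
        qed
        then show ?thesis using elim assms(2) by (simp add: scaleR_diff_right sum_subtractf)
      qed
      also have "norm \<dots> \<le> (\<Sum>b\<in>Basis. norm ((v \<bullet> b) *\<^sub>R (L x b - L x0 b)))" by (rule norm_sum)
      also have "\<dots> \<le> (\<Sum>b\<in>Basis. norm v * norm (L x b - L x0 b))"
        by (intro sum_mono) (auto intro!: mult_right_mono Basis_le_norm)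
      also have "\<dots> = norm v * ?h x" by (simp add: sum_distrib_left)
      also have "\<dots> \<le> norm v * (1 / (2 * K))" using elim by (intro mult_left_mono) auto
      finally have "norm (L x v - L x0 v) \<le> norm v * (1 / (2 * K))" .
      moreover have "norm v \<le> norm (L x0 v) * K"
        using K(2)[of "L x0 v"] inv(2)[OF assms(2)] by simp
      moreover have "norm (L x0 v) \<le> norm (L x v) + norm (L x v - L x0 v)"
        by norm
      ultimately have "norm v \<le> (norm (L x v) + norm v * (1 / (2 * K))) * K"
        using K(1) by (smt (verit) mult_right_mono)
      then have "norm v \<le> norm (L x v) * K + norm v / 2"
        using K(1) by (simp add: field_simps)
      then show "norm (M x w) \<le> 2 * K * norm w"
        using inv(1) elim unfolding v_def by (simp add: algebra_simps)
    qed
  qed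
  let ?u = "M x0 w"
  have "((\<lambda>x. 2 * K * norm (L x0 ?u - L x ?u)) \<longlongrightarrow> 2 * K * norm (L x0 ?u - L x0 ?u)) (at x0)"
    using contv[of ?u] unfolding isCont_def by (intro tendsto_intros)
  then have lim: "((\<lambda>x. 2 * K * norm (L x0 ?u - L x ?u)) \<longlongrightarrow> 0) (at x0)" by simp
  have "eventually (\<lambda>x. x \<in> U) (at x0)"
    using assms(1,2) by (metis eventually_at_topological)
  with bd have "eventually (\<lambda>x. norm (M x w - M x0 w) \<le> 2 * K * norm (L x0 ?u - L x ?u)) (at x0)"
  proof eventually_elim
    case (elim x)
    have "M x (L x0 ?u - L x ?u) = M x w - M x0 w"
      using elim inv assms(2) lin(2)[of x] by (simp add: linear_diff)
    then show ?case using elim by metis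
  qed
  then have "((\<lambda>x. M x w - M x0 w) \<longlongrightarrow> 0) (at x0)"
    using lim by (rule Lim_null_comparison)
  then show ?thesis unfolding isCont_def using LIM_zero_iff by blast
qed

text \<open>
  A product rule in which one factor is merely continuous, at the price that the other one vanishes at the
  point. It differentiates an inverse family before that family is known to be differentiable.
\<close>

lemma has_derivative_vanishing_scaleR:
  fixes \<phi> :: "'a::euclidean_space \<Rightarrow> real" and \<psi> :: "'a \<Rightarrow> 'b::euclidean_space"
  assumes "(\<phi> has_derivative \<phi>') (at x)" "\<phi> x = 0" "isCont \<psi> x"
  shows "((\<lambda>y. \<phi> y *\<^sub>R \<psi> y) has_derivative (\<lambda>h. \<phi>' h *\<^sub>R \<psi> x)) (at x)"
proof -
  obtain K where K: "\<And>h. norm (\<phi>' h) \<le> norm h * K"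
    using assms(1) has_derivative_bounded_linear bounded_linear.pos_bounded by blast
  have 1: "((\<lambda>y. \<phi> y *\<^sub>R \<psi> x) has_derivative (\<lambda>h. \<phi>' h *\<^sub>R \<psi> x)) (at x)"
    using assms(1) by (rule has_derivative_scaleR_left)
  have q: "((\<lambda>y. (\<phi> y - \<phi> x - \<phi>' (y - x)) /\<^sub>R norm (y - x)) \<longlongrightarrow> 0) (at x)"
    using assms(1) unfolding has_derivative_at_within by auto
  have c: "((\<lambda>y. \<psi> y - \<psi> x) \<longlongrightarrow> 0) (at x)"
    using assms(3) unfolding isCont_def using LIM_zero_iff by blast
  have p: "((\<lambda>y. ((\<phi> y - \<phi> x - \<phi>' (y - x)) /\<^sub>R norm (y - x)) *\<^sub>R (\<psi> y - \<psi> x)) \<longlongrightarrow> 0 *\<^sub>R 0) (at x)"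
    using q c by (rule tendsto_scaleR)
  have "((\<lambda>y. K * norm (\<psi> y - \<psi> x)) \<longlongrightarrow> K * norm (0::'b)) (at x)"
    using c by (intro tendsto_intros)
  then have lim2: "((\<lambda>y. K * norm (\<psi> y - \<psi> x)) \<longlongrightarrow> 0) (at x)" by simp
  have "norm ((\<phi>' (y - x) /\<^sub>R norm (y - x)) *\<^sub>R (\<psi> y - \<psi> x)) \<le> K * norm (\<psi> y - \<psi> x)" if "y \<noteq> x" for y
  proof -
    have "norm (\<phi>' (y - x) /\<^sub>R norm (y - x)) \<le> K"
      using K[of "y - x"] that by (simp add: divide_simps mult.commute)
    then show ?thesis by (simp add: mult_right_mono)
  qed
  then have "eventually (\<lambda>y. norm ((\<phi>' (y - x) /\<^sub>R norm (y - x)) *\<^sub>R (\<psi> y - \<psi> x)) \<le> K * norm (\<psi> y - \<psi> x)) (at x)"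
    by (metis (mono_tags, lifting) eventually_at_topological open_UNIV UNIV_I)
  then have r: "((\<lambda>y. (\<phi>' (y - x) /\<^sub>R norm (y - x)) *\<^sub>R (\<psi> y - \<psi> x)) \<longlongrightarrow> 0) (at x)"
    using lim2 by (rule Lim_null_comparison)
  have "((\<lambda>y. (\<phi> y *\<^sub>R (\<psi> y - \<psi> x)) /\<^sub>R norm (y - x)) \<longlongrightarrow> 0) (at x)"
  proof -
    have "(\<phi> y *\<^sub>R (\<psi> y - \<psi> x)) /\<^sub>R norm (y - x) =
      ((\<phi> y - \<phi> x - \<phi>' (y - x)) /\<^sub>R norm (y - x)) *\<^sub>R (\<psi> y - \<psi> x)
       + (\<phi>' (y - x) /\<^sub>R norm (y - x)) *\<^sub>R (\<psi> y - \<psi> x)" for y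
    proof -
      have *: "\<phi> y - \<phi> x - \<phi>' (y - x) + \<phi>' (y - x) = \<phi> y" using assms(2) by simp
      show ?thesis
        unfolding scaleR_left_distrib[symmetric] scaleR_right_distrib[symmetric] * by simp
    qed
    then show ?thesis using tendsto_add[OF p r] by simp
  qed
  then have 2: "((\<lambda>y. \<phi> y *\<^sub>R (\<psi> y - \<psi> x)) has_derivative (\<lambda>h. 0)) (at x)"
    unfolding has_derivative_at_within by (simp add: assms(2))
  show ?thesis using has_derivative_add[OF 1 2] by (simp add: scaleR_diff_right)
qed

text \<open>
  With \<open>u = M x w\<close> the identity
  \<open>M y w = M x w - M y (L y u - L x u)\<close> expresses \<open>M y w\<close> near \<open>x\<close> through products of a differentiable
  function that vanishes at \<open>x\<close> with a continuous one. The resulting derivative \<open>- M x (L' (M x w))\<close>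
  contains \<open>M\<close> itself and the first derivatives of \<open>L\<close>, so the induction on \<open>k\<close> applies to it.
\<close>

lemma C_k_on_open_inverse_family:
  fixes L :: "'a::euclidean_space \<Rightarrow> 'b::euclidean_space \<Rightarrow> 'c::euclidean_space"
  assumes "open U"
    and lin: "\<And>x. x \<in> U \<Longrightarrow> linear (L x)" "\<And>x. x \<in> U \<Longrightarrow> linear (M x)"
    and inv: "\<And>x w. x \<in> U \<Longrightarrow> L x (M x w) = w" "\<And>x w. x \<in> U \<Longrightarrow> M x (L x w) = w"
    and C: "\<And>v. C_k_on_open k U (\<lambda>x. L x v)"
  shows "C_k_on_open k U (\<lambda>x. M x w)"
  using C
proof (induction k arbitrary: w)
  case 0
  then have "isCont (\<lambda>x. M x w) x" if "x \<in> U" for x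
    using that inverse_family_continuous_at[OF assms(1) that lin inv] by auto
  then show ?case using continuous_at_imp_continuous_on by auto
next
  case (Suc k)
  have Ck: "C_k_on_open k U (\<lambda>x. L x v)" for v
    using Suc.prems C_k_on_open_Suc_imp by blast
  have IH: "C_k_on_open k U (\<lambda>x. M x w)" for w
    using Suc.IH[OF Ck] .
  have cont: "continuous_on U (\<lambda>x. L x v)" for v
    using Suc.prems[of v]
    by (auto intro!: continuous_at_imp_continuous_on differentiable_imp_continuous_within)
  have contM: "isCont (\<lambda>x. M x w) x" if "x \<in> U" for x w
    using inverse_family_continuous_at[OF assms(1) that lin inv cont] by simp
  let ?D = "\<lambda>x v h. frechet_derivative (\<lambda>x. L x v) (at x) h"
  let ?M' = "\<lambda>x h. \<Sum>c\<in>Basis. - (\<Sum>b\<in>Basis. (M x w \<bullet> b) *\<^sub>R (?D x b h \<bullet> c)) *\<^sub>R M x c"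
  show ?case
  proof (rule C_k_on_open_SucI[OF assms(1)])
    fix x assume x: "x \<in> U"
    define u where "u = M x w"
    let ?\<phi> = "\<lambda>c y. - ((L y u - L x u) \<bullet> c)"
    have Lu: "L y u = (\<Sum>b\<in>Basis. (u \<bullet> b) *\<^sub>R L y b)" if "y \<in> U" for y
    proof -
      have "L y (\<Sum>b\<in>Basis. (u \<bullet> b) *\<^sub>R b) = (\<Sum>b\<in>Basis. (u \<bullet> b) *\<^sub>R L y b)"
        using lin(1)[OF that] by (simp add: linear_sum linear_cmul)
      then show ?thesis by (simp add: euclidean_representation)
    qed
    have Dv: "((\<lambda>x. L x v) has_derivative ?D x v) (at x)" for v
      using C_k_on_open_Suc_has_derivative[OF Suc.prems x] .
    have "((\<lambda>y. \<Sum>b\<in>Basis. (u \<bullet> b) *\<^sub>R L y b) has_derivative (\<lambda>h. \<Sum>b\<in>Basis. (u \<bullet> b) *\<^sub>R ?D x b h)) (at x)"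
      by (intro has_derivative_sum has_derivative_scaleR_right Dv)
    then have "((\<lambda>y. L y u) has_derivative (\<lambda>h. \<Sum>b\<in>Basis. (u \<bullet> b) *\<^sub>R ?D x b h)) (at x)"
      by (rule has_derivative_transform_within_open[OF _ assms(1) x]) (simp add: Lu)
    then have "((\<lambda>y. L y u - L x u) has_derivative (\<lambda>h. (\<Sum>b\<in>Basis. (u \<bullet> b) *\<^sub>R ?D x b h) - 0)) (at x)"
      by (rule has_derivative_diff) (rule has_derivative_const)
    then have "(?\<phi> c has_derivative (\<lambda>h. - (((\<Sum>b\<in>Basis. (u \<bullet> b) *\<^sub>R ?D x b h) - 0) \<bullet> c))) (at x)" for c
      by (intro has_derivative_minus has_derivative_inner_left)
    then have "((\<lambda>y. ?\<phi> c y *\<^sub>R M y c) has_derivative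
        (\<lambda>h. (- (((\<Sum>b\<in>Basis. (u \<bullet> b) *\<^sub>R ?D x b h) - 0) \<bullet> c)) *\<^sub>R M x c)) (at x)" for c
      by (rule has_derivative_vanishing_scaleR) (auto intro: contM x)
    then have "((\<lambda>y. M x w + (\<Sum>c\<in>Basis. ?\<phi> c y *\<^sub>R M y c)) has_derivative
        (\<lambda>h. 0 + (\<Sum>c\<in>Basis. (- (((\<Sum>b\<in>Basis. (u \<bullet> b) *\<^sub>R ?D x b h) - 0) \<bullet> c)) *\<^sub>R M x c))) (at x)"
      by (intro has_derivative_add has_derivative_const has_derivative_sum)
    moreover have "M x w + (\<Sum>c\<in>Basis. ?\<phi> c y *\<^sub>R M y c) = M y w" if "y \<in> U" for y
    proof -
      have "M y (L y u - L x u) = M y (\<Sum>c\<in>Basis. ((L y u - L x u) \<bullet> c) *\<^sub>R c)"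
        by (simp add: euclidean_representation)
      also have "\<dots> = (\<Sum>c\<in>Basis. ((L y u - L x u) \<bullet> c) *\<^sub>R M y c)"
        using lin(2)[OF that] by (simp add: linear_sum linear_cmul)
      finally have "(\<Sum>c\<in>Basis. ?\<phi> c y *\<^sub>R M y c) = - M y (L y u - L x u)"
        by (simp add: sum_negf)
      also have "\<dots> = M y w - M x w"
        using lin(2)[OF that] inv x that by (simp add: linear_diff u_def)
      finally show ?thesis by simp
    qed
    ultimately have "((\<lambda>x. M x w) has_derivative
        (\<lambda>h. 0 + (\<Sum>c\<in>Basis. (- (((\<Sum>b\<in>Basis. (u \<bullet> b) *\<^sub>R ?D x b h) - 0) \<bullet> c)) *\<^sub>R M x c))) (at x)"
      by (rule has_derivative_transform_within_open[OF _ assms(1) x])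
    then show "((\<lambda>x. M x w) has_derivative ?M' x) (at x)"
      by (simp only: inner_sum_left u_def add_0_left diff_0_right inner_scaleR_left real_scaleR_def)
  next
    fix h
    show "C_k_on_open k U (\<lambda>x. ?M' x h)"
      using Suc.prems
      by (intro C_k_on_open_sum C_k_on_open_scaleR assms(1) IH finite_Basis
            C_k_on_open_linear_compose[OF assms(1) bounded_linear_inner_left]
            C_k_on_open_linear_compose[OF assms(1) bounded_linear_minus[OF bounded_linear_ident]]) auto
  qed
qed

text \<open>
  The classical theorem provides a differentiable inverse whose derivative at \<open>y\<close> is the inverse of the
  derivative of \<open>f\<close> at \<open>g y\<close>. If \<open>g\<close> is \<open>C^k\<close>, then so is this derivative, being a composition of the smooth
  family of inverse matrices with \<open>g\<close>; hence \<open>g\<close> is \<open>C^(k+1)\<close>.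
\<close>

theorem smooth_inverse_function:
  fixes f :: "'a::euclidean_space \<Rightarrow> 'a"
  assumes "open U" "x0 \<in> U" and C: "\<And>k. C_k_on_open k U f"
    and inj: "inj (frechet_derivative f (at x0))"
  obtains U' V g where "open U'" "U' \<subseteq> U" "x0 \<in> U'" "open V" "f x0 \<in> V" "homeomorphism U' V f g"
    "\<And>k. C_k_on_open k V g"
    "(g has_derivative inv (frechet_derivative f (at x0))) (at (f x0))"
proof -
  let ?D = "\<lambda>x. frechet_derivative f (at x)"
  have D: "(f has_derivative ?D x) (at x)" if "x \<in> U" for x
    using C_k_on_open_Suc_has_derivative[OF C that] .
  have bl: "bounded_linear (?D x)" if "x \<in> U" for x
    using D[OF that] has_derivative_bounded_linear by blast
  define f' where "f' x = Blinfun (?D x)" for x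
  have f': "blinfun_apply (f' x) = ?D x" if "x \<in> U" for x
    unfolding f'_def using bl[OF that] by (rule bounded_linear_Blinfun_apply)
  have cD: "continuous_on U (\<lambda>x. ?D x v)" for v
    using C[of "Suc 0"] by simp
  have cont: "continuous_on U f'"
    by (rule continuous_on_blinfun_componentwise) (use cD f' in \<open>auto cong: continuous_on_cong\<close>)
  have lin0: "linear (?D x0)" using bl[OF assms(2)] bounded_linear.linear by blast
  obtain h where h: "linear h" "h \<circ> ?D x0 = id"
    using linear_injective_left_inverse[OF lin0 inj] by blast
  then have inv: "Blinfun h o\<^sub>L f' x0 = id_blinfun"
    using f'[OF assms(2)] h(1)
    by (intro blinfun_eqI) (auto simp: bounded_linear_Blinfun_apply linear_conv_bounded_linear o_def id_def fun_eq_iff)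
  obtain U' V g g' where *: "open U'" "U' \<subseteq> U" "x0 \<in> U'" "open V" "f x0 \<in> V" "homeomorphism U' V f g"
    "\<And>y. y \<in> V \<Longrightarrow> (g has_derivative (g' y)) (at y)"
    "\<And>y. y \<in> V \<Longrightarrow> g' y = Hilbert_Choice.inv (blinfun_apply (f'(g y)))"
    "\<And>y. y \<in> V \<Longrightarrow> bij (blinfun_apply (f'(g y)))"
    using inverse_function_theorem[OF assms(1) _ cont assms(2) inv] D f' by metis
  have gV: "g ` V = U'" "f ` U' = V" and gf: "\<And>x. x \<in> U' \<Longrightarrow> g (f x) = x"
    using *(6) by (auto simp: homeomorphism_def)
  define M where "M x = Hilbert_Choice.inv (?D x)" for x
  have bij: "bij (?D x)" if "x \<in> U'" for x
  proof -
    have "x \<in> g ` V" using that gV(1) by simp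
    then obtain y where "y \<in> V" "x = g y" by (rule imageE)
    then show ?thesis using *(9)[of y] f'[of x] *(2) that by (simp add: subset_iff)
  qed
  have lin: "linear (?D x)" if "x \<in> U'" for x
    using bl *(2) that bounded_linear.linear by blast
  have linM: "linear (M x)" if "x \<in> U'" for x
    unfolding M_def by (rule inj_linear_imp_inv_linear[OF lin[OF that] bij_is_inj[OF bij[OF that]]])
  have M: "C_k_on_open k U' (\<lambda>x. M x w)" for k w
  proof (rule C_k_on_open_inverse_family[OF *(1) lin linM])
    show "C_k_on_open k U' (\<lambda>x. ?D x v)" for v
      using C[of "Suc k"] *(2) by (auto intro: C_k_on_open_subset)
  qed (use bij in \<open>auto simp: M_def bij_is_surj surj_f_inv_f bij_is_inj\<close>)
  have g'M: "g' y = M (g y)" if "y \<in> V" for y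
    using *(8)[OF that] that gV *(2) f' unfolding M_def by (metis image_eqI subsetD)
  have "C_k_on_open k V g" for k
  proof (induction k)
    case 0
    show ?case using *(6) by (auto simp: homeomorphism_def)
  next
    case (Suc k)
    show ?case
    proof (rule C_k_on_open_SucI[OF *(4)])
      show "(g has_derivative M (g y)) (at y)" if "y \<in> V" for y
        using *(7)[OF that] g'M[OF that] by simp
      show "C_k_on_open k V (\<lambda>x. M (g x) v)" for v
        using C_k_on_open_compose[OF *(4,1) _ Suc.IH M] gV by auto
    qed
  qed
  moreover have "(g has_derivative Hilbert_Choice.inv (?D x0)) (at (f x0))"
    using *(7)[OF *(5)] g'M[OF *(5)] gf[OF *(3)] by (simp add: M_def)
  ultimately show ?thesis using that * by blast
qed


section \<open>Smooth maps on arbitrary subsets\<close>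

lemma smooth_onI:
  assumes "\<And>x. x \<in> S \<Longrightarrow> \<exists>U F. open U \<and> x \<in> U \<and> (\<forall>k. C_k_on_open k U F) \<and> (\<forall>y\<in>U \<inter> S. F y = f y)"
  shows "smooth_on S f"
  using assms unfolding smooth_on_def by blast

lemma smooth_onE:
  assumes "smooth_on S f" "x \<in> S"
  obtains U F where "open U" "x \<in> U" "\<And>k. C_k_on_open k U F" "\<And>y. y \<in> U \<Longrightarrow> y \<in> S \<Longrightarrow> F y = f y"
  using assms unfolding smooth_on_def by (metis IntI)

lemma smooth_on_C_k:
  assumes "open U" "\<And>k. C_k_on_open k U f"
  shows "smooth_on U f"
  using assms unfolding smooth_on_def by blast

lemma smooth_on_subset: "smooth_on S f \<Longrightarrow> T \<subseteq> S \<Longrightarrow> smooth_on T f"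
proof (rule smooth_onI)
  fix x assume "smooth_on S f" "T \<subseteq> S" "x \<in> T"
  moreover then obtain U F where "open U" "x \<in> U" "\<And>k. C_k_on_open k U F" "\<And>y. y \<in> U \<Longrightarrow> y \<in> S \<Longrightarrow> F y = f y"
    using smooth_onE[of S f x] by blast
  ultimately show "\<exists>U F. open U \<and> x \<in> U \<and> (\<forall>k. C_k_on_open k U F) \<and> (\<forall>y\<in>U \<inter> T. F y = f y)"
    by (intro exI[of _ U] exI[of _ F]) auto
qed

lemma smooth_on_cong: "smooth_on S f \<Longrightarrow> (\<And>x. x \<in> S \<Longrightarrow> f x = g x) \<Longrightarrow> smooth_on S g"
  unfolding smooth_on_def by simp

lemma smooth_on_local:
  assumes "\<And>x. x \<in> S \<Longrightarrow> \<exists>V. open V \<and> x \<in> V \<and> smooth_on (S \<inter> V) f"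
  shows "smooth_on S f"
proof (rule smooth_onI)
  fix x assume x: "x \<in> S"
  then obtain V where V: "open V" "x \<in> V" "smooth_on (S \<inter> V) f" using assms by blast
  obtain U F where U: "open U" "x \<in> U" "\<And>k. C_k_on_open k U F" "\<And>y. y \<in> U \<Longrightarrow> y \<in> S \<inter> V \<Longrightarrow> F y = f y"
    using smooth_onE[OF V(3), of x] V(2) x by auto
  show "\<exists>U F. open U \<and> x \<in> U \<and> (\<forall>k. C_k_on_open k U F) \<and> (\<forall>y\<in>U \<inter> S. F y = f y)"
  proof (intro exI conjI allI ballI)
    show "open (U \<inter> V)" "x \<in> U \<inter> V" using U V by auto
    show "C_k_on_open k (U \<inter> V) F" for k using U(3) by (rule C_k_on_open_subset) auto
    show "F y = f y" if "y \<in> U \<inter> V \<inter> S" for y using U(4) that by auto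
  qed
qed

lemma smooth_on_linear: "bounded_linear L \<Longrightarrow> smooth_on S L"
  by (rule smooth_on_subset[OF smooth_on_C_k[OF open_UNIV C_k_on_open_linear[OF open_UNIV]]]) auto

lemma smooth_on_const: "smooth_on S (\<lambda>x. c)"
  by (rule smooth_on_subset[OF smooth_on_C_k[OF open_UNIV C_k_on_open_const[OF open_UNIV]]]) auto

lemma smooth_on_id: "smooth_on S (\<lambda>x. x)"
  by (rule smooth_on_linear) (rule bounded_linear_ident)

lemma C_k_imp_continuous: "C_k_on_open k U f \<Longrightarrow> continuous_on U f"
  by (induction k) (auto dest: C_k_on_open_Suc_imp simp del: C_k_on_open.simps(2))

text \<open>
  Local smooth extensions compose, after the domain of the inner one is shrunk to the preimage of the domain
  of the outer one.
\<close>

lemma smooth_on_compose: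
  assumes f: "smooth_on T f" and g: "smooth_on S g" and "g ` S \<subseteq> T"
  shows "smooth_on S (\<lambda>x. f (g x))"
proof (rule smooth_onI)
  fix x assume x: "x \<in> S"
  obtain U G where U: "open U" "x \<in> U" "\<And>k. C_k_on_open k U G" "\<And>y. y \<in> U \<Longrightarrow> y \<in> S \<Longrightarrow> G y = g y"
    using smooth_onE[OF g x] by blast
  obtain V F where V: "open V" "g x \<in> V" "\<And>k. C_k_on_open k V F" "\<And>y. y \<in> V \<Longrightarrow> y \<in> T \<Longrightarrow> F y = f y"
    using smooth_onE[OF f, of "g x"] x assms(3) by blast
  have o: "open (U \<inter> G -` V)"
    using C_k_imp_continuous[OF U(3)] U(1) V(1) continuous_open_preimage by blast
  show "\<exists>U F. open U \<and> x \<in> U \<and> (\<forall>k. C_k_on_open k U F) \<and> (\<forall>y\<in>U \<inter> S. F y = f (g y))"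
  proof (intro exI conjI allI ballI)
    show "open (U \<inter> G -` V)" by (rule o)
    show "x \<in> U \<inter> G -` V" using U V x by auto
    show "C_k_on_open k (U \<inter> G -` V) (\<lambda>x. F (G x))" for k
      by (rule C_k_on_open_compose[OF o V(1) _ C_k_on_open_subset[OF U(3)] V(3)]) auto
    show "F (G y) = f (g y)" if "y \<in> (U \<inter> G -` V) \<inter> S" for y
      using that U(4)[of y] V(4)[of "G y"] assms(3) by auto
  qed
qed

lemma smooth_on_Pair:
  assumes f: "smooth_on S f" and g: "smooth_on S g"
  shows "smooth_on S (\<lambda>x. (f x, g x))"
proof (rule smooth_onI)
  fix x assume x: "x \<in> S"
  obtain U F where U: "open U" "x \<in> U" "\<And>k. C_k_on_open k U F" "\<And>y. y \<in> U \<Longrightarrow> y \<in> S \<Longrightarrow> F y = f y"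
    using smooth_onE[OF f x] by blast
  obtain V G where V: "open V" "x \<in> V" "\<And>k. C_k_on_open k V G" "\<And>y. y \<in> V \<Longrightarrow> y \<in> S \<Longrightarrow> G y = g y"
    using smooth_onE[OF g x] by blast
  show "\<exists>U F. open U \<and> x \<in> U \<and> (\<forall>k. C_k_on_open k U F) \<and> (\<forall>y\<in>U \<inter> S. F y = (f y, g y))"
  proof (intro exI conjI allI ballI)
    show "open (U \<inter> V)" "x \<in> U \<inter> V" using U V by auto
    show "C_k_on_open k (U \<inter> V) (\<lambda>x. (F x, G x))" for k
      using U V by (intro C_k_on_open_Pair C_k_on_open_subset[OF U(3)] C_k_on_open_subset[OF V(3)]) auto
    show "(F y, G y) = (f y, g y)" if "y \<in> U \<inter> V \<inter> S" for y using that U(4) V(4) by auto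
  qed
qed

lemma smooth_on_imp_continuous_on: "smooth_on S f \<Longrightarrow> continuous_on S f"
proof -
  assume s: "smooth_on S f"
  show ?thesis unfolding continuous_on_eq_continuous_within
  proof
    fix x assume x: "x \<in> S"
    obtain U F where U: "open U" "x \<in> U" "\<And>k. C_k_on_open k U F" "\<And>y. y \<in> U \<Longrightarrow> y \<in> S \<Longrightarrow> F y = f y"
      using smooth_onE[OF s x] by blast
    have "continuous (at x) F" using C_k_imp_continuous[OF U(3)] U continuous_on_eq_continuous_at by blast
    then have "continuous (at x within S) F" by (rule continuous_at_imp_continuous_at_within)
    then have "(F \<longlongrightarrow> f x) (at x within S)" using U(2,4) x by (simp add: continuous_within)
    moreover have "eventually (\<lambda>y. F y = f y) (at x within S)"
      unfolding eventually_at_topological using U by blast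
    ultimately have "(f \<longlongrightarrow> f x) (at x within S)" using Lim_transform_eventually by blast
    then show "continuous (at x within S) f" by (simp add: continuous_within)
  qed
qed

lemma smooth_on_open_derivative:
  assumes "open S" "smooth_on S f" "x \<in> S"
  shows "(f has_derivative frechet_derivative f (at x)) (at x)"
proof -
  obtain U F where U: "open U" "x \<in> U" "\<And>k. C_k_on_open k U F" "\<And>y. y \<in> U \<Longrightarrow> y \<in> S \<Longrightarrow> F y = f y"
    using smooth_onE[OF assms(2,3)] by blast
  have "(F has_derivative frechet_derivative F (at x)) (at x)"
    by (rule C_k_on_open_Suc_has_derivative[OF U(3,2)])
  then have "(f has_derivative frechet_derivative F (at x)) (at x)"
    by (rule has_derivative_transform_within_open[OF _ open_Int[OF U(1) assms(1)]]) (use U assms in auto)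
  then have "f differentiable (at x)" by (auto simp: differentiable_def)
  then show ?thesis by (simp add: frechet_derivative_works)
qed

lemma smooth_on_add:
  fixes f g :: "'a::euclidean_space \<Rightarrow> 'b::euclidean_space"
  assumes "smooth_on S f" "smooth_on S g"
  shows "smooth_on S (\<lambda>x. f x + g x)"
proof -
  have "smooth_on UNIV (\<lambda>z::'b\<times>'b. fst z + snd z)"
    by (intro smooth_on_linear bounded_linear_add bounded_linear_fst bounded_linear_snd)
  from smooth_on_compose[OF this smooth_on_Pair[OF assms]] show ?thesis by simp
qed

section \<open>Charts\<close>

text \<open>
  The conditions on the atlas of a smooth manifold, separated out because they pass directly to products,
  submanifolds and open subsets.
\<close>

definition smooth_atlas :: "('m, 'e::euclidean_space) manifold \<Rightarrow> bool" where
  "smooth_atlas M \<longleftrightarrow>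
     (\<forall>c\<in>atlas M. is_chart (mtop M) (mdim M) c) \<and>
     (\<Union>c\<in>atlas M. cdom c) = points M \<and>
     (\<forall>c\<in>atlas M. \<forall>c'\<in>atlas M. compatible c c')"

lemma smooth_manifold_imp_smooth_atlas: "smooth_manifold M \<Longrightarrow> smooth_atlas M"
  by (simp add: smooth_manifold_def smooth_atlas_def)

lemma is_chart_cdom_subset: "is_chart X n c \<Longrightarrow> cdom c \<subseteq> topspace X"
  by (simp add: is_chart_def openin_subset)

lemma is_chart_openin: "is_chart X n c \<Longrightarrow> openin X (cdom c)"
  by (simp add: is_chart_def)

lemma is_chart_inj:
  assumes "is_chart X n c"
  shows "inj_on (cmap c) (cdom c)"
proof -
  have "topspace (subtopology X (cdom c)) = cdom c"
    using is_chart_cdom_subset[OF assms] by auto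
  then show ?thesis using assms homeomorphic_imp_injective_map unfolding is_chart_def by metis
qed

lemma cinv_cmap: "is_chart X n c \<Longrightarrow> p \<in> cdom c \<Longrightarrow> cinv c (cmap c p) = p"
  unfolding cinv_def by (rule inv_into_f_f[OF is_chart_inj])

lemma cinv_in_cdom: "x \<in> cimage c \<Longrightarrow> cinv c x \<in> cdom c"
  and cmap_cinv: "x \<in> cimage c \<Longrightarrow> cmap c (cinv c x) = x"
  unfolding cimage_def cinv_def by (auto intro: inv_into_into f_inv_into_f)

lemma cmap_in_cimage: "p \<in> cdom c \<Longrightarrow> cmap c p \<in> cimage c"
  by (simp add: cimage_def)

lemma is_chart_cimage_subset: "is_chart X n c \<Longrightarrow> cimage c \<subseteq> cmodel c"
  by (auto simp: is_chart_def dest: openin_imp_subset)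

lemma cmap_in_cmodel: "is_chart X n c \<Longrightarrow> p \<in> cdom c \<Longrightarrow> cmap c p \<in> cmodel c"
  using subsetD[OF is_chart_cimage_subset cmap_in_cimage] .

text \<open>
  Openness of an image is relative to the model subspace of the chart. The open set \<open>V\<close> of the surrounding
  space that represents it can be used to recognise points of \<open>W\<close> by their coordinates.
\<close>

lemma is_chart_open_image:
  assumes "is_chart X n c" "openin X W" "W \<subseteq> cdom c"
  obtains V where "open V" "cmap c ` W = V \<inter> cmodel c" "\<And>q. q \<in> cdom c \<Longrightarrow> cmap c q \<in> V \<longleftrightarrow> q \<in> W"
proof -
  have "openin (subtopology X (cdom c)) W"
    using assms is_chart_openin[OF assms(1)] by (simp add: openin_open_subtopology)
  then have "openin (top_of_set (cimage c)) (cmap c ` W)"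
    using assms(1) homeomorphic_map_openness_eq unfolding is_chart_def by blast
  then have "openin (top_of_set (cmodel c)) (cmap c ` W)"
    using assms(1) openin_trans unfolding is_chart_def by blast
  then obtain V where V: "open V" "cmap c ` W = V \<inter> cmodel c"
    by (auto simp: openin_open Int_commute)
  have "cmap c q \<in> V \<longleftrightarrow> q \<in> W" if q: "q \<in> cdom c" for q
  proof -
    have "cmap c q \<in> cmodel c" using q is_chart_cimage_subset[OF assms(1)] by (auto simp: cimage_def)
    then have "cmap c q \<in> V \<longleftrightarrow> cmap c q \<in> cmap c ` W" unfolding V(2) by simp
    also have "\<dots> \<longleftrightarrow> q \<in> W" using inj_on_image_mem_iff[OF is_chart_inj[OF assms(1)] q assms(3)] .
    finally show ?thesis .
  qed
  then show ?thesis using that V by blast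
qed

lemma is_chart_cimage_open:
  assumes "is_chart X n c"
  obtains V where "open V" "cimage c = V \<inter> cmodel c"
  unfolding cimage_def
  by (rule is_chart_open_image[OF assms is_chart_openin[OF assms] order_refl]) (rule that, simp_all add: cimage_def)

lemma is_chart_open_vimage:
  assumes "is_chart X n c" "open V"
  shows "openin X {q \<in> cdom c. cmap c q \<in> V}"
proof -
  have t: "topspace (subtopology X (cdom c)) = cdom c"
    using is_chart_cdom_subset[OF assms(1)] by auto
  have "continuous_map (subtopology X (cdom c)) (top_of_set (cimage c)) (cmap c)"
    using assms(1) homeomorphic_imp_continuous_map unfolding is_chart_def by blast
  moreover have "openin (top_of_set (cimage c)) (cimage c \<inter> V)"
    using assms(2) by blast
  ultimately have "openin (subtopology X (cdom c)) {q \<in> cdom c. cmap c q \<in> cimage c \<inter> V}"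
    using t openin_continuous_map_preimage by fastforce
  moreover have "{q \<in> cdom c. cmap c q \<in> cimage c \<inter> V} = {q \<in> cdom c. cmap c q \<in> V}"
    by (auto simp: cimage_def)
  ultimately show ?thesis
    using is_chart_openin[OF assms(1)] by (simp add: openin_open_subtopology)
qed

lemma is_chartI:
  fixes c :: "('m, 'e::euclidean_space) chart"
  assumes "openin X (cdom c)" "subspace (cmodel c)" "dim (cmodel c) = n"
    and inj: "inj_on (cmap c) (cdom c)"
    and im: "\<And>W. openin X W \<Longrightarrow> W \<subseteq> cdom c \<Longrightarrow> openin (top_of_set (cmodel c)) (cmap c ` W)"
    and vim: "\<And>V. open V \<Longrightarrow> openin X {q \<in> cdom c. cmap c q \<in> V}"
  shows "is_chart X n c"
proof -
  have t: "topspace (subtopology X (cdom c)) = cdom c"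
    using openin_subset[OF assms(1)] by auto
  have "homeomorphic_map (subtopology X (cdom c)) (top_of_set (cimage c)) (cmap c)"
  proof (rule bijective_open_imp_homeomorphic_map)
    show "continuous_map (subtopology X (cdom c)) (top_of_set (cimage c)) (cmap c)"
      unfolding continuous_map_def
    proof (intro conjI allI impI)
      show "cmap c \<in> topspace (subtopology X (cdom c)) \<rightarrow> topspace (top_of_set (cimage c))"
        unfolding t by (auto simp: cimage_def)
      fix U assume "openin (top_of_set (cimage c)) U"
      then obtain V where "open V" "U = cimage c \<inter> V" by (auto simp: openin_open)
      moreover then have "{q \<in> cdom c. cmap c q \<in> U} = {q \<in> cdom c. cmap c q \<in> V}"
        by (auto simp: cimage_def)
      ultimately show "openin (subtopology X (cdom c)) {x \<in> topspace (subtopology X (cdom c)). cmap c x \<in> U}"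
        unfolding t using vim[of V] assms(1) by (simp add: openin_open_subtopology)
    qed
    show "open_map (subtopology X (cdom c)) (top_of_set (cimage c)) (cmap c)"
      unfolding open_map_def
    proof (intro allI impI)
      fix U assume "openin (subtopology X (cdom c)) U"
      then have U: "openin X U" "U \<subseteq> cdom c" using assms(1) by (auto simp: openin_open_subtopology)
      from im[OF U] obtain V where "open V" "cmap c ` U = cmodel c \<inter> V" by (auto simp: openin_open)
      moreover have "cmap c ` U \<subseteq> cimage c" using U(2) by (auto simp: cimage_def)
      moreover have "cimage c \<subseteq> cmodel c"
        using im[OF assms(1) order_refl] openin_imp_subset unfolding cimage_def by blast
      ultimately have "cmap c ` U = cimage c \<inter> V" by blast
      then show "openin (top_of_set (cimage c)) (cmap c ` U)" using \<open>open V\<close> by auto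
    qed
  qed (use inj t in \<open>auto simp: cimage_def\<close>)
  then show ?thesis using assms im[OF assms(1) order_refl] by (simp add: is_chart_def cimage_def)
qed

section \<open>The maximal atlas\<close>

lemma charts_is_chart: "c \<in> charts M \<Longrightarrow> is_chart (mtop M) (mdim M) c"
  by (simp add: charts_def)

lemma atlas_subset_charts: "smooth_atlas M \<Longrightarrow> atlas M \<subseteq> charts M"
  by (auto simp: charts_def smooth_atlas_def)

lemma chart_at:
  assumes "smooth_atlas M" "p \<in> points M"
  obtains c where "c \<in> atlas M" "c \<in> charts M" "p \<in> cdom c"
proof -
  have "p \<in> (\<Union>c\<in>atlas M. cdom c)" using assms by (simp add: smooth_atlas_def)
  then show ?thesis using atlas_subset_charts[OF assms(1)] that by blast
qed

lemma compatible_sym: "compatible c c' \<Longrightarrow> compatible c' c"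
  by (auto simp: compatible_def Int_commute)

lemma transition_smooth_through:
  assumes "is_chart X n c" "is_chart X n' a" "openin X (cdom c')"
    and "compatible c a" "compatible a c'"
  shows "smooth_on (cmap c ` (cdom c \<inter> cdom a \<inter> cdom c')) (cmap c' \<circ> cinv c)"
proof -
  have "smooth_on (cmap c ` (cdom c \<inter> cdom a \<inter> cdom c')) (\<lambda>x. (cmap c' \<circ> cinv a) ((cmap a \<circ> cinv c) x))"
  proof (rule smooth_on_compose[where f = "cmap c' \<circ> cinv a" and T = "cmap a ` (cdom a \<inter> cdom c')"])
    show "smooth_on (cmap a ` (cdom a \<inter> cdom c')) (cmap c' \<circ> cinv a)"
      using assms(5) by (simp add: compatible_def)
    show "smooth_on (cmap c ` (cdom c \<inter> cdom a \<inter> cdom c')) (cmap a \<circ> cinv c)"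
      by (rule smooth_on_subset[of "cmap c ` (cdom c \<inter> cdom a)"]) (use assms(4) in \<open>auto simp: compatible_def\<close>)
  qed (use assms(1) in \<open>auto simp: cinv_cmap\<close>)
  then show ?thesis
    by (rule smooth_on_cong) (use assms(1,2) in \<open>auto simp: cinv_cmap\<close>)
qed

text \<open>
  Two charts of the maximal atlas are only known to be compatible with the charts of the atlas. Near each
  point a chart \<open>a\<close> of the atlas is available, and the transition map factors through its coordinates.
\<close>

lemma charts_transition_smooth:
  assumes "smooth_atlas M" "c \<in> charts M" "c' \<in> charts M"
  shows "smooth_on (cmap c ` (cdom c \<inter> cdom c')) (cmap c' \<circ> cinv c)"
proof (rule smooth_on_local)
  note ch = charts_is_chart[OF assms(2)] charts_is_chart[OF assms(3)]
  fix x assume "x \<in> cmap c ` (cdom c \<inter> cdom c')"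
  then obtain p where p: "p \<in> cdom c" "p \<in> cdom c'" "x = cmap c p" by blast
  then have "p \<in> points M" using is_chart_cdom_subset[OF ch(1)] by blast
  then obtain a where a: "a \<in> atlas M" "p \<in> cdom a" "a \<in> charts M" using chart_at[OF assms(1)] by blast
  let ?W = "cdom c \<inter> cdom a \<inter> cdom c'"
  have oW: "openin (mtop M) ?W"
    using ch charts_is_chart[OF a(3)] by (intro openin_Int is_chart_openin)
  have sub: "?W \<subseteq> cdom c" by blast
  obtain V where V: "open V" "cmap c ` ?W = V \<inter> cmodel c" "\<And>q. q \<in> cdom c \<Longrightarrow> cmap c q \<in> V \<longleftrightarrow> q \<in> ?W"
    by (rule is_chart_open_image[OF ch(1) oW sub]) (rule that)
  have "compatible c a" "compatible a c'"
    using assms(2,3) a(1) compatible_sym by (auto simp: charts_def)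
  then have "smooth_on (cmap c ` ?W) (cmap c' \<circ> cinv c)"
    using transition_smooth_through[OF ch(1) charts_is_chart[OF a(3)] is_chart_openin[OF ch(2)]] by blast
  moreover have "cmap c ` (cdom c \<inter> cdom c') \<inter> V \<subseteq> cmap c ` ?W"
    using V(3) by auto
  ultimately have "smooth_on (cmap c ` (cdom c \<inter> cdom c') \<inter> V) (cmap c' \<circ> cinv c)"
    using smooth_on_subset by blast
  moreover have "x \<in> V" using p a V(3) by simp
  ultimately show "\<exists>V. open V \<and> x \<in> V \<and> smooth_on (cmap c ` (cdom c \<inter> cdom c') \<inter> V) (cmap c' \<circ> cinv c)"
    using V(1) by blast
qed

lemma charts_compatible: "smooth_atlas M \<Longrightarrow> c \<in> charts M \<Longrightarrow> c' \<in> charts M \<Longrightarrow> compatible c c'"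
  unfolding compatible_def using charts_transition_smooth Int_commute by metis

definition restrict_chart :: "('m, 'e) chart \<Rightarrow> 'm set \<Rightarrow> ('m, 'e) chart" where
  "restrict_chart c W = \<lparr>cdom = cdom c \<inter> W, cmap = cmap c, cmodel = cmodel c\<rparr>"

lemma restrict_chart_simps [simp]:
  "cdom (restrict_chart c W) = cdom c \<inter> W" "cmap (restrict_chart c W) = cmap c"
  "cmodel (restrict_chart c W) = cmodel c"
  by (simp_all add: restrict_chart_def)

lemma is_chart_restrict:
  assumes "is_chart X n c" "openin X W"
  shows "is_chart X n (restrict_chart c W)"
proof (rule is_chartI)
  show "openin X (cdom (restrict_chart c W))" using assms by (auto intro: is_chart_openin)
  show "openin (top_of_set (cmodel (restrict_chart c W))) (cmap (restrict_chart c W) ` U)"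
    if U: "openin X U" "U \<subseteq> cdom (restrict_chart c W)" for U
  proof -
    have "U \<subseteq> cdom c" using U(2) by simp
    then obtain V where "open V" "cmap c ` U = V \<inter> cmodel c"
      by (rule is_chart_open_image[OF assms(1) U(1)]) (rule that)
    then show ?thesis by (auto simp: openin_open)
  qed
  show "openin X {q \<in> cdom (restrict_chart c W). cmap (restrict_chart c W) q \<in> V}" if "open V" for V
  proof -
    have "{q \<in> cdom (restrict_chart c W). cmap (restrict_chart c W) q \<in> V} = {q \<in> cdom c. cmap c q \<in> V} \<inter> W"
      by auto
    then show ?thesis using is_chart_open_vimage[OF assms(1) that] assms(2) by auto
  qed
qed (use assms(1) in \<open>auto simp: is_chart_def intro: inj_on_subset[OF is_chart_inj[OF assms(1)]]\<close>)

lemma cinv_restrict: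
  "is_chart X n c \<Longrightarrow> openin X W \<Longrightarrow> p \<in> cdom c \<Longrightarrow> p \<in> W \<Longrightarrow> cinv (restrict_chart c W) (cmap c p) = p"
  using cinv_cmap[OF is_chart_restrict, of X n c W p] by simp

lemma compatible_restrict:
  assumes "is_chart X n c" "openin X W" "compatible c c'"
  shows "compatible (restrict_chart c W) c'"
  unfolding compatible_def
proof
  have "smooth_on (cmap c ` (cdom c \<inter> W \<inter> cdom c')) (cmap c' \<circ> cinv c)"
    by (rule smooth_on_subset[of "cmap c ` (cdom c \<inter> cdom c')"]) (use assms(3) in \<open>auto simp: compatible_def\<close>)
  then show "smooth_on (cmap (restrict_chart c W) ` (cdom (restrict_chart c W) \<inter> cdom c'))
      (cmap c' \<circ> cinv (restrict_chart c W))"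
    by (auto elim!: smooth_on_cong simp: cinv_cmap[OF assms(1)] cinv_restrict[OF assms(1,2)])
  have "smooth_on (cmap c' ` (cdom c \<inter> W \<inter> cdom c')) (cmap c \<circ> cinv c')"
    by (rule smooth_on_subset[of "cmap c' ` (cdom c \<inter> cdom c')"]) (use assms(3) in \<open>auto simp: compatible_def\<close>)
  then show "smooth_on (cmap c' ` (cdom (restrict_chart c W) \<inter> cdom c')) (cmap (restrict_chart c W) \<circ> cinv c')"
    by simp
qed

lemma restrict_chart_in_charts:
  "c \<in> charts M \<Longrightarrow> openin (mtop M) W \<Longrightarrow> restrict_chart c W \<in> charts M"
  by (auto simp: charts_def intro: is_chart_restrict compatible_restrict)

section \<open>Smooth maps in arbitrary charts\<close>

lemma smooth_map_in_points: "smooth_map M N f \<Longrightarrow> p \<in> points M \<Longrightarrow> f p \<in> points N"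
  by (auto simp: smooth_map_def)

text \<open>
  Smoothness of a map asks for one suitable pair of charts at each point; composing with transition maps
  turns it into smoothness, near the point, in any prescribed pair of charts.
\<close>

lemma smooth_map_in_charts:
  assumes M: "smooth_atlas M" and N: "smooth_atlas N" and f: "smooth_map M N f"
    and c: "c \<in> charts M" "p \<in> cdom c" and c': "c' \<in> charts N" "f p \<in> cdom c'"
  obtains W where "openin (mtop M) W" "p \<in> W" "W \<subseteq> cdom c" "f ` W \<subseteq> cdom c'"
    "smooth_on (cmap c ` W) (cmap c' \<circ> f \<circ> cinv c)"
proof -
  note ch = charts_is_chart[OF c(1)] and ch' = charts_is_chart[OF c'(1)]
  have "p \<in> points M" using is_chart_cdom_subset[OF ch] c(2) by blast
  then obtain a a' where a: "a \<in> charts M" "p \<in> cdom a" and a': "a' \<in> charts N"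
    and fa: "f ` cdom a \<subseteq> cdom a'" and sm: "smooth_on (cimage a) (cmap a' \<circ> f \<circ> cinv a)"
    using f unfolding smooth_map_def by blast
  note cha = charts_is_chart[OF a(1)] and cha' = charts_is_chart[OF a']
  have oV: "openin (mtop N) (cdom a' \<inter> cdom c')"
    by (intro openin_Int is_chart_openin[OF cha'] is_chart_openin[OF ch'])
  obtain V' where V': "open V'" "cmap a' ` (cdom a' \<inter> cdom c') = V' \<inter> cmodel a'" "\<And>q. q \<in> cdom a' \<Longrightarrow> cmap a' q \<in> V' \<longleftrightarrow> q \<in> cdom a' \<inter> cdom c'"
    by (rule is_chart_open_image[OF cha' oV Int_lower1]) (rule that)
  let ?h = "cmap a' \<circ> f \<circ> cinv a"
  obtain V where V: "open V" "V \<inter> cimage a = ?h -` V' \<inter> cimage a"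
    using smooth_on_imp_continuous_on[OF sm] V'(1) unfolding continuous_on_open_invariant by metis
  have V_iff: "cmap a q \<in> V \<longleftrightarrow> f q \<in> cdom c'" if q: "q \<in> cdom a" for q
  proof -
    have fq: "f q \<in> cdom a'" using fa q by blast
    have "cmap a q \<in> V \<longleftrightarrow> cmap a q \<in> V \<inter> cimage a" using cmap_in_cimage[OF q] by simp
    also have "\<dots> \<longleftrightarrow> cmap a' (f q) \<in> V'"
      unfolding V(2) using cmap_in_cimage[OF q] cinv_cmap[OF cha q] by simp
    also have "\<dots> \<longleftrightarrow> f q \<in> cdom c'" using V'(3)[OF fq] fq by simp
    finally show ?thesis .
  qed
  define W where "W = {q \<in> cdom a. cmap a q \<in> V} \<inter> cdom c"
  have fW: "f q \<in> cdom c'" "f q \<in> cdom a'" if "q \<in> W" for q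
    using that V_iff[of q] fa by (auto simp: W_def)
  have pW: "p \<in> W" using a c c'(2) V_iff[OF a(2)] by (simp add: W_def)
  have oW: "openin (mtop M) W"
    unfolding W_def by (intro openin_Int is_chart_open_vimage[OF cha V(1)] is_chart_openin[OF ch])
  have 1: "smooth_on (cmap c ` W) (cmap a \<circ> cinv c)"
    by (rule smooth_on_subset[OF charts_transition_smooth[OF M c(1) a(1)]]) (auto simp: W_def)
  have 2: "smooth_on (cmap c ` W) (\<lambda>x. ?h ((cmap a \<circ> cinv c) x))"
    by (rule smooth_on_compose[OF sm 1]) (auto simp: W_def cinv_cmap[OF ch] cmap_in_cimage)
  have 3: "smooth_on (cmap c ` W) (\<lambda>x. (cmap c' \<circ> cinv a') (?h ((cmap a \<circ> cinv c) x)))"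
  proof (rule smooth_on_compose[OF charts_transition_smooth[OF N a' c'(1)] 2])
    show "(\<lambda>x. ?h ((cmap a \<circ> cinv c) x)) ` cmap c ` W \<subseteq> cmap a' ` (cdom a' \<inter> cdom c')"
    proof clarify
      fix q assume q: "q \<in> W"
      then have "q \<in> cdom a" "q \<in> cdom c" by (auto simp: W_def)
      then show "?h ((cmap a \<circ> cinv c) (cmap c q)) \<in> cmap a' ` (cdom a' \<inter> cdom c')"
        using fW[OF q] by (simp add: cinv_cmap[OF ch] cinv_cmap[OF cha])
    qed
  qed
  have "smooth_on (cmap c ` W) (cmap c' \<circ> f \<circ> cinv c)"
  proof (rule smooth_on_cong[OF 3])
    fix x assume "x \<in> cmap c ` W"
    then obtain q where q: "q \<in> W" "x = cmap c q" by blast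
    then have "q \<in> cdom a" "q \<in> cdom c" by (auto simp: W_def)
    then show "(cmap c' \<circ> cinv a') (?h ((cmap a \<circ> cinv c) x)) = (cmap c' \<circ> f \<circ> cinv c) x"
      using fW[OF q(1)] q(2) by (simp add: cinv_cmap[OF ch] cinv_cmap[OF cha] cinv_cmap[OF cha'])
  qed
  then show ?thesis using that[OF oW pW] fW by (auto simp: W_def)
qed

text \<open>
  The converse of the preceding lemma: a local coordinate expression on an open \<open>W\<close> suffices, since the
  restriction of a chart to \<open>W\<close> is again a chart.
\<close>

lemma smooth_mapI:
  assumes "f ` points M \<subseteq> points N"
    and "\<And>p. p \<in> points M \<Longrightarrow> \<exists>c\<in>charts M. \<exists>c'\<in>charts N. \<exists>W. openin (mtop M) W \<and> p \<in> W \<and>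
      W \<subseteq> cdom c \<and> f ` W \<subseteq> cdom c' \<and> smooth_on (cmap c ` W) (cmap c' \<circ> f \<circ> cinv c)"
  shows "smooth_map M N f"
  unfolding smooth_map_def
proof (intro conjI ballI assms(1))
  fix p assume "p \<in> points M"
  then obtain c c' W where *: "c \<in> charts M" "c' \<in> charts N" "openin (mtop M) W" "p \<in> W"
    "W \<subseteq> cdom c" "f ` W \<subseteq> cdom c'" and s: "smooth_on (cmap c ` W) (cmap c' \<circ> f \<circ> cinv c)"
    using assms(2) by metis
  let ?c = "restrict_chart c W"
  have cW: "cdom c \<inter> W = W" using *(5) by blast
  note ch = charts_is_chart[OF *(1)]
  have "smooth_on (cimage ?c) (cmap c' \<circ> f \<circ> cinv ?c)"
    unfolding cimage_def restrict_chart_simps cW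
    by (rule smooth_on_cong[OF s]) (use *(5) in \<open>auto simp: cinv_cmap[OF ch] cinv_restrict[OF ch *(3)] subset_iff\<close>)
  then show "\<exists>c\<in>charts M. \<exists>c'\<in>charts N. p \<in> cdom c \<and> f ` cdom c \<subseteq> cdom c' \<and>
      smooth_on (cimage c) (cmap c' \<circ> f \<circ> cinv c)"
    using restrict_chart_in_charts[OF *(1,3)] * cW by (intro bexI[of _ ?c] bexI[of _ c']) auto
qed

lemma smooth_map_id:
  assumes "smooth_atlas M"
  shows "smooth_map M M id"
proof (rule smooth_mapI)
  fix p assume "p \<in> points M"
  then obtain c where c: "c \<in> charts M" "p \<in> cdom c" using chart_at[OF assms] by blast
  note ch = charts_is_chart[OF c(1)]
  have "smooth_on (cmap c ` cdom c) (cmap c \<circ> id \<circ> cinv c)"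
    by (rule smooth_on_cong[OF smooth_on_id]) (auto simp: cinv_cmap[OF ch])
  then show "\<exists>c\<in>charts M. \<exists>c'\<in>charts M. \<exists>W. openin (mtop M) W \<and> p \<in> W \<and>
      W \<subseteq> cdom c \<and> id ` W \<subseteq> cdom c' \<and> smooth_on (cmap c ` W) (cmap c' \<circ> id \<circ> cinv c)"
    using c is_chart_openin[OF ch] by auto
qed auto

section \<open>Curves and their velocities\<close>

text \<open>
  By continuity the curve stays near its base point for a short time, and there the transition map carries
  smoothness from the chart in which it is known to the given one.
\<close>

lemma curve_at_in_chart:
  assumes M: "smooth_atlas M" and \<gamma>: "curve_at M p \<gamma>"
    and c: "c \<in> charts M" "p \<in> cdom c" and W: "openin (mtop M) W" "p \<in> W"
  obtains r where "r > 0" "\<And>t. t \<in> {-r<..<r} \<Longrightarrow> \<gamma> t \<in> cdom c \<inter> W" "smooth_on {-r<..<r} (cmap c \<circ> \<gamma>)"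
proof -
  obtain a s where a: "a \<in> charts M" and s: "s > 0" "\<gamma> ` {-s<..<s} \<subseteq> cdom a" "smooth_on {-s<..<s} (cmap a \<circ> \<gamma>)"
    and p: "\<gamma> 0 = p"
    using \<gamma> unfolding curve_at_def by blast
  have pa: "p \<in> cdom a" using s p by force
  note ch = charts_is_chart[OF c(1)] and cha = charts_is_chart[OF a]
  have oV: "openin (mtop M) (cdom a \<inter> (cdom c \<inter> W))"
    using W by (intro openin_Int is_chart_openin[OF cha] is_chart_openin[OF ch])
  obtain V where V: "open V" "cmap a ` (cdom a \<inter> (cdom c \<inter> W)) = V \<inter> cmodel a"
      "\<And>q. q \<in> cdom a \<Longrightarrow> cmap a q \<in> V \<longleftrightarrow> q \<in> cdom a \<inter> (cdom c \<inter> W)"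
    by (rule is_chart_open_image[OF cha oV Int_lower1]) (rule that)
  have "open ({-s<..<s} \<inter> (cmap a \<circ> \<gamma>) -` V)"
    using smooth_on_imp_continuous_on[OF s(3)] V(1) by (intro continuous_open_preimage) auto
  moreover have "0 \<in> {-s<..<s} \<inter> (cmap a \<circ> \<gamma>) -` V"
    using s(1) p pa c(2) W(2) V(3)[OF pa] by auto
  ultimately obtain r where r: "r > 0" "\<And>t. dist t 0 < r \<Longrightarrow> t \<in> {-s<..<s} \<inter> (cmap a \<circ> \<gamma>) -` V"
    unfolding open_dist by metis
  have mem: "\<gamma> t \<in> cdom a" "\<gamma> t \<in> cdom c \<inter> W" "t \<in> {-s<..<s}" if "t \<in> {-r<..<r}" for t
  proof -
    have t: "t \<in> {-s<..<s}" "cmap a (\<gamma> t) \<in> V" using r(2)[of t] that by auto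
    then show 1: "\<gamma> t \<in> cdom a" "t \<in> {-s<..<s}" using s(2) by auto
    show "\<gamma> t \<in> cdom c \<inter> W" using V(3)[OF 1(1)] t(2) by simp
  qed
  have "smooth_on {-r<..<r} (\<lambda>t. (cmap c \<circ> cinv a) ((cmap a \<circ> \<gamma>) t))"
  proof (rule smooth_on_compose[OF charts_transition_smooth[OF M a c(1)]])
    show "smooth_on {-r<..<r} (cmap a \<circ> \<gamma>)"
      by (rule smooth_on_subset[OF s(3)]) (use mem(3) in blast)
    show "(cmap a \<circ> \<gamma>) ` {-r<..<r} \<subseteq> cmap a ` (cdom a \<inter> cdom c)"
      using mem by auto
  qed
  then have "smooth_on {-r<..<r} (cmap c \<circ> \<gamma>)"
    by (rule smooth_on_cong) (use mem cinv_cmap[OF cha] in auto)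
  then show ?thesis using that[OF r(1)] mem by blast
qed

lemma curve_at_base: "curve_at M p \<gamma> \<Longrightarrow> \<gamma> 0 = p"
  by (simp add: curve_at_def)

lemma curve_atI:
  "\<gamma> 0 = p \<Longrightarrow> c \<in> charts M \<Longrightarrow> r > 0 \<Longrightarrow> (\<And>t. t \<in> {-r<..<r} \<Longrightarrow> \<gamma> t \<in> cdom c) \<Longrightarrow>
    smooth_on {-r<..<r} (cmap c \<circ> \<gamma>) \<Longrightarrow> curve_at M p \<gamma>"
  unfolding curve_at_def by blast

lemma curve_at_in_points: "curve_at M p \<gamma> \<Longrightarrow> p \<in> points M"
  unfolding curve_at_def using charts_is_chart is_chart_cdom_subset
  by (metis greaterThanLessThan_iff image_subset_iff neg_less_0_iff_less subsetD)

text \<open>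
  Decompose the derivative into a part in \<open>F\<close> and a part orthogonal to \<open>F\<close>. The inner product of the curve with
  the orthogonal part vanishes, hence so does its derivative, which is the squared length of that part.
\<close>

lemma has_vector_derivative_in_subspace:
  fixes f :: "real \<Rightarrow> 'e::euclidean_space"
  assumes "(f has_vector_derivative v) (at 0)" "subspace F" "r > 0" "\<And>t. t \<in> {-r<..<r} \<Longrightarrow> f t \<in> F"
  shows "v \<in> F"
proof -
  obtain y z where y: "y \<in> span F" and z: "\<And>w. w \<in> span F \<Longrightarrow> orthogonal z w" and v: "v = y + z"
    using orthogonal_subspace_decomp_exists[of F v] by metis
  have F: "span F = F" using assms(2) by simp
  have "((\<lambda>t. z \<bullet> f t) has_vector_derivative z \<bullet> v) (at 0)"
    using bounded_linear.has_vector_derivative[OF bounded_linear_inner_right assms(1)] .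
  moreover have "((\<lambda>t. z \<bullet> f t) has_vector_derivative 0) (at 0)"
    by (rule has_vector_derivative_transform_within_open[of "\<lambda>t. 0" _ _ "{-r<..<r}"])
       (use assms z F in \<open>auto simp: orthogonal_def\<close>)
  ultimately have "z \<bullet> v = 0" using vector_derivative_unique_at by blast
  then have "z \<bullet> z = 0" using v z[OF y] by (simp add: orthogonal_def inner_add_right)
  then show ?thesis using v y F by simp
qed

lemma smooth_on_has_vector_derivative:
  fixes g :: "real \<Rightarrow> 'e::euclidean_space"
  assumes "smooth_on {-r<..<r} g" "r > 0"
  shows "(g has_vector_derivative vector_derivative g (at 0)) (at 0)"
proof -
  have "(g has_derivative frechet_derivative g (at 0)) (at 0)"
    by (rule smooth_on_open_derivative[OF open_greaterThanLessThan assms(1)]) (use assms(2) in auto)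
  then have "g differentiable (at 0)" by (auto simp: differentiable_def)
  then show ?thesis using vector_derivative_works by blast
qed

lemma velocity_works:
  assumes "smooth_atlas M" "curve_at M p \<gamma>" "c \<in> charts M" "p \<in> cdom c"
  shows "((cmap c \<circ> \<gamma>) has_vector_derivative velocity c \<gamma>) (at 0)" and "velocity c \<gamma> \<in> cmodel c"
proof -
  note ch = charts_is_chart[OF assms(3)]
  have "openin (mtop M) (points M)" "p \<in> points M"
    using curve_at_in_points[OF assms(2)] by auto
  then obtain r where r: "r > 0" "\<And>t. t \<in> {-r<..<r} \<Longrightarrow> \<gamma> t \<in> cdom c"
    "smooth_on {-r<..<r} (cmap c \<circ> \<gamma>)"
    using curve_at_in_chart[OF assms] by (metis IntD1)
  show 1: "((cmap c \<circ> \<gamma>) has_vector_derivative velocity c \<gamma>) (at 0)"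
    unfolding velocity_def using smooth_on_has_vector_derivative[OF r(3,1)] .
  show "velocity c \<gamma> \<in> cmodel c"
  proof (rule has_vector_derivative_in_subspace[OF 1 _ r(1)])
    show "subspace (cmodel c)" using ch by (simp add: is_chart_def)
    show "(cmap c \<circ> \<gamma>) t \<in> cmodel c" if "t \<in> {-r<..<r}" for t
      using cmap_in_cimage[OF r(2)[OF that]] is_chart_cimage_subset[OF ch] by auto
  qed
qed

lemma velocity_eqI:
  "((cmap c \<circ> \<gamma>) has_vector_derivative u) (at 0) \<Longrightarrow> velocity c \<gamma> = u"
  unfolding velocity_def by (rule vector_derivative_at)

lemma velocity_cong_local:
  assumes "r > 0" "\<And>t. t \<in> {-r<..<r} \<Longrightarrow> \<gamma> t = \<delta> t"
    and "((cmap c \<circ> \<gamma>) has_vector_derivative u) (at 0)"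
  shows "velocity c \<delta> = u"
  by (rule velocity_eqI, rule has_vector_derivative_transform_within_open[OF assms(3), of "{-r<..<r}"])
     (use assms(1,2) in auto)

text \<open>
  Curves are most easily produced in coordinates. Only the values near time 0 are prescribed, so that the curve
  may be continued arbitrarily.
\<close>

lemma chart_curve:
  assumes c: "c \<in> charts M" "p \<in> cdom c"
    and g: "smooth_on {-r<..<r} g" "r > 0" "g 0 = cmap c p" "\<And>t. t \<in> {-r<..<r} \<Longrightarrow> g t \<in> cimage c"
    and \<gamma>: "\<And>t. t \<in> {-r<..<r} \<Longrightarrow> \<gamma> t = cinv c (g t)"
  shows "curve_at M p \<gamma>" and "velocity c \<gamma> = vector_derivative g (at 0)"
proof -
  note ch = charts_is_chart[OF c(1)]
  have eq: "g t = (cmap c \<circ> \<gamma>) t" if "t \<in> {-r<..<r}" for t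
    using \<gamma>[OF that] g(4)[OF that] by (simp add: cmap_cinv)
  show "curve_at M p \<gamma>"
  proof (rule curve_atI[OF _ c(1) g(2)])
    show "\<gamma> 0 = p" using \<gamma>[of 0] g c cinv_cmap[OF ch] by simp
    show "\<gamma> t \<in> cdom c" if "t \<in> {-r<..<r}" for t using \<gamma>[OF that] g(4)[OF that] cinv_in_cdom by metis
    show "smooth_on {-r<..<r} (cmap c \<circ> \<gamma>)" by (rule smooth_on_cong[OF g(1) eq])
  qed
  show "velocity c \<gamma> = vector_derivative g (at 0)"
    by (rule velocity_eqI,
        rule has_vector_derivative_transform_within_open[OF smooth_on_has_vector_derivative[OF g(1,2)], of "{-r<..<r}"])
       (use g(2) eq in auto)
qed

lemma line_curve_exists:
  assumes c: "c \<in> charts M" "p \<in> cdom c" and u: "u \<in> cmodel c"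
  obtains \<gamma> where "curve_at M p \<gamma>" "velocity c \<gamma> = u"
proof -
  note ch = charts_is_chart[OF c(1)]
  obtain V where V: "open V" "cimage c = V \<inter> cmodel c"
    by (rule is_chart_cimage_open[OF ch]) (rule that)
  let ?g = "\<lambda>t::real. t *\<^sub>R u + cmap c p"
  have "open (?g -` V)" by (intro open_vimage V continuous_intros)
  moreover have "0 \<in> ?g -` V" using V(2) cmap_in_cimage[OF c(2)] by auto
  ultimately obtain r where r: "r > 0" "\<And>t. dist t 0 < r \<Longrightarrow> t \<in> ?g -` V"
    unfolding open_dist by metis
  have sub: "subspace (cmodel c)" using ch by (simp add: is_chart_def)
  have im: "?g t \<in> cimage c" if "t \<in> {-r<..<r}" for t
  proof -
    have "cmap c p \<in> cmodel c" using cmap_in_cimage[OF c(2)] V(2) by simp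
    then have "?g t \<in> cmodel c" using u by (intro subspace_add[OF sub] subspace_mul[OF sub])
    moreover have "?g t \<in> V" using r(2)[of t] that by auto
    ultimately show ?thesis unfolding V(2) by simp
  qed
  have sm: "smooth_on {-r<..<r} ?g"
    by (intro smooth_on_add smooth_on_const smooth_on_linear bounded_linear_scaleR_left)
  have d: "vector_derivative ?g (at 0) = u"
    by (rule vector_derivative_at) (auto intro!: derivative_eq_intros)
  show ?thesis
    using chart_curve[OF c sm r(1) _ im, of "\<lambda>t. cinv c (?g t)"] d that by auto
qed

text \<open>
  The coordinate form of a smooth map near \<open>p\<close>: a smooth \<open>F\<close> on an open set of the surrounding Euclidean space,
  agreeing with the map on \<open>W\<close>. The neighbourhoods are chosen so that \<open>W\<close> corresponds to all of
  \<open>U \<inter> cmodel c\<close>; whoever solves an equation for \<open>F\<close> inside the model thereby obtains points of \<open>W\<close>.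
  The last two conclusions are the chain rule for curves.
\<close>

lemma smooth_map_local_rep:
  assumes M: "smooth_atlas M" and N: "smooth_atlas N" and f: "smooth_map M N f"
    and c: "c \<in> charts M" "p \<in> cdom c" and c': "c' \<in> charts N" "f p \<in> cdom c'"
  obtains W U F where "openin (mtop M) W" "p \<in> W" "W \<subseteq> cdom c" "f ` W \<subseteq> cdom c'"
    "open U" "cmap c ` W = U \<inter> cmodel c" "\<And>k. C_k_on_open k U F"
    "\<And>q. q \<in> W \<Longrightarrow> F (cmap c q) = cmap c' (f q)"
    "\<And>\<gamma>. curve_at M p \<gamma> \<Longrightarrow> curve_at N (f p) (f \<circ> \<gamma>)"
    "\<And>\<gamma>. curve_at M p \<gamma> \<Longrightarrow> velocity c' (f \<circ> \<gamma>) = frechet_derivative F (at (cmap c p)) (velocity c \<gamma>)"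
proof -
  note ch = charts_is_chart[OF c(1)] and ch' = charts_is_chart[OF c'(1)]
  obtain W where W: "openin (mtop M) W" "p \<in> W" "W \<subseteq> cdom c" "f ` W \<subseteq> cdom c'"
    and sm: "smooth_on (cmap c ` W) (cmap c' \<circ> f \<circ> cinv c)"
    using smooth_map_in_charts[OF M N f c c'] by blast
  obtain U F where U: "open U" "cmap c p \<in> U" "\<And>k. C_k_on_open k U F"
    "\<And>y. y \<in> U \<Longrightarrow> y \<in> cmap c ` W \<Longrightarrow> F y = (cmap c' \<circ> f \<circ> cinv c) y"
    using smooth_onE[OF sm, of "cmap c p"] W(2) by blast
  obtain V where V: "open V" "cmap c ` W = V \<inter> cmodel c"
    by (rule is_chart_open_image[OF ch W(1,3)]) (rule that)
  define W' where "W' = {q \<in> cdom c. cmap c q \<in> U} \<inter> W"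
  have oW': "openin (mtop M) W'"
    unfolding W'_def by (intro openin_Int is_chart_open_vimage[OF ch U(1)] W(1))
  have pW': "p \<in> W'" "W' \<subseteq> cdom c" "f ` W' \<subseteq> cdom c'" using W U(2) by (auto simp: W'_def)
  have cW': "cmap c ` W' = (U \<inter> V) \<inter> cmodel c"
  proof
    show "cmap c ` W' \<subseteq> (U \<inter> V) \<inter> cmodel c" using V(2) by (auto simp: W'_def)
    show "(U \<inter> V) \<inter> cmodel c \<subseteq> cmap c ` W'"
    proof
      fix x assume x: "x \<in> (U \<inter> V) \<inter> cmodel c"
      then obtain q where "q \<in> W" "x = cmap c q" using V(2) by blast
      then show "x \<in> cmap c ` W'" using x W(3) by (auto simp: W'_def)
    qed
  qed
  have F: "F (cmap c q) = cmap c' (f q)" if "q \<in> W'" for q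
    using U(4)[of "cmap c q"] that by (auto simp: W'_def cinv_cmap[OF ch])
  have C: "C_k_on_open k (U \<inter> V) F" for k using U(3) by (rule C_k_on_open_subset) auto
  have curve: "curve_at N (f p) (f \<circ> \<gamma>) \<and> velocity c' (f \<circ> \<gamma>) = frechet_derivative F (at (cmap c p)) (velocity c \<gamma>)"
    if \<gamma>: "curve_at M p \<gamma>" for \<gamma>
  proof -
    obtain r where r: "r > 0" "\<And>t. t \<in> {-r<..<r} \<Longrightarrow> \<gamma> t \<in> cdom c \<inter> W'" "smooth_on {-r<..<r} (cmap c \<circ> \<gamma>)"
      using curve_at_in_chart[OF M \<gamma> c oW' pW'(1)] by blast
    have g0: "\<gamma> 0 = p" using \<gamma> by (rule curve_at_base)
    have eq: "F ((cmap c \<circ> \<gamma>) t) = (cmap c' \<circ> (f \<circ> \<gamma>)) t" if "t \<in> {-r<..<r}" for t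
      using F r(2)[OF that] by auto
    have "smooth_on {-r<..<r} (\<lambda>t. F ((cmap c \<circ> \<gamma>) t))"
      by (rule smooth_on_compose[OF smooth_on_C_k[OF U(1,3)] r(3)]) (use r(2) in \<open>auto simp: W'_def\<close>)
    then have "smooth_on {-r<..<r} (cmap c' \<circ> (f \<circ> \<gamma>))" by (rule smooth_on_cong[OF _ eq])
    then have cu: "curve_at N (f p) (f \<circ> \<gamma>)"
      by (intro curve_atI[OF _ c'(1) r(1)]) (use g0 r(2) pW'(3) in auto)
    have d1: "((cmap c \<circ> \<gamma>) has_derivative (\<lambda>t. t *\<^sub>R velocity c \<gamma>)) (at 0)"
      using velocity_works(1)[OF M \<gamma> c] by (simp add: has_vector_derivative_def)
    have d2: "(F has_derivative frechet_derivative F (at (cmap c p))) (at ((cmap c \<circ> \<gamma>) 0))"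
      using C_k_on_open_Suc_has_derivative[OF U(3,2)] g0 by simp
    have lin: "linear (frechet_derivative F (at (cmap c p)))" using d2 has_derivative_linear by blast
    have "((\<lambda>t. F ((cmap c \<circ> \<gamma>) t)) has_vector_derivative frechet_derivative F (at (cmap c p)) (velocity c \<gamma>)) (at 0)"
      using diff_chain_at[OF d1 d2] lin by (simp add: has_vector_derivative_def o_def linear_cmul)
    then have "((cmap c' \<circ> (f \<circ> \<gamma>)) has_vector_derivative frechet_derivative F (at (cmap c p)) (velocity c \<gamma>)) (at 0)"
      by (rule has_vector_derivative_transform_within_open[of _ _ _ "{-r<..<r}"]) (use r(1) eq in auto)
    then show ?thesis using cu velocity_eqI by blast
  qed
  show ?thesis
    by (rule that[OF oW' pW' _ cW' C F]) (use U(1) V(1) curve in auto)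
qed

lemma smooth_map_curve:
  assumes "smooth_atlas M" "smooth_atlas N" "smooth_map M N f" "curve_at M p \<gamma>"
  shows "curve_at N (f p) (f \<circ> \<gamma>)"
proof -
  have p: "p \<in> points M" using curve_at_in_points[OF assms(4)] .
  obtain c where "c \<in> charts M" "p \<in> cdom c" using chart_at[OF assms(1) p] by blast
  moreover obtain c' where "c' \<in> charts N" "f p \<in> cdom c'"
    using chart_at[OF assms(2) smooth_map_in_points[OF assms(3) p]] by blast
  ultimately show ?thesis using smooth_map_local_rep[OF assms(1-3)] assms(4) by metis
qed

section \<open>Tangent vectors in coordinates\<close>

lemma velocity_determined:
  assumes M: "smooth_atlas M" and N: "smooth_atlas N" and f: "smooth_map M N f"
    and c: "c \<in> charts M" "p \<in> cdom c" and c': "c' \<in> charts N" "f p \<in> cdom c'"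
    and "curve_at M p \<gamma>" "curve_at M p \<delta>" "velocity c \<gamma> = velocity c \<delta>"
  shows "velocity c' (f \<circ> \<gamma>) = velocity c' (f \<circ> \<delta>)"
  by (rule smooth_map_local_rep[OF M N f c c']) (use assms(8-10) in auto)

text \<open>
  Equal velocities in one chart at \<open>p\<close> imply equal velocities in all of them: transition maps are the coordinate
  forms of the identity, which is a smooth map.
\<close>

lemma tangent_class_eq_coords:
  assumes "smooth_atlas M" "c \<in> charts M" "p \<in> cdom c" "curve_at M p \<gamma>"
  shows "tangent_class M p \<gamma> = tangent_of_coords M c p (velocity c \<gamma>)"
  unfolding tangent_class_def tangent_of_coords_def
proof (intro Collect_cong conj_cong refl iffI ballI impI)
  fix \<delta> c' assume "curve_at M p \<delta>" "velocity c \<delta> = velocity c \<gamma>" "c' \<in> charts M" "p \<in> cdom c'"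
  then show "velocity c' \<delta> = velocity c' \<gamma>"
    using velocity_determined[OF assms(1,1) smooth_map_id[OF assms(1)] assms(2,3), of c' \<delta> \<gamma>] assms(4) by simp
qed (use assms in blast)

text \<open>
  Straight lines in the chart realise all velocities in the model subspace.
\<close>

lemma tangent_space_eq_coords:
  assumes "smooth_atlas M" "c \<in> charts M" "p \<in> cdom c"
  shows "tangent_space M p = tangent_of_coords M c p ` cmodel c"
proof
  show "tangent_space M p \<subseteq> tangent_of_coords M c p ` cmodel c"
    using tangent_class_eq_coords[OF assms] velocity_works(2)[OF assms(1) _ assms(2,3)]
    by (auto simp: tangent_space_def)
  show "tangent_of_coords M c p ` cmodel c \<subseteq> tangent_space M p"
  proof clarify
    fix u assume "u \<in> cmodel c"
    then obtain \<gamma> where "curve_at M p \<gamma>" "velocity c \<gamma> = u" using line_curve_exists[OF assms(2,3)] by blast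
    then show "tangent_of_coords M c p u \<in> tangent_space M p"
      using tangent_class_eq_coords[OF assms, of \<gamma>] by (auto simp: tangent_space_def)
  qed
qed

lemma tangent_of_coords_inj:
  assumes "c \<in> charts M" "p \<in> cdom c" "u \<in> cmodel c"
    and "tangent_of_coords M c p u = tangent_of_coords M c p v"
  shows "u = v"
proof -
  obtain \<gamma> where "curve_at M p \<gamma>" "velocity c \<gamma> = u" using line_curve_exists[OF assms(1,2,3)] by blast
  then have "\<gamma> \<in> tangent_of_coords M c p u" by (simp add: tangent_of_coords_def)
  then have "\<gamma> \<in> tangent_of_coords M c p v" unfolding assms(4) .
  then show ?thesis using \<open>velocity c \<gamma> = u\<close> by (simp add: tangent_of_coords_def)
qed

text \<open>
  The union that defines the differential is a union of equal sets, because the velocity of \<open>f \<circ> \<gamma>\<close> depends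
  only on that of \<open>\<gamma>\<close>.
\<close>

lemma tangent_map_class:
  assumes "smooth_atlas M" "smooth_atlas N" "smooth_map M N f" "curve_at M p \<gamma>"
  shows "tangent_map N f p (tangent_class M p \<gamma>) = tangent_class N (f p) (f \<circ> \<gamma>)"
proof -
  have p: "p \<in> points M" using curve_at_in_points[OF assms(4)] .
  obtain c where c: "c \<in> charts M" "p \<in> cdom c" using chart_at[OF assms(1) p] by blast
  obtain c' where c': "c' \<in> charts N" "f p \<in> cdom c'"
    using chart_at[OF assms(2) smooth_map_in_points[OF assms(3) p]] by blast
  have "tangent_class N (f p) (f \<circ> \<delta>) = tangent_class N (f p) (f \<circ> \<gamma>)" if "\<delta> \<in> tangent_class M p \<gamma>" for \<delta>
  proof -
    have d: "curve_at M p \<delta>" "velocity c \<delta> = velocity c \<gamma>" using that c by (auto simp: tangent_class_def)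
    then have "velocity c' (f \<circ> \<delta>) = velocity c' (f \<circ> \<gamma>)"
      using velocity_determined[OF assms(1-3) c c'] assms(4) by blast
    then show ?thesis
      using tangent_class_eq_coords[OF assms(2) c'] smooth_map_curve[OF assms(1-3)] d(1) assms(4) by metis
  qed
  moreover have "\<gamma> \<in> tangent_class M p \<gamma>" using assms(4) by (simp add: tangent_class_def)
  ultimately show ?thesis unfolding tangent_map_def by blast
qed

section \<open>Products\<close>

definition prod_chart :: "('m, 'e) chart \<Rightarrow> ('n, 'f) chart \<Rightarrow> ('m \<times> 'n, 'e \<times> 'f) chart" where
  "prod_chart c c' = \<lparr>cdom = cdom c \<times> cdom c', cmap = map_prod (cmap c) (cmap c'),
                      cmodel = cmodel c \<times> cmodel c'\<rparr>"

lemma prod_chart_simps [simp]: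
  "cdom (prod_chart c c') = cdom c \<times> cdom c'"
  "cmap (prod_chart c c') = map_prod (cmap c) (cmap c')"
  "cmodel (prod_chart c c') = cmodel c \<times> cmodel c'"
  by (simp_all add: prod_chart_def)

lemma cimage_prod_chart [simp]: "cimage (prod_chart c c') = cimage c \<times> cimage c'"
  by (simp add: cimage_def map_prod_surj_on)

lemma prod_manifold_simps [simp]:
  "mtop (prod_manifold M N) = prod_topology (mtop M) (mtop N)"
  "mdim (prod_manifold M N) = mdim M + mdim N"
  by (simp_all add: prod_manifold_def)

lemma atlas_prod_manifold: "atlas (prod_manifold M N) = {prod_chart c c' | c c'. c \<in> atlas M \<and> c' \<in> atlas N}"
  by (simp add: prod_manifold_def prod_chart_def)

lemma is_chart_prod:
  assumes c: "is_chart X n c" and c': "is_chart Y m c'"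
  shows "is_chart (prod_topology X Y) (n + m) (prod_chart c c')"
proof -
  have sub: "subspace (cmodel c)" "subspace (cmodel c')" using c c' by (auto simp: is_chart_def)
  obtain g where g: "homeomorphic_maps (subtopology X (cdom c)) (top_of_set (cimage c)) (cmap c) g"
    using c unfolding is_chart_def homeomorphic_map_maps by blast
  obtain g' where g': "homeomorphic_maps (subtopology Y (cdom c')) (top_of_set (cimage c')) (cmap c') g'"
    using c' unfolding is_chart_def homeomorphic_map_maps by blast
  have "homeomorphic_maps (prod_topology (subtopology X (cdom c)) (subtopology Y (cdom c')))
     (prod_topology (top_of_set (cimage c)) (top_of_set (cimage c'))) (\<lambda>(x,y). (cmap c x, cmap c' y)) (\<lambda>(x,y). (g x, g' y))"
    using g g' homeomorphic_maps_prod by blast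
  then have "homeomorphic_map (subtopology (prod_topology X Y) (cdom c \<times> cdom c'))
     (top_of_set (cimage c \<times> cimage c')) (map_prod (cmap c) (cmap c'))"
    unfolding homeomorphic_map_maps map_prod_def subtopology_Times prod_topology_subtopology_eu by blast
  moreover have "openin (prod_topology X Y) (cdom c \<times> cdom c')"
    using c c' by (simp add: openin_prod_Times_iff is_chart_openin)
  moreover have "openin (top_of_set (cmodel c \<times> cmodel c')) (cimage c \<times> cimage c')"
    using c c' by (auto simp: is_chart_def intro: openin_Times)
  ultimately show ?thesis
    using c c' sub by (simp add: is_chart_def subspace_Times dim_Times[OF sub])
qed

lemma transition_smooth_prod:
  assumes c: "is_chart X n c" "is_chart Y m c'"
    and s: "smooth_on (cmap c ` (cdom c \<inter> cdom a)) (cmap a \<circ> cinv c)"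
    and s': "smooth_on (cmap c' ` (cdom c' \<inter> cdom a')) (cmap a' \<circ> cinv c')"
  shows "smooth_on (cmap (prod_chart c c') ` (cdom (prod_chart c c') \<inter> cdom (prod_chart a a')))
           (cmap (prod_chart a a') \<circ> cinv (prod_chart c c'))"
proof -
  let ?S = "cmap (prod_chart c c') ` (cdom (prod_chart c c') \<inter> cdom (prod_chart a a'))"
  have 1: "smooth_on ?S (\<lambda>z. (cmap a \<circ> cinv c) (fst z))"
    by (rule smooth_on_compose[where g = fst, OF s smooth_on_linear[OF bounded_linear_fst]]) auto
  have 2: "smooth_on ?S (\<lambda>z. (cmap a' \<circ> cinv c') (snd z))"
    by (rule smooth_on_compose[where g = snd, OF s' smooth_on_linear[OF bounded_linear_snd]]) auto
  show ?thesis
  proof (rule smooth_on_cong[OF smooth_on_Pair[OF 1 2]])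
    fix x assume "x \<in> ?S"
    then obtain p q where pq: "p \<in> cdom c" "q \<in> cdom c'" "x = cmap (prod_chart c c') (p, q)" by auto
    have "cinv (prod_chart c c') x = (p, q)"
      unfolding pq(3) by (rule cinv_cmap[OF is_chart_prod[OF c]]) (use pq in auto)
    then show "((cmap a \<circ> cinv c) (fst x), (cmap a' \<circ> cinv c') (snd x)) =
        (cmap (prod_chart a a') \<circ> cinv (prod_chart c c')) x"
      using pq by (simp add: cinv_cmap[OF c(1)] cinv_cmap[OF c(2)])
  qed
qed

lemma smooth_atlas_prod:
  assumes M: "smooth_atlas M" and N: "smooth_atlas N"
  shows "smooth_atlas (prod_manifold M N)"
proof -
  have "compatible (prod_chart c c') (prod_chart a a')"
    if "c \<in> atlas M" "a \<in> atlas M" "c' \<in> atlas N" "a' \<in> atlas N" for c a c' a'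
  proof -
    have ch: "is_chart (mtop M) (mdim M) c" "is_chart (mtop N) (mdim N) c'"
      "is_chart (mtop M) (mdim M) a" "is_chart (mtop N) (mdim N) a'"
      and "compatible c a" "compatible c' a'"
      using that M N by (auto simp: smooth_atlas_def)
    then show ?thesis
      using transition_smooth_prod[OF ch(1,2), of a a'] transition_smooth_prod[OF ch(3,4), of c c']
      unfolding compatible_def by (simp add: Int_commute)
  qed
  moreover have "(\<Union>c\<in>atlas (prod_manifold M N). cdom c) = points (prod_manifold M N)"
  proof -
    have "(\<Union>c\<in>atlas (prod_manifold M N). cdom c) = (\<Union>c\<in>atlas M. cdom c) \<times> (\<Union>c\<in>atlas N. cdom c)"
      unfolding atlas_prod_manifold by fastforce
    then show ?thesis using M N by (simp add: smooth_atlas_def)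
  qed
  ultimately show ?thesis
    using M N unfolding smooth_atlas_def atlas_prod_manifold by (auto intro!: is_chart_prod)
qed

lemma prod_chart_at:
  assumes "smooth_atlas M" "smooth_atlas N" "p \<in> points M" "q \<in> points N"
  obtains c c' where "c \<in> charts M" "p \<in> cdom c" "c' \<in> charts N" "q \<in> cdom c'"
    "prod_chart c c' \<in> charts (prod_manifold M N)"
proof -
  obtain c where c: "c \<in> charts M" "c \<in> atlas M" "p \<in> cdom c" using chart_at[OF assms(1,3)] by blast
  obtain c' where c': "c' \<in> charts N" "c' \<in> atlas N" "q \<in> cdom c'" using chart_at[OF assms(2,4)] by blast
  have "prod_chart c c' \<in> charts (prod_manifold M N)"
    using atlas_subset_charts[OF smooth_atlas_prod[OF assms(1,2)]] c c' by (auto simp: atlas_prod_manifold)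
  then show ?thesis using that c c' by blast
qed

lemma smooth_map_fst:
  assumes "smooth_atlas M" "smooth_atlas N"
  shows "smooth_map (prod_manifold M N) M fst"
proof (rule smooth_mapI)
  fix z assume "z \<in> points (prod_manifold M N)"
  then have "fst z \<in> points M" "snd z \<in> points N" by auto
  then obtain c c' where c: "c \<in> charts M" "fst z \<in> cdom c" "c' \<in> charts N" "snd z \<in> cdom c'"
    "prod_chart c c' \<in> charts (prod_manifold M N)"
    by (rule prod_chart_at[OF assms]) (rule that)
  have "smooth_on (cmap (prod_chart c c') ` cdom (prod_chart c c')) (cmap c \<circ> fst \<circ> cinv (prod_chart c c'))"
  proof (rule smooth_on_cong[OF smooth_on_linear[OF bounded_linear_fst]], elim imageE)
    fix x y assume "x = cmap (prod_chart c c') y" "y \<in> cdom (prod_chart c c')"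
    then show "fst x = (cmap c \<circ> fst \<circ> cinv (prod_chart c c')) x"
      using cinv_cmap[OF charts_is_chart[OF c(5)]] by (cases y) auto
  qed
  then show "\<exists>a\<in>charts (prod_manifold M N). \<exists>c\<in>charts M. \<exists>W. openin (mtop (prod_manifold M N)) W \<and> z \<in> W \<and>
      W \<subseteq> cdom a \<and> fst ` W \<subseteq> cdom c \<and> smooth_on (cmap a ` W) (cmap c \<circ> fst \<circ> cinv a)"
    using c is_chart_openin[OF charts_is_chart[OF c(5)]]
    by (intro bexI[of _ "prod_chart c c'"] bexI[of _ c] exI[of _ "cdom (prod_chart c c')"]) (auto simp: mem_Times_iff)
qed auto

lemma smooth_map_snd:
  assumes "smooth_atlas M" "smooth_atlas N"
  shows "smooth_map (prod_manifold M N) N snd"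
proof (rule smooth_mapI)
  fix z assume "z \<in> points (prod_manifold M N)"
  then have "fst z \<in> points M" "snd z \<in> points N" by auto
  then obtain c c' where c: "c \<in> charts M" "fst z \<in> cdom c" "c' \<in> charts N" "snd z \<in> cdom c'"
    "prod_chart c c' \<in> charts (prod_manifold M N)"
    by (rule prod_chart_at[OF assms]) (rule that)
  have "smooth_on (cmap (prod_chart c c') ` cdom (prod_chart c c')) (cmap c' \<circ> snd \<circ> cinv (prod_chart c c'))"
  proof (rule smooth_on_cong[OF smooth_on_linear[OF bounded_linear_snd]], elim imageE)
    fix x y assume "x = cmap (prod_chart c c') y" "y \<in> cdom (prod_chart c c')"
    then show "snd x = (cmap c' \<circ> snd \<circ> cinv (prod_chart c c')) x"
      using cinv_cmap[OF charts_is_chart[OF c(5)]] by (cases y) auto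
  qed
  then show "\<exists>a\<in>charts (prod_manifold M N). \<exists>c\<in>charts N. \<exists>W. openin (mtop (prod_manifold M N)) W \<and> z \<in> W \<and>
      W \<subseteq> cdom a \<and> snd ` W \<subseteq> cdom c \<and> smooth_on (cmap a ` W) (cmap c \<circ> snd \<circ> cinv a)"
    using c is_chart_openin[OF charts_is_chart[OF c(5)]]
    by (intro bexI[of _ "prod_chart c c'"] bexI[of _ c'] exI[of _ "cdom (prod_chart c c')"]) (auto simp: mem_Times_iff)
qed auto

lemma curve_at_Pair:
  assumes M: "smooth_atlas M" and N: "smooth_atlas N" and \<gamma>: "curve_at M p \<gamma>" and \<delta>: "curve_at N q \<delta>"
  shows "curve_at (prod_manifold M N) (p, q) (\<lambda>t. (\<gamma> t, \<delta> t))"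
proof -
  obtain c c' where c: "c \<in> charts M" "p \<in> cdom c" "c' \<in> charts N" "q \<in> cdom c'"
    "prod_chart c c' \<in> charts (prod_manifold M N)"
    by (rule prod_chart_at[OF M N curve_at_in_points[OF \<gamma>] curve_at_in_points[OF \<delta>]]) (rule that)
  obtain r where r: "r > 0" "\<And>t. t \<in> {-r<..<r} \<Longrightarrow> \<gamma> t \<in> cdom c \<inter> cdom c" "smooth_on {-r<..<r} (cmap c \<circ> \<gamma>)"
    by (rule curve_at_in_chart[OF M \<gamma> c(1,2) is_chart_openin[OF charts_is_chart[OF c(1)]] c(2)]) (rule that)
  obtain s where s: "s > 0" "\<And>t. t \<in> {-s<..<s} \<Longrightarrow> \<delta> t \<in> cdom c' \<inter> cdom c'" "smooth_on {-s<..<s} (cmap c' \<circ> \<delta>)"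
    by (rule curve_at_in_chart[OF N \<delta> c(3,4) is_chart_openin[OF charts_is_chart[OF c(3)]] c(4)]) (rule that)
  define h where "h = min r s"
  have h: "h > 0" "{-h<..<h} \<subseteq> {-r<..<r}" "{-h<..<h} \<subseteq> {-s<..<s}" using r s by (auto simp: h_def)
  show ?thesis
  proof (rule curve_atI[OF _ c(5) h(1)])
    show "(\<gamma> 0, \<delta> 0) = (p, q)" using curve_at_base[OF \<gamma>] curve_at_base[OF \<delta>] by simp
    show "(\<gamma> t, \<delta> t) \<in> cdom (prod_chart c c')" if "t \<in> {-h<..<h}" for t
      using r(2)[of t] s(2)[of t] that h by auto
    have "smooth_on {-h<..<h} (\<lambda>t. ((cmap c \<circ> \<gamma>) t, (cmap c' \<circ> \<delta>) t))"
      by (intro smooth_on_Pair smooth_on_subset[OF r(3) h(2)] smooth_on_subset[OF s(3) h(3)])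
    then show "smooth_on {-h<..<h} (cmap (prod_chart c c') \<circ> (\<lambda>t. (\<gamma> t, \<delta> t)))"
      by (simp add: o_def)
  qed
qed

lemma curve_at_const:
  assumes "smooth_atlas M" "p \<in> points M"
  shows "curve_at M p (\<lambda>t. p)"
proof -
  obtain c where "c \<in> charts M" "p \<in> cdom c" using chart_at[OF assms] by blast
  then show ?thesis using curve_atI[of "\<lambda>t. p" p c M 1] smooth_on_const[of "{-1<..<1}" "cmap c p"] by (simp add: o_def)
qed

section \<open>Embedded submanifolds\<close>

text \<open>
  The chart that a slice chart \<open>c\<close> of the ambient manifold induces on the submanifold.
\<close>

definition slice :: "('m, 'e) chart \<Rightarrow> 'm set \<Rightarrow> 'e set \<Rightarrow> ('m, 'e) chart" where
  "slice c S F = \<lparr>cdom = cdom c \<inter> S, cmap = cmap c, cmodel = F\<rparr>"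

lemma slice_simps [simp]:
  "cdom (slice c S F) = cdom c \<inter> S" "cmap (slice c S F) = cmap c" "cmodel (slice c S F) = F"
  by (simp_all add: slice_def)

lemma submanifold_simps [simp]:
  "mtop (submanifold M k S) = subtopology (mtop M) S" "mdim (submanifold M k S) = k"
  by (simp_all add: submanifold_def)

lemma atlas_submanifold: "atlas (submanifold M k S) = {slice c S F | c F. slice_chart M k S c F}"
  by (simp add: submanifold_def slice_def)

lemma points_submanifold: "embedded_submanifold M k S \<Longrightarrow> points (submanifold M k S) = S"
  by (auto simp: embedded_submanifold_def)

lemma is_chart_slice:
  assumes "slice_chart M k S c F"
  shows "is_chart (subtopology (mtop M) S) k (slice c S F)"
proof (rule is_chartI)
  have c: "c \<in> charts M" and F: "subspace F" "F \<subseteq> cmodel c" "dim F = k"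
    and im: "cmap c ` (cdom c \<inter> S) = cimage c \<inter> F"
    using assms by (auto simp: slice_chart_def)
  note ch = charts_is_chart[OF c]
  show "openin (subtopology (mtop M) S) (cdom (slice c S F))"
    using is_chart_openin[OF ch] by (auto simp: openin_subtopology)
  show "subspace (cmodel (slice c S F))" "dim (cmodel (slice c S F)) = k" using F by auto
  show "inj_on (cmap (slice c S F)) (cdom (slice c S F))"
    using is_chart_inj[OF ch] by (auto intro: inj_on_subset)
  show "openin (subtopology (mtop M) S) {q \<in> cdom (slice c S F). cmap (slice c S F) q \<in> V}" if "open V" for V
  proof -
    have "{q \<in> cdom (slice c S F). cmap (slice c S F) q \<in> V} = {q \<in> cdom c. cmap c q \<in> V} \<inter> S" by auto
    then show ?thesis using is_chart_open_vimage[OF ch that] by (auto simp: openin_subtopology)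
  qed
  show "openin (top_of_set (cmodel (slice c S F))) (cmap (slice c S F) ` W)"
    if W: "openin (subtopology (mtop M) S) W" "W \<subseteq> cdom (slice c S F)" for W
  proof -
    obtain T where T: "openin (mtop M) T" "W = T \<inter> S" using W(1) by (auto simp: openin_subtopology)
    have "openin (mtop M) (cdom c \<inter> T)" using T is_chart_openin[OF ch] by blast
    then obtain V where V: "open V" "cmap c ` (cdom c \<inter> T) = V \<inter> cmodel c"
      "\<And>q. q \<in> cdom c \<Longrightarrow> cmap c q \<in> V \<longleftrightarrow> q \<in> cdom c \<inter> T"
      by (rule is_chart_open_image[OF ch _ Int_lower1]) (rule that)
    have "cmap c ` W = F \<inter> V"
    proof
      show "cmap c ` W \<subseteq> F \<inter> V"
      proof
        fix x assume "x \<in> cmap c ` W"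
        then obtain q where q: "q \<in> cdom c" "q \<in> S" "q \<in> T" "x = cmap c q" using W(2) T(2) by auto
        then have "x \<in> cmap c ` (cdom c \<inter> S)" by blast
        then have "x \<in> F" unfolding im by simp
        then show "x \<in> F \<inter> V" using q V(3)[OF q(1)] by simp
      qed
      show "F \<inter> V \<subseteq> cmap c ` W"
      proof
        fix x assume x: "x \<in> F \<inter> V"
        then have "x \<in> V \<inter> cmodel c" using F by blast
        then have "x \<in> cmap c ` (cdom c \<inter> T)" unfolding V(2) .
        then have "x \<in> cimage c" by (auto simp: cimage_def)
        with x have "x \<in> cmap c ` (cdom c \<inter> S)" unfolding im by simp
        then obtain q where q: "q \<in> cdom c" "q \<in> S" "x = cmap c q" by blast
        then have "q \<in> T" using V(3)[OF q(1)] x by simp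
        then show "x \<in> cmap c ` W" using q T(2) by blast
      qed
    qed
    then show ?thesis using V(1) by auto
  qed
qed

lemma cinv_slice:
  "slice_chart M k S c F \<Longrightarrow> p \<in> cdom c \<Longrightarrow> p \<in> S \<Longrightarrow> cinv (slice c S F) (cmap c p) = p"
  using cinv_cmap[OF is_chart_slice, of M k S c F p] by simp

lemma smooth_atlas_submanifold:
  assumes M: "smooth_atlas M" and S: "embedded_submanifold M k S"
  shows "smooth_atlas (submanifold M k S)"
proof -
  have t: "smooth_on (cmap (slice c S F) ` (cdom (slice c S F) \<inter> cdom (slice a S H)))
        (cmap (slice a S H) \<circ> cinv (slice c S F))"
    if s: "slice_chart M k S c F" "slice_chart M k S a H" for c F a H
  proof -
    have c: "c \<in> charts M" "a \<in> charts M" using s by (auto simp: slice_chart_def)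
    have "smooth_on (cmap c ` ((cdom c \<inter> S) \<inter> (cdom a \<inter> S))) (cmap a \<circ> cinv c)"
      by (rule smooth_on_subset[OF charts_transition_smooth[OF M c]]) auto
    then have "smooth_on (cmap c ` ((cdom c \<inter> S) \<inter> (cdom a \<inter> S))) (cmap a \<circ> cinv (slice c S F))"
      by (rule smooth_on_cong) (use cinv_slice[OF s(1)] cinv_cmap[OF charts_is_chart[OF c(1)]] in auto)
    then show ?thesis by simp
  qed
  have "(\<Union>c\<in>atlas (submanifold M k S). cdom c) = S"
    using S unfolding atlas_submanifold embedded_submanifold_def by fastforce
  moreover have "compatible c c'" if "c \<in> atlas (submanifold M k S)" "c' \<in> atlas (submanifold M k S)" for c c'
  proof -
    from that obtain a F a' F' where s: "c = slice a S F" "slice_chart M k S a F"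
      "c' = slice a' S F'" "slice_chart M k S a' F'"
      unfolding atlas_submanifold by blast
    show ?thesis
      unfolding compatible_def s(1,3) using t[OF s(2,4)] t[OF s(4,2)] by (metis Int_commute)
  qed
  ultimately show ?thesis
    unfolding smooth_atlas_def points_submanifold[OF S]
    by (auto simp: atlas_submanifold intro: is_chart_slice)
qed

lemma slice_in_charts:
  assumes "smooth_atlas M" "embedded_submanifold M k S" "slice_chart M k S c F"
  shows "slice c S F \<in> charts (submanifold M k S)"
  using atlas_subset_charts[OF smooth_atlas_submanifold[OF assms(1,2)]] assms(3)
  by (auto simp: atlas_submanifold)

lemma slice_chart_at:
  assumes "embedded_submanifold M k S" "p \<in> S"
  obtains c F where "slice_chart M k S c F" "c \<in> charts M" "p \<in> cdom c"
  using assms unfolding embedded_submanifold_def slice_chart_def by metis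

lemma smooth_map_submanifold:
  assumes M: "smooth_atlas M" and N: "smooth_atlas N" and S: "embedded_submanifold M k S"
    and f: "smooth_map M N f"
  shows "smooth_map (submanifold M k S) N f"
proof (rule smooth_mapI)
  have SM: "S \<subseteq> points M" using S by (simp add: embedded_submanifold_def)
  show "f ` points (submanifold M k S) \<subseteq> points N"
    using smooth_map_in_points[OF f] SM points_submanifold[OF S] by blast
  fix p assume "p \<in> points (submanifold M k S)"
  then have p: "p \<in> S" using points_submanifold[OF S] by simp
  obtain c F where s: "slice_chart M k S c F" and c: "c \<in> charts M" "p \<in> cdom c"
    using slice_chart_at[OF S p] by blast
  obtain c' where c': "c' \<in> charts N" "f p \<in> cdom c'"
    using chart_at[OF N smooth_map_in_points[OF f]] SM p by blast
  obtain W where W: "openin (mtop M) W" "p \<in> W" "W \<subseteq> cdom c" "f ` W \<subseteq> cdom c'"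
    "smooth_on (cmap c ` W) (cmap c' \<circ> f \<circ> cinv c)"
    by (rule smooth_map_in_charts[OF M N f c c']) (rule that)
  have "smooth_on (cmap c ` (W \<inter> S)) (cmap c' \<circ> f \<circ> cinv c)"
    by (rule smooth_on_subset[OF W(5)]) auto
  then have "smooth_on (cmap c ` (W \<inter> S)) (cmap c' \<circ> f \<circ> cinv (slice c S F))"
    by (rule smooth_on_cong) (use W(3) cinv_slice[OF s] cinv_cmap[OF charts_is_chart[OF c(1)]] in \<open>auto simp: subset_iff\<close>)
  moreover have "openin (subtopology (mtop M) S) (W \<inter> S)" using W(1) by (auto simp: openin_subtopology)
  ultimately show "\<exists>c\<in>charts (submanifold M k S). \<exists>c'\<in>charts N. \<exists>W. openin (mtop (submanifold M k S)) W \<and> p \<in> W \<and>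
      W \<subseteq> cdom c \<and> f ` W \<subseteq> cdom c' \<and> smooth_on (cmap c ` W) (cmap c' \<circ> f \<circ> cinv c)"
    using slice_in_charts[OF M S s] c' W p
    by (intro bexI[of _ "slice c S F"] bexI[of _ c'] exI[of _ "W \<inter> S"]) auto
qed

text \<open>
  In a slice chart the coordinates of the curve are the same as in the ambient chart, hence smooth.
\<close>

lemma curve_at_submanifoldI:
  assumes M: "smooth_atlas M" and S: "embedded_submanifold M k S"
    and \<gamma>: "curve_at M p \<gamma>" and "\<And>t. \<gamma> t \<in> S"
  shows "curve_at (submanifold M k S) p \<gamma>"
proof -
  have p: "p \<in> S" using assms(4)[of 0] curve_at_base[OF \<gamma>] by simp
  obtain c F where s: "slice_chart M k S c F" and c: "c \<in> charts M" "p \<in> cdom c"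
    using slice_chart_at[OF S p] by blast
  obtain r where r: "r > 0" "\<And>t. t \<in> {-r<..<r} \<Longrightarrow> \<gamma> t \<in> cdom c \<inter> cdom c" "smooth_on {-r<..<r} (cmap c \<circ> \<gamma>)"
    by (rule curve_at_in_chart[OF M \<gamma> c is_chart_openin[OF charts_is_chart[OF c(1)]] c(2)]) (rule that)
  show ?thesis
    by (rule curve_atI[where \<gamma> = \<gamma> and r = r, OF _ slice_in_charts[OF M S s]])
       (use r assms(4) curve_at_base[OF \<gamma>] in auto)
qed

lemma curve_at_submanifoldD:
  assumes M: "smooth_atlas M" and S: "embedded_submanifold M k S" and \<gamma>: "curve_at (submanifold M k S) p \<gamma>"
  shows "curve_at M p \<gamma>"
  using smooth_map_curve[OF smooth_atlas_submanifold[OF M S] M smooth_map_submanifold[OF M M S smooth_map_id[OF M]] \<gamma>]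
  by simp

lemma submanifold_tangent_space_eq:
  assumes M: "smooth_atlas M" and S: "embedded_submanifold M k S"
  shows "submanifold_tangent_space M k S p = {tangent_class M p \<gamma> | \<gamma>. curve_at (submanifold M k S) p \<gamma>}"
proof -
  have "tangent_map M id p (tangent_class (submanifold M k S) p \<gamma>) = tangent_class M p \<gamma>"
    if "curve_at (submanifold M k S) p \<gamma>" for \<gamma>
    using tangent_map_class[OF smooth_atlas_submanifold[OF M S] M smooth_map_submanifold[OF M M S smooth_map_id[OF M]] that]
    by simp
  then show ?thesis unfolding submanifold_tangent_space_def tangent_space_def by (auto simp: image_iff)
qed

text \<open>
  A curve in the submanifold has its coordinates in \<open>F\<close>, and so has its velocity; conversely, a straight line in \<open>F\<close>
  is the coordinate form of a curve in the submanifold.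
\<close>

lemma submanifold_tangent_space_coords:
  assumes M: "smooth_atlas M" and S: "embedded_submanifold M k S"
    and s: "slice_chart M k S c F" and p: "p \<in> cdom c" "p \<in> S"
  shows "submanifold_tangent_space M k S p = tangent_of_coords M c p ` F"
proof -
  have c: "c \<in> charts M" using s by (simp add: slice_chart_def)
  note sl = slice_in_charts[OF M S s]
  have ps: "p \<in> cdom (slice c S F)" using p by simp
  have v: "velocity (slice c S F) \<gamma> = velocity c \<gamma>" for \<gamma> by (simp add: velocity_def)
  show ?thesis
    unfolding submanifold_tangent_space_eq[OF M S]
  proof (intro equalityI subsetI)
    fix x assume "x \<in> {tangent_class M p \<gamma> |\<gamma>. curve_at (submanifold M k S) p \<gamma>}"
    then obtain \<gamma> where g: "x = tangent_class M p \<gamma>" "curve_at (submanifold M k S) p \<gamma>" by blast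
    have "velocity c \<gamma> \<in> F"
      using velocity_works(2)[OF smooth_atlas_submanifold[OF M S] g(2) sl ps] v by simp
    then show "x \<in> tangent_of_coords M c p ` F"
      using tangent_class_eq_coords[OF M c p(1) curve_at_submanifoldD[OF M S g(2)]] g(1) by blast
  next
    fix x assume "x \<in> tangent_of_coords M c p ` F"
    then obtain u where u: "u \<in> F" "x = tangent_of_coords M c p u" by blast
    obtain \<gamma> where g: "curve_at (submanifold M k S) p \<gamma>" "velocity (slice c S F) \<gamma> = u"
      by (rule line_curve_exists[OF sl ps, of u]) (use u in \<open>auto intro: that\<close>)
    then show "x \<in> {tangent_class M p \<gamma> |\<gamma>. curve_at (submanifold M k S) p \<gamma>}"
      using tangent_class_eq_coords[OF M c p(1) curve_at_submanifoldD[OF M S g(1)]] u v by auto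
  qed
qed

section \<open>Open submanifolds\<close>

lemma open_submanifold_simps [simp]:
  "mtop (open_submanifold M U) = subtopology (mtop M) U" "mdim (open_submanifold M U) = mdim M"
  "atlas (open_submanifold M U) = {c \<in> charts M. cdom c \<subseteq> U}"
  by (simp_all add: open_submanifold_def)

lemma points_open_submanifold: "openin (mtop M) U \<Longrightarrow> points (open_submanifold M U) = U"
  using openin_subset by fastforce

lemma is_chart_open_subtopology:
  assumes U: "openin X U" and c: "is_chart X n c" "cdom c \<subseteq> U"
  shows "is_chart (subtopology X U) n c"
proof -
  have "subtopology (subtopology X U) (cdom c) = subtopology X (cdom c)"
    using c(2) by (simp add: subtopology_subtopology Int_absorb1)
  then show ?thesis using assms by (simp add: is_chart_def openin_open_subtopology)
qed

lemma restrict_chart_in_open_submanifold: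
  assumes "c \<in> charts M" "openin (mtop M) U"
  shows "restrict_chart c U \<in> atlas (open_submanifold M U)"
  using restrict_chart_in_charts[OF assms] by simp

lemma smooth_atlas_open_submanifold:
  assumes M: "smooth_atlas M" and U: "openin (mtop M) U"
  shows "smooth_atlas (open_submanifold M U)"
proof -
  have "(\<Union>c\<in>atlas (open_submanifold M U). cdom c) = U"
  proof
    show "U \<subseteq> (\<Union>c\<in>atlas (open_submanifold M U). cdom c)"
    proof
      fix p assume p: "p \<in> U"
      then have "p \<in> points M" using openin_subset[OF U] by blast
      then obtain c where "c \<in> charts M" "p \<in> cdom c" using chart_at[OF M] by blast
      then show "p \<in> (\<Union>c\<in>atlas (open_submanifold M U). cdom c)"
        using restrict_chart_in_open_submanifold[OF _ U, of c] p
          by (intro UN_I[of "restrict_chart c U"]) auto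
    qed
  qed auto
  then show ?thesis
    unfolding smooth_atlas_def points_open_submanifold[OF U]
    using charts_compatible[OF M] by (auto intro: is_chart_open_subtopology[OF U] charts_is_chart)
qed

lemma restrict_chart_in_open_submanifold_charts:
  assumes "smooth_atlas M" "c \<in> charts M" "openin (mtop M) U"
  shows "restrict_chart c U \<in> charts (open_submanifold M U)"
  using restrict_chart_in_open_submanifold[OF assms(2,3)] atlas_subset_charts[OF smooth_atlas_open_submanifold[OF assms(1,3)]]
  by blast

lemma velocity_restrict_chart [simp]: "velocity (restrict_chart c U) \<gamma> = velocity c \<gamma>"
  by (simp add: velocity_def)

lemma curve_at_open_submanifoldD:
  assumes M: "smooth_atlas M" and U: "openin (mtop M) U" and \<gamma>: "curve_at (open_submanifold M U) p \<gamma>"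
  shows "curve_at M p \<gamma>"
proof -
  note MU = smooth_atlas_open_submanifold[OF M U]
  have "p \<in> U" using curve_at_in_points[OF \<gamma>] points_open_submanifold[OF U] by simp
  moreover then have "p \<in> points M" using openin_subset[OF U] by blast
  then obtain c where c: "c \<in> charts M" "p \<in> cdom c" using chart_at[OF M] by blast
  ultimately have pc: "p \<in> cdom (restrict_chart c U)" by simp
  note rc = restrict_chart_in_open_submanifold_charts[OF M c(1) U]
  obtain r where r: "r > 0" "\<And>t. t \<in> {-r<..<r} \<Longrightarrow> \<gamma> t \<in> cdom (restrict_chart c U) \<inter> cdom (restrict_chart c U)"
    "smooth_on {-r<..<r} (cmap (restrict_chart c U) \<circ> \<gamma>)"
    by (rule curve_at_in_chart[OF MU \<gamma> rc pc is_chart_openin[OF charts_is_chart[OF rc]] pc]) (rule that)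
  show ?thesis
    by (rule curve_atI[where \<gamma> = \<gamma> and r = r, OF _ c(1)]) (use r curve_at_base[OF \<gamma>] in auto)
qed

section \<open>Local diffeomorphisms and derivatives\<close>

lemma curve_eventually_in_open:
  assumes "smooth_atlas M" "curve_at M p \<gamma>" "openin (mtop M) U" "p \<in> U"
  obtains r where "r > 0" "\<And>t. t \<in> {-r<..<r} \<Longrightarrow> \<gamma> t \<in> U"
proof -
  obtain c where c: "c \<in> charts M" "p \<in> cdom c" using chart_at[OF assms(1) curve_at_in_points[OF assms(2)]] by blast
  obtain r where "r > 0" "\<And>t. t \<in> {-r<..<r} \<Longrightarrow> \<gamma> t \<in> cdom c \<inter> U" "smooth_on {-r<..<r} (cmap c \<circ> \<gamma>)"
    by (rule curve_at_in_chart[OF assms(1,2) c assms(3,4)]) (rule that)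
  then show ?thesis using that by blast
qed

text \<open>
  Transport curves back and forth: a local inverse \<open>g\<close> is smooth and has a derivative \<open>D'\<close>. A curve \<open>\<gamma>\<close>
  agrees with \<open>g \<circ> f \<circ> \<gamma>\<close> near time 0, so \<open>D'\<close> inverts \<open>D\<close> on velocities, and any curve \<open>\<delta>\<close> at \<open>f p\<close> agrees with
  \<open>f \<circ> g \<circ> \<delta>\<close> near time 0, so all velocities at \<open>f p\<close> are attained.
\<close>

lemma local_diffeomorphism_derivative_bij:
  assumes M: "smooth_atlas M" and N: "smooth_atlas N"
    and f: "local_diffeomorphism M N f"
    and c: "c \<in> charts M" "p \<in> cdom c" and c': "c' \<in> charts N" "f p \<in> cdom c'"
    and D: "\<And>\<gamma>. curve_at M p \<gamma> \<Longrightarrow> velocity c' (f \<circ> \<gamma>) = D (velocity c \<gamma>)"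
  shows "bij_betw D (cmodel c) (cmodel c')"
proof -
  have "p \<in> points M" using is_chart_cdom_subset[OF charts_is_chart[OF c(1)]] c(2) by blast
  then obtain U where U: "openin (mtop M) U" "p \<in> U" and fU: "openin (mtop N) (f ` U)"
    and diff: "diffeomorphism (open_submanifold M U) (open_submanifold N (f ` U)) f"
    using f unfolding local_diffeomorphism_def by blast
  let ?M = "open_submanifold M U" and ?N = "open_submanifold N (f ` U)"
  define g where "g = inv_into U f"
  have pts: "points ?M = U" "points ?N = f ` U" using points_open_submanifold U(1) fU by blast+
  have inj: "inj_on f U" and sf: "smooth_map ?M ?N f" and sg: "smooth_map ?N ?M g"
    using diff unfolding diffeomorphism_def pts g_def by (auto simp: bij_betw_def)
  note M' = smooth_atlas_open_submanifold[OF M U(1)] and N' = smooth_atlas_open_submanifold[OF N fU]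
  have gf: "g (f q) = q" if "q \<in> U" for q using inj that by (simp add: g_def)
  have fg: "f (g r) = r" if "r \<in> f ` U" for r using that by (simp add: g_def f_inv_into_f)
  note cU = restrict_chart_in_open_submanifold_charts[OF M c(1) U(1)]
    and c'U = restrict_chart_in_open_submanifold_charts[OF N c'(1) fU]
  have pU: "p \<in> cdom (restrict_chart c U)" "f p \<in> cdom (restrict_chart c' (f ` U))"
    "g (f p) \<in> cdom (restrict_chart c U)"
    using U(2) c(2) c'(2) gf by auto
  obtain D' where D': "\<And>\<delta>. curve_at ?N (f p) \<delta> \<Longrightarrow> velocity c (g \<circ> \<delta>) = D' (velocity c' \<delta>)"
    by (rule smooth_map_local_rep[OF N' M' sg c'U pU(2) cU pU(3)]) (use that in auto)
  have p1: "openin (mtop ?M) U" "openin (mtop ?N) (f ` U)" using U(1) fU by (auto simp: openin_open_subtopology)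
  have inv: "D u \<in> cmodel c' \<and> D' (D u) = u" if u: "u \<in> cmodel c" for u
  proof -
    obtain \<gamma> where \<gamma>: "curve_at ?M p \<gamma>" "velocity c \<gamma> = u"
      by (rule line_curve_exists[OF cU pU(1), of u]) (use u that in auto)
    have f\<gamma>: "curve_at ?N (f p) (f \<circ> \<gamma>)" by (rule smooth_map_curve[OF M' N' sf \<gamma>(1)])
    have Du: "velocity c' (f \<circ> \<gamma>) = D u"
      using D[OF curve_at_open_submanifoldD[OF M U(1) \<gamma>(1)]] \<gamma>(2) by simp
    obtain r where r: "r > 0" "\<And>t. t \<in> {-r<..<r} \<Longrightarrow> \<gamma> t \<in> U"
      by (rule curve_eventually_in_open[OF M' \<gamma>(1) p1(1) U(2)]) (rule that)
    have "velocity c (g \<circ> (f \<circ> \<gamma>)) = u"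
      by (rule velocity_cong_local[OF r(1), where \<gamma> = \<gamma>])
         (use r(2) gf velocity_works(1)[OF M' \<gamma>(1) cU pU(1)] \<gamma>(2) in auto)
    then have "D' (D u) = u" using D'[OF f\<gamma>] Du by simp
    moreover have "D u \<in> cmodel c'" using velocity_works(2)[OF N' f\<gamma> c'U pU(2)] Du by simp
    ultimately show ?thesis by simp
  qed
  moreover have "\<exists>u\<in>cmodel c. D u = w" if w: "w \<in> cmodel c'" for w
  proof -
    obtain \<delta> where \<delta>: "curve_at ?N (f p) \<delta>" "velocity c' \<delta> = w"
      by (rule line_curve_exists[OF c'U pU(2), of w]) (use w that in auto)
    have g\<delta>: "curve_at ?M p (g \<circ> \<delta>)" using smooth_map_curve[OF N' M' sg \<delta>(1)] gf U(2) by simp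
    have fp: "f p \<in> f ` U" using U(2) by blast
    obtain r where r: "r > 0" "\<And>t. t \<in> {-r<..<r} \<Longrightarrow> \<delta> t \<in> f ` U"
      by (rule curve_eventually_in_open[OF N' \<delta>(1) p1(2) fp]) (rule that)
    have "velocity c' (f \<circ> (g \<circ> \<delta>)) = w"
      by (rule velocity_cong_local[OF r(1), where \<gamma> = \<delta>])
         (use fg[OF r(2)] velocity_works(1)[OF N' \<delta>(1) c'U pU(2)] \<delta>(2) in auto)
    then have "D (velocity c (g \<circ> \<delta>)) = w"
      using D[OF curve_at_open_submanifoldD[OF M U(1) g\<delta>]] by simp
    moreover have "velocity c (g \<circ> \<delta>) \<in> cmodel c" using velocity_works(2)[OF M' g\<delta> cU pU(1)] by simp
    ultimately show ?thesis by blast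
  qed
  ultimately show ?thesis
    unfolding bij_betw_def by (intro conjI inj_on_inverseI[of _ D'] equalityI subsetI) (auto simp: image_iff)
qed


text \<open>
  The inverse function theorem on manifolds. The models \<open>?E\<close> and \<open>?E'\<close> are subspaces of different
  Euclidean spaces, and \<open>F\<close> is defined off \<open>?E\<close> without any control of its values there. Let \<open>T\<close> be a linear map
  that inverts the derivative of \<open>F\<close> on \<open>?E\<close>, and \<open>\<pi>\<close> a projection onto \<open>?E\<close>. Then
  \<open>h x = T (F (\<pi> x)) + (x - \<pi> x)\<close> maps an open set of the whole space into that space, has the identity as its
  derivative at the base point, and satisfies \<open>h x \<in> ?E \<longleftrightarrow> x \<in> ?E\<close>. A local inverse \<open>g\<close> of \<open>h\<close> therefore respects
  \<open>?E\<close>, and \<open>g \<circ> T\<close> is a local inverse of \<open>F\<close> on the models.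
\<close>

lemma bij_derivative_imp_local_diffeomorphism:
  fixes M :: "('m, 'e::euclidean_space) manifold" and N :: "('n, 'f::euclidean_space) manifold"
  assumes M: "smooth_atlas M" and N: "smooth_atlas N" and f: "smooth_map M N f"
    and bij: "\<And>p. p \<in> points M \<Longrightarrow> \<exists>c c' D. c \<in> charts M \<and> p \<in> cdom c \<and> c' \<in> charts N \<and> f p \<in> cdom c' \<and>
      (\<forall>\<gamma>. curve_at M p \<gamma> \<longrightarrow> velocity c' (f \<circ> \<gamma>) = D (velocity c \<gamma>)) \<and> bij_betw D (cmodel c) (cmodel c')"
  shows "local_diffeomorphism M N f"
  unfolding local_diffeomorphism_def
proof
  fix p assume "p \<in> points M"
  then obtain c c' D where c: "c \<in> charts M" "p \<in> cdom c" and c': "c' \<in> charts N" "f p \<in> cdom c'"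
    and D: "\<And>\<gamma>. curve_at M p \<gamma> \<Longrightarrow> velocity c' (f \<circ> \<gamma>) = D (velocity c \<gamma>)"
    and bD: "bij_betw D (cmodel c) (cmodel c')"
    using bij by metis
  note ch = charts_is_chart[OF c(1)] and ch' = charts_is_chart[OF c'(1)]
  let ?E = "cmodel c" and ?E' = "cmodel c'"
  have sub: "subspace ?E" "subspace ?E'" using ch ch' by (auto simp: is_chart_def)
  obtain W U F where W: "openin (mtop M) W" "p \<in> W" "W \<subseteq> cdom c" "f ` W \<subseteq> cdom c'"
    and U: "open U" "cmap c ` W = U \<inter> ?E" and CF: "\<And>k. C_k_on_open k U F"
    and Ff: "\<And>q. q \<in> W \<Longrightarrow> F (cmap c q) = cmap c' (f q)"
    and FD: "\<And>\<gamma>. curve_at M p \<gamma> \<Longrightarrow> velocity c' (f \<circ> \<gamma>) = frechet_derivative F (at (cmap c p)) (velocity c \<gamma>)"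
    by (rule smooth_map_local_rep[OF M N f c c']) (rule that)
  let ?x0 = "cmap c p"
  have "?x0 \<in> cmap c ` W" using W(2) by blast
  then have x0: "?x0 \<in> U" "?x0 \<in> ?E" unfolding U(2) by auto
  define L where "L = frechet_derivative F (at ?x0)"
  have FL: "(F has_derivative L) (at ?x0)"
    unfolding L_def by (rule C_k_on_open_Suc_has_derivative[OF CF x0(1)])
  have linL: "linear L" using FL has_derivative_linear by blast
  have LD: "L u = D u" if u: "u \<in> ?E" for u
    by (rule line_curve_exists[OF c u]) (use D FD in \<open>auto simp: L_def\<close>)
  have bL: "bij_betw L ?E ?E'" using bD LD bij_betw_cong by blast
  then have injL: "inj_on L ?E" and surjL: "L ` ?E = ?E'" by (auto simp: bij_betw_def)
  obtain T where T: "range T \<subseteq> ?E" "linear T" "\<And>u. u \<in> ?E \<Longrightarrow> T (L u) = u"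
    using linear_exists_left_inverse_on[OF linL sub(1) injL] by metis
  have LT: "L (T w) = w" if w: "w \<in> ?E'" for w
  proof -
    have "w \<in> L ` ?E" unfolding surjL by (rule w)
    then show ?thesis using T(3) by auto
  qed
  obtain \<pi> :: "'e \<Rightarrow> 'e" where \<pi>: "range \<pi> \<subseteq> ?E" "linear \<pi>" "\<And>u. u \<in> ?E \<Longrightarrow> \<pi> u = u"
    using linear_exists_left_inverse_on[OF linear_id sub(1)] by auto
  have bl: "bounded_linear T" "bounded_linear \<pi>"
    using T(2) \<pi>(2) linear_conv_bounded_linear by blast+
  define U2 where "U2 = \<pi> -` U"
  have U2: "open U2" unfolding U2_def
    by (intro open_vimage U(1) linear_continuous_on bl)
  define h where "h x = T (F (\<pi> x)) + (x - \<pi> x)" for x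
  have Ch: "C_k_on_open k U2 h" for k
  proof -
    have 1: "C_k_on_open k U2 \<pi>" by (rule C_k_on_open_linear[OF U2 bl(2)])
    have 2: "C_k_on_open k U2 (\<lambda>x. F (\<pi> x))"
      by (rule C_k_on_open_compose[OF U2 U(1) _ 1 CF]) (auto simp: U2_def)
    have 3: "C_k_on_open k U2 (\<lambda>x. x - \<pi> x)"
      by (intro C_k_on_open_linear[OF U2] bounded_linear_sub bounded_linear_ident bl)
    show ?thesis
      unfolding h_def by (intro C_k_on_open_add[OF U2] 3 C_k_on_open_linear_compose[OF U2 bl(1) 2])
  qed
  have x0': "?x0 \<in> U2" using x0 \<pi>(3) by (simp add: U2_def)
  have "(h has_derivative (\<lambda>v. v)) (at ?x0)"
  proof -
    have "(F has_derivative L) (at (\<pi> ?x0))" using FL \<pi>(3)[OF x0(2)] by simp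
    then have "((\<lambda>x. F (\<pi> x)) has_derivative (\<lambda>v. L (\<pi> v))) (at ?x0)"
      using diff_chain_at[OF bounded_linear_imp_has_derivative[OF bl(2)]] by (fastforce simp: o_def)
    then have "(h has_derivative (\<lambda>v. T (L (\<pi> v)) + (v - \<pi> v))) (at ?x0)"
      unfolding h_def
      by (intro has_derivative_add has_derivative_diff has_derivative_ident
          bounded_linear.has_derivative[OF bl(1)] bounded_linear_imp_has_derivative[OF bl(2)])
    moreover have "T (L (\<pi> v)) + (v - \<pi> v) = v" for v using T(3)[of "\<pi> v"] \<pi>(1) by auto
    ultimately show ?thesis by simp
  qed
  then have "frechet_derivative h (at ?x0) = (\<lambda>v. v)" using frechet_derivative_at by metis
  then have "inj (frechet_derivative h (at ?x0))" by simp
  then obtain U' V g where U': "open U'" "U' \<subseteq> U2" "?x0 \<in> U'" and V: "open V"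
    and hom: "homeomorphism U' V h g" and Cg: "\<And>k. C_k_on_open k V g"
    by (rule smooth_inverse_function[OF U2 x0' Ch]) (rule that)
  have gh: "g (h x) = x" if "x \<in> U'" for x using hom that by (simp add: homeomorphism_def)
  have hg: "h (g y) = y" if "y \<in> V" for y using hom that by (simp add: homeomorphism_def)
  have hV: "h x \<in> V" if "x \<in> U'" for x using hom that by (auto simp: homeomorphism_def)
  have gU': "g y \<in> U'" if "y \<in> V" for y using hom that by (auto simp: homeomorphism_def)
  have hE: "h x \<in> ?E \<longleftrightarrow> x \<in> ?E" for x
  proof
    assume "h x \<in> ?E"
    then have "h x - T (F (\<pi> x)) + \<pi> x \<in> ?E" using sub(1) T(1) \<pi>(1) by (intro subspace_add subspace_diff) auto
    then show "x \<in> ?E" by (simp add: h_def)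
  next
    assume "x \<in> ?E"
    then show "h x \<in> ?E" using T(1) \<pi>(3) by (auto simp: h_def)
  qed
  have hx: "h x = T (F x)" if "x \<in> ?E" for x using \<pi>(3)[OF that] by (simp add: h_def)
  define A where "A = {q \<in> cdom c. cmap c q \<in> U'} \<inter> W"
  have oA: "openin (mtop M) A" unfolding A_def by (intro openin_Int is_chart_open_vimage[OF ch U'(1)] W(1))
  have pA: "p \<in> A" using W(2) c(2) U'(3) by (simp add: A_def)
  have AE: "cmap c q \<in> ?E" if "q \<in> A" for q
  proof -
    have "q \<in> cdom c" using that by (simp add: A_def)
    then show ?thesis by (rule cmap_in_cmodel[OF ch])
  qed
  have hA: "h (cmap c q) = T (cmap c' (f q))" if "q \<in> A" for q
    using hx[OF AE[OF that]] Ff that by (simp add: A_def)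
  have fA: "f ` A = {r \<in> cdom c'. cmap c' r \<in> T -` V}"
  proof (intro equalityI subsetI)
    fix r assume "r \<in> f ` A"
    then obtain q where q: "q \<in> A" "r = f q" by blast
    then have "h (cmap c q) \<in> V" using hV by (simp add: A_def)
    then show "r \<in> {r \<in> cdom c'. cmap c' r \<in> T -` V}"
      using q W(4) hA[OF q(1)] by (auto simp: A_def)
  next
    fix r assume "r \<in> {r \<in> cdom c'. cmap c' r \<in> T -` V}"
    then have r: "r \<in> cdom c'" "T (cmap c' r) \<in> V" by auto
    \<comment> \<open>A point whose coordinates lie in \<open>T -` V\<close> has the preimage with coordinates \<open>g (T (cmap c' r))\<close>.\<close>
    let ?x = "g (T (cmap c' r))"
    have x: "?x \<in> U'" "h ?x = T (cmap c' r)" using gU' hg r(2) by auto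
    then have xE: "?x \<in> ?E" using hE T(1) by (metis rangeI subsetD)
    have "?x \<in> U" using U'(2) x(1) \<pi>(3)[OF xE] by (auto simp: U2_def)
    then have "?x \<in> cmap c ` W" unfolding U(2) using xE by simp
    then obtain q where q: "q \<in> W" "?x = cmap c q" by blast
    then have qA: "q \<in> A" using W(3) x(1) by (auto simp: A_def)
    have "T (cmap c' (f q)) = T (cmap c' r)" using hA[OF qA] x(2) q(2) by simp
    moreover have fq: "f q \<in> cdom c'" using W(4) q(1) by blast
    moreover have "cmap c' s \<in> ?E'" if "s \<in> cdom c'" for s
      by (rule cmap_in_cmodel[OF ch' that])
    ultimately have "cmap c' (f q) = cmap c' r" using LT r(1) by metis
    then have "f q = r" using inj_onD[OF is_chart_inj[OF ch']] fq r(1) by blast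
    then show "r \<in> f ` A" using qA by blast
  qed
  have "open (T -` V)" by (intro open_vimage V linear_continuous_on bl)
  then have ofA: "openin (mtop N) (f ` A)"
    unfolding fA by (rule is_chart_open_vimage[OF ch'])
  have g_eq: "g (T (cmap c' (f q))) = cmap c q" if "q \<in> A" for q
    using gh[of "cmap c q"] hA[OF that] that by (simp add: A_def)
  have inj: "inj_on f A"
  proof (rule inj_onI)
    fix q q' assume q: "q \<in> A" "q' \<in> A" "f q = f q'"
    then have "cmap c q = cmap c q'" using g_eq by metis
    then show "q = q'" using inj_onD[OF is_chart_inj[OF ch]] q by (auto simp: A_def)
  qed
  let ?M = "open_submanifold M A" and ?N = "open_submanifold N (f ` A)"
  have pts: "points ?M = A" "points ?N = f ` A" using points_open_submanifold oA ofA by blast+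
  note cA = restrict_chart_in_open_submanifold_charts[OF M c(1) oA]
    and cfA = restrict_chart_in_open_submanifold_charts[OF N c'(1) ofA]
  have subA: "A \<subseteq> cdom c" "f ` A \<subseteq> cdom c'" "A \<subseteq> W" using W(3,4) by (auto simp: A_def)
  have oA': "openin (mtop ?M) A" "openin (mtop ?N) (f ` A)" using oA ofA by (auto simp: openin_open_subtopology)
  have "smooth_map ?M ?N f"
  proof (rule smooth_mapI)
    fix q assume "q \<in> points ?M"
    then have q: "q \<in> A" using pts by simp
    have "smooth_on (cmap c ` A) F"
      using subA(3) U(2) by (intro smooth_on_subset[OF smooth_on_C_k[OF U(1) CF]]) auto
    then have "smooth_on (cmap c ` A) (cmap c' \<circ> f \<circ> cinv (restrict_chart c A))"
      by (rule smooth_on_cong) (use subA Ff cinv_restrict[OF ch oA] in \<open>auto simp: subset_iff\<close>)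
    then show "\<exists>a\<in>charts ?M. \<exists>a'\<in>charts ?N. \<exists>W. openin (mtop ?M) W \<and> q \<in> W \<and>
        W \<subseteq> cdom a \<and> f ` W \<subseteq> cdom a' \<and> smooth_on (cmap a ` W) (cmap a' \<circ> f \<circ> cinv a)"
      using subA q oA'
      by (intro bexI[OF _ cA] bexI[OF _ cfA] exI[of _ A]) auto
  qed (use pts in auto)
  moreover have "smooth_map ?N ?M (inv_into A f)"
  proof (rule smooth_mapI)
    fix r assume "r \<in> points ?N"
    then have r: "r \<in> f ` A" using pts by simp
    have "smooth_on (cmap c' ` f ` A) (\<lambda>y. g (T y))"
      by (rule smooth_on_compose[OF smooth_on_C_k[OF V Cg] smooth_on_linear[OF bl(1)]]) (auto simp: fA)
    then have "smooth_on (cmap c' ` f ` A) (cmap c \<circ> inv_into A f \<circ> cinv (restrict_chart c' (f ` A)))"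
    proof (rule smooth_on_cong)
      fix y assume "y \<in> cmap c' ` f ` A"
      then obtain q where q: "q \<in> A" "y = cmap c' (f q)" by blast
      then have "cinv (restrict_chart c' (f ` A)) y = f q"
        using cinv_restrict[OF ch' ofA] subA(2) by auto
      then show "g (T y) = (cmap c \<circ> inv_into A f \<circ> cinv (restrict_chart c' (f ` A))) y"
        using q g_eq inv_into_f_f[OF inj] by simp
    qed
    then show "\<exists>a\<in>charts ?N. \<exists>a'\<in>charts ?M. \<exists>W. openin (mtop ?N) W \<and> r \<in> W \<and>
        W \<subseteq> cdom a \<and> inv_into A f ` W \<subseteq> cdom a' \<and> smooth_on (cmap a ` W) (cmap a' \<circ> inv_into A f \<circ> cinv a)"
      using subA r oA' inv_into_f_f[OF inj]
      by (intro bexI[OF _ cfA] bexI[OF _ cA] exI[of _ "f ` A"]) auto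
  qed (use pts inj in auto)
  ultimately have "diffeomorphism ?M ?N f"
    unfolding diffeomorphism_def pts using inj by (simp add: bij_betw_def)
  then show "\<exists>U. openin (mtop M) U \<and> p \<in> U \<and> openin (mtop N) (f ` U) \<and>
      diffeomorphism (open_submanifold M U) (open_submanifold N (f ` U)) f"
    using oA pA ofA by blast
qed

section \<open>Curves in the fibres of a submersion\<close>

lemma smooth_map_derivative:
  assumes M: "smooth_atlas M" and N: "smooth_atlas N" and f: "smooth_map M N f"
    and c: "c \<in> charts M" "p \<in> cdom c" and c': "c' \<in> charts N" "f p \<in> cdom c'"
  obtains D where "linear D" "\<And>\<gamma>. curve_at M p \<gamma> \<Longrightarrow> velocity c' (f \<circ> \<gamma>) = D (velocity c \<gamma>)"
    "D ` cmodel c \<subseteq> cmodel c'"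
proof -
  obtain W U F where W: "p \<in> W" "cmap c ` W = U \<inter> cmodel c" and CF: "\<And>k. C_k_on_open k U F"
    and FD: "\<And>\<gamma>. curve_at M p \<gamma> \<Longrightarrow> velocity c' (f \<circ> \<gamma>) = frechet_derivative F (at (cmap c p)) (velocity c \<gamma>)"
    by (rule smooth_map_local_rep[OF M N f c c']) (rule that)
  have "cmap c p \<in> cmap c ` W" using W(1) by blast
  then have "cmap c p \<in> U" unfolding W(2) by simp
  then have "linear (frechet_derivative F (at (cmap c p)))"
    using C_k_on_open_Suc_has_derivative[OF CF] has_derivative_linear by blast
  moreover have "frechet_derivative F (at (cmap c p)) u \<in> cmodel c'" if u: "u \<in> cmodel c" for u
  proof -
    obtain \<gamma> where \<gamma>: "curve_at M p \<gamma>" "velocity c \<gamma> = u" by (rule line_curve_exists[OF c u]) (rule that)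
    then show ?thesis
      using velocity_works(2)[OF N smooth_map_curve[OF M N f \<gamma>(1)] c'] FD[OF \<gamma>(1)] by simp
  qed
  ultimately show ?thesis using that FD by blast
qed

text \<open>
  The straight line with velocity \<open>v\<close> is corrected by a term in the range of a right inverse \<open>R\<close> of the
  derivative \<open>L\<close>. To find the correction as a smooth function of time, invert
  \<open>\<Psi> (y, t) = (F (x0 + t *\<^sub>R v + R (\<pi> y)) + (y - \<pi> y), t)\<close> near 0, where \<open>\<pi>\<close> projects onto the model of the
  target. Its derivative at 0 is the identity since \<open>L v = 0\<close>, so the solution of \<open>\<Psi> (y, t) = (F x0, t)\<close>
  satisfies \<open>y' 0 = 0\<close> and the corrected curve still has velocity \<open>v\<close>. Outside a small time interval
  the curve is continued by the constant \<open>p\<close>, so that it lies in the fibre for all \<open>t\<close>.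
\<close>

lemma submersion_fibre_curve:
  fixes M :: "('m, 'e::euclidean_space) manifold" and N :: "('n, 'f::euclidean_space) manifold"
  assumes M: "smooth_atlas M" and N: "smooth_atlas N" and sub: "submersion M N f"
    and c: "c \<in> charts M" "p \<in> cdom c" and c': "c' \<in> charts N" "f p \<in> cdom c'"
    and \<gamma>\<^sub>0: "curve_at M p \<gamma>\<^sub>0" "velocity c' (f \<circ> \<gamma>\<^sub>0) = 0"
  obtains \<gamma> where "curve_at M p \<gamma>" "velocity c \<gamma> = velocity c \<gamma>\<^sub>0" "\<And>t. \<gamma> t \<in> points M" "\<And>t. f (\<gamma> t) = f p"
proof -
  have f: "smooth_map M N f" using sub by (simp add: submersion_def)
  note ch = charts_is_chart[OF c(1)] and ch' = charts_is_chart[OF c'(1)]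
  have pM: "p \<in> points M" using is_chart_cdom_subset[OF ch] c(2) by blast
  let ?E = "cmodel c" and ?E' = "cmodel c'"
  have subE: "subspace ?E" "subspace ?E'" using ch ch' by (auto simp: is_chart_def)
  obtain W U F where W: "openin (mtop M) W" "p \<in> W" "W \<subseteq> cdom c" "f ` W \<subseteq> cdom c'"
    and U: "open U" "cmap c ` W = U \<inter> ?E" and CF: "\<And>k. C_k_on_open k U F"
    and Ff: "\<And>q. q \<in> W \<Longrightarrow> F (cmap c q) = cmap c' (f q)"
    and FD: "\<And>\<gamma>. curve_at M p \<gamma> \<Longrightarrow> velocity c' (f \<circ> \<gamma>) = frechet_derivative F (at (cmap c p)) (velocity c \<gamma>)"
    by (rule smooth_map_local_rep[OF M N f c c']) (rule that)
  let ?x0 = "cmap c p"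
  have "?x0 \<in> cmap c ` W" using W(2) by blast
  then have x0: "?x0 \<in> U" "?x0 \<in> ?E" unfolding U(2) by auto
  define L where "L = frechet_derivative F (at ?x0)"
  have FL: "(F has_derivative L) (at ?x0)"
    unfolding L_def by (rule C_k_on_open_Suc_has_derivative[OF CF x0(1)])
  have linL: "linear L" using FL has_derivative_linear by blast
  define v where "v = velocity c \<gamma>\<^sub>0"
  have v: "v \<in> ?E" "L v = 0"
    using velocity_works(2)[OF M \<gamma>\<^sub>0(1) c] FD[OF \<gamma>\<^sub>0(1)] \<gamma>\<^sub>0(2) by (auto simp: v_def L_def)
  have surj: "w \<in> L ` ?E" if w: "w \<in> ?E'" for w
  proof -
    obtain \<delta> where \<delta>: "curve_at N (f p) \<delta>" "velocity c' \<delta> = w" by (rule line_curve_exists[OF c' w]) (rule that)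
    have "tangent_class N (f p) \<delta> \<in> tangent_space N (f p)" using \<delta>(1) by (auto simp: tangent_space_def)
    also have "\<dots> = tangent_map N f p ` tangent_space M p" using sub pM by (simp add: submersion_def)
    finally obtain \<gamma> where \<gamma>: "curve_at M p \<gamma>" "tangent_class N (f p) \<delta> = tangent_map N f p (tangent_class M p \<gamma>)"
      by (auto simp: tangent_space_def)
    have "\<delta> \<in> tangent_class N (f p) \<delta>" using \<delta>(1) by (simp add: tangent_class_def)
    then have "\<delta> \<in> tangent_class N (f p) (f \<circ> \<gamma>)"
      unfolding \<gamma>(2) tangent_map_class[OF M N f \<gamma>(1)] .
    then have "velocity c' (f \<circ> \<gamma>) = w" using c' \<delta>(2) by (simp add: tangent_class_def)
    then have "w = L (velocity c \<gamma>)" using FD[OF \<gamma>(1)] by (simp add: L_def)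
    then show ?thesis using velocity_works(2)[OF M \<gamma>(1) c] by blast
  qed
  obtain R where R: "range R \<subseteq> ?E" "linear R" "\<And>w. w \<in> L ` ?E \<Longrightarrow> L (R w) = w"
    using linear_exists_right_inverse_on[OF linL subE(1)] by metis
  obtain \<pi> :: "'f \<Rightarrow> 'f" where \<pi>: "range \<pi> \<subseteq> ?E'" "linear \<pi>" "\<And>u. u \<in> ?E' \<Longrightarrow> \<pi> u = u"
    using linear_exists_left_inverse_on[OF linear_id subE(2)] by auto
  have LR: "L (R (\<pi> w)) = \<pi> w" for w
  proof -
    have "\<pi> w \<in> ?E'" using \<pi>(1) by blast
    then show ?thesis using R(3) surj by blast
  qed
  have bl: "bounded_linear R" "bounded_linear \<pi>"
    using R(2) \<pi>(2) linear_conv_bounded_linear by blast+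
  define \<Lambda> where "\<Lambda> z = snd z *\<^sub>R v + R (\<pi> (fst z))" for z :: "'f \<times> real"
  have bl\<Lambda>: "bounded_linear \<Lambda>"
    unfolding \<Lambda>_def
    by (intro bounded_linear_add bounded_linear_compose[OF bl(1)] bounded_linear_compose[OF bl(2)]
        bounded_linear_fst bounded_linear_compose[OF bounded_linear_scaleR_left] bounded_linear_snd)
  have \<Lambda>E: "\<Lambda> z \<in> ?E" for z
    unfolding \<Lambda>_def using R(1) v(1) subE(1) by (intro subspace_add subspace_mul) auto
  have L\<Lambda>: "L (\<Lambda> z) = \<pi> (fst z)" for z
    unfolding \<Lambda>_def using linL v(2) LR by (simp add: linear_add linear_cmul)
  define \<sigma> where "\<sigma> z = ?x0 + \<Lambda> z" for z
  have \<sigma>E: "\<sigma> z \<in> ?E" for z unfolding \<sigma>_def using x0(2) \<Lambda>E subE(1) by (intro subspace_add)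
  have \<Lambda>0: "\<Lambda> 0 = 0" using linear_0[OF bounded_linear.linear[OF bl\<Lambda>]] .
  define U2 where "U2 = \<sigma> -` U"
  have U2: "open U2" unfolding U2_def \<sigma>_def
    by (intro open_vimage U(1) continuous_intros linear_continuous_on bl\<Lambda>)
  have z0: "0 \<in> U2" using x0(1) \<Lambda>0 by (simp add: U2_def \<sigma>_def)
  define \<Psi> where "\<Psi> z = (F (\<sigma> z) + (fst z - \<pi> (fst z)), snd z)" for z
  have C\<sigma>: "C_k_on_open k U2 \<sigma>" for k
    unfolding \<sigma>_def by (intro C_k_on_open_add U2 C_k_on_open_const C_k_on_open_linear bl\<Lambda>)
  have C\<Psi>: "C_k_on_open k U2 \<Psi>" for k
  proof -
    have 1: "C_k_on_open k U2 (\<lambda>z. F (\<sigma> z))"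
      by (rule C_k_on_open_compose[OF U2 U(1) _ C\<sigma> CF]) (auto simp: U2_def)
    have 2: "C_k_on_open k U2 (\<lambda>z. fst z - \<pi> (fst z))"
      by (intro C_k_on_open_linear[OF U2] bounded_linear_sub bounded_linear_fst bounded_linear_compose[OF bl(2)])
    show ?thesis unfolding \<Psi>_def
      by (intro C_k_on_open_Pair[OF U2] C_k_on_open_add[OF U2] 1 2 C_k_on_open_linear[OF U2] bounded_linear_snd)
  qed
  have d\<sigma>: "(\<sigma> has_derivative \<Lambda>) (at z)" for z
    unfolding \<sigma>_def using has_derivative_add[OF has_derivative_const bounded_linear_imp_has_derivative[OF bl\<Lambda>]] by simp
  have "(\<Psi> has_derivative (\<lambda>z. z)) (at 0)"
  proof -
    have "(F has_derivative L) (at (\<sigma> 0))" using FL \<Lambda>0 by (simp add: \<sigma>_def)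
    then have 1: "((\<lambda>z. F (\<sigma> z)) has_derivative (\<lambda>z. L (\<Lambda> z))) (at 0)"
      using diff_chain_at[OF d\<sigma>] by (fastforce simp: o_def)
    have 2: "((\<lambda>z::'f \<times> real. fst z - \<pi> (fst z)) has_derivative (\<lambda>z. fst z - \<pi> (fst z))) (at 0)"
      by (intro bounded_linear_imp_has_derivative bounded_linear_sub bounded_linear_fst bounded_linear_compose[OF bl(2)])
    have "(\<Psi> has_derivative (\<lambda>z. (L (\<Lambda> z) + (fst z - \<pi> (fst z)), snd z))) (at 0)"
      unfolding \<Psi>_def
      by (intro has_derivative_Pair has_derivative_add 1 2 bounded_linear_imp_has_derivative[OF bounded_linear_snd])
    then show ?thesis unfolding L\<Lambda> by simp
  qed
  then have d\<Psi>: "frechet_derivative \<Psi> (at 0) = (\<lambda>z. z)" using frechet_derivative_at by metis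
  then have "inj (frechet_derivative \<Psi> (at 0))" by simp
  then obtain U' V H where U': "open U'" "U' \<subseteq> U2" "0 \<in> U'" and V: "open V" "\<Psi> 0 \<in> V"
    and hom: "homeomorphism U' V \<Psi> H" and CH: "\<And>k. C_k_on_open k V H"
    and dH: "(H has_derivative inv (frechet_derivative \<Psi> (at 0))) (at (\<Psi> 0))"
    by (rule smooth_inverse_function[OF U2 z0 C\<Psi>]) (rule that)
  have "inv (\<lambda>z::'f \<times> real. z) = (\<lambda>z. z)" using inv_id by (simp add: id_def)
  with dH d\<Psi> have dH: "(H has_derivative (\<lambda>z. z)) (at (\<Psi> 0))" by simp
  have \<Psi>0: "\<Psi> 0 = (F ?x0, 0)"
    using \<Lambda>0 linear_0[OF \<pi>(2)] by (simp add: \<Psi>_def \<sigma>_def)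
  have H0: "H (\<Psi> 0) = 0" using hom U'(3) by (simp add: homeomorphism_def)
  define l where "l t = (F ?x0, t)" for t :: real
  have l0: "l 0 = \<Psi> 0" by (simp add: l_def \<Psi>0)
  have "open (l -` V)" unfolding l_def by (intro open_vimage V(1) continuous_intros)
  moreover have "0 \<in> l -` V" using V(2) l0 by simp
  ultimately obtain r where r: "r > 0" "\<And>t. dist t 0 < r \<Longrightarrow> t \<in> l -` V"
    unfolding open_dist by metis
  define h where "h t = \<sigma> (H (l t))" for t
  have in_dom: "H (l t) \<in> U'" "\<Psi> (H (l t)) = l t" if "t \<in> {-r<..<r}" for t
  proof -
    have "l t \<in> V" using r(2)[of t] that by auto
    then show "H (l t) \<in> U'" "\<Psi> (H (l t)) = l t"
      using homeomorphism_image2[OF hom] homeomorphism_apply2[OF hom] by blast+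
  qed
  have hW: "h t \<in> cmap c ` W" if "t \<in> {-r<..<r}" for t
    unfolding U(2) h_def using in_dom(1)[OF that] U'(2) \<sigma>E by (auto simp: U2_def)
  have FE': "F x \<in> ?E'" if "x \<in> cmap c ` W" for x
    using that Ff W(4) cmap_in_cmodel[OF ch'] by auto
  have Fh: "F (h t) = F ?x0" if t: "t \<in> {-r<..<r}" for t
  proof -
    let ?y = "fst (H (l t))"
    have eq: "F (h t) + (?y - \<pi> ?y) = F ?x0"
      using in_dom(2)[OF t] by (simp add: \<Psi>_def l_def h_def)
    \<comment> \<open>The equation \<open>\<Psi> (H (l t)) = l t\<close> forces \<open>?y\<close> into the model, where \<open>?y - \<pi> ?y\<close> vanishes.\<close>
    have "?y = F ?x0 - F (h t) + \<pi> ?y" using eq by (simp add: algebra_simps)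
    also have "\<dots> \<in> ?E'" using FE'[OF hW[OF t]] FE'[of ?x0] W(2) \<pi>(1) subE(2)
      by (intro subspace_add subspace_diff) auto
    finally have "\<pi> ?y = ?y" by (rule \<pi>(3))
    then show ?thesis using eq by simp
  qed
  have smh: "smooth_on {-r<..<r} h"
  proof -
    have "smooth_on {-r<..<r} l"
      unfolding l_def by (intro smooth_on_Pair smooth_on_const smooth_on_id)
    then have 1: "smooth_on {-r<..<r} (\<lambda>t. H (l t))"
      by (rule smooth_on_compose[OF smooth_on_C_k[OF V(1) CH]]) (use r(2) in auto)
    show ?thesis unfolding h_def
      by (rule smooth_on_compose[OF smooth_on_C_k[OF U2 C\<sigma>] 1]) (use in_dom(1) U'(2) in blast)
  qed
  have "(h has_vector_derivative v) (at 0)"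
  proof -
    have "(l has_derivative (\<lambda>t. (0, t))) (at 0)"
      unfolding l_def by (intro has_derivative_Pair has_derivative_const has_derivative_ident)
    moreover have "(H has_derivative (\<lambda>z. z)) (at (l 0))" using dH l0 by simp
    ultimately have "((\<lambda>t. H (l t)) has_derivative (\<lambda>t. (0, t))) (at 0)"
      using diff_chain_at by (fastforce simp: o_def)
    then have "(h has_derivative (\<lambda>t. \<Lambda> (0, t))) (at 0)"
      unfolding h_def using diff_chain_at[OF _ d\<sigma>] by (fastforce simp: o_def)
    moreover have "\<Lambda> (0, t) = t *\<^sub>R v" for t
      using linear_0[OF R(2)] linear_0[OF \<pi>(2)] by (simp add: \<Lambda>_def)
    ultimately show ?thesis by (simp add: has_vector_derivative_def)
  qed
  then have vh: "vector_derivative h (at 0) = v" by (rule vector_derivative_at)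
  define \<gamma> where "\<gamma> t = (if t \<in> {-r<..<r} then cinv c (h t) else p)" for t
  have h0: "h 0 = ?x0" using H0 l0 \<Lambda>0 by (simp add: h_def \<sigma>_def)
  have him: "h t \<in> cimage c" if "t \<in> {-r<..<r}" for t
    using hW[OF that] W(3) cmap_in_cimage by fastforce
  have f\<gamma>: "\<gamma> t \<in> points M \<and> f (\<gamma> t) = f p" for t
  proof (cases "t \<in> {-r<..<r}")
    case True
    obtain q where q: "q \<in> W" "h t = cmap c q" using hW[OF True] by blast
    then have "\<gamma> t = q" using True W(3) cinv_cmap[OF ch] by (auto simp: \<gamma>_def)
    moreover have "cmap c' (f q) = cmap c' (f p)" using Fh[OF True] q Ff W(2) by simp
    then have "f q = f p" using inj_onD[OF is_chart_inj[OF ch']] W(2,4) q(1) by blast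
    ultimately show ?thesis using q(1) W(1) openin_subset by fastforce
  next
    case False
    then show ?thesis using pM by (simp only: \<gamma>_def if_False)
  qed
  show ?thesis
  proof (rule that)
    show "curve_at M p \<gamma>" "velocity c \<gamma> = velocity c \<gamma>\<^sub>0"
      using chart_curve[OF c smh r(1) h0 him, of \<gamma>] vh by (auto simp: \<gamma>_def v_def)
  qed (use f\<gamma> in auto)
qed

section \<open>Forms in coordinates\<close>

lemma form_tangent_class:
  assumes "smooth_atlas M" "c \<in> charts M" "p \<in> cdom c" "curve_at M p \<gamma>" "curve_at M p \<delta>"
  shows "\<omega> p (tangent_class M p \<gamma>) (tangent_class M p \<delta>)
    = form_coords M \<omega> c (cmap c p) (velocity c \<gamma>) (velocity c \<delta>)"
  unfolding form_coords_def cinv_cmap[OF charts_is_chart[OF assms(2)] assms(3)]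
    tangent_class_eq_coords[OF assms(1-4)] tangent_class_eq_coords[OF assms(1-3,5)] ..

lemma form_coords_bilinear:
  assumes "smooth_2form M \<omega>" "c \<in> charts M" "x \<in> cimage c"
    and "u \<in> cmodel c" "v \<in> cmodel c" "w \<in> cmodel c"
  shows "form_coords M \<omega> c x (a *\<^sub>R u + b *\<^sub>R v) w = a * form_coords M \<omega> c x u w + b * form_coords M \<omega> c x v w"
    and "form_coords M \<omega> c x u v = - form_coords M \<omega> c x v u"
  using assms unfolding smooth_2form_def by blast+

lemma form_coords_zero:
  assumes "smooth_2form M \<omega>" "c \<in> charts M" "x \<in> cimage c" "w \<in> cmodel c"
  shows "form_coords M \<omega> c x 0 w = 0" "form_coords M \<omega> c x w 0 = 0"
proof -
  show 1: "form_coords M \<omega> c x 0 w = 0"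
    using form_coords_bilinear(1)[OF assms(1-4,4,4), of 0 0] by simp
  have "subspace (cmodel c)" using charts_is_chart[OF assms(2)] by (simp add: is_chart_def)
  then show "form_coords M \<omega> c x w 0 = 0"
    using form_coords_bilinear(2)[OF assms(1-4) subspace_0 assms(4)] 1 by simp
qed

lemma velocity_const: "velocity c (\<lambda>t. p) = 0"
  by (rule velocity_eqI) (simp add: o_def)

lemma form_constant_curve:
  assumes M: "smooth_atlas M" and \<omega>: "smooth_2form M \<omega>" and \<gamma>: "curve_at M p \<gamma>"
  shows "\<omega> p (tangent_class M p \<gamma>) (tangent_class M p (\<lambda>t. p)) = 0"
    and "\<omega> p (tangent_class M p (\<lambda>t. p)) (tangent_class M p \<gamma>) = 0"
proof -
  have p: "p \<in> points M" by (rule curve_at_in_points[OF \<gamma>])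
  obtain c where c: "c \<in> charts M" "p \<in> cdom c" using chart_at[OF M p] by blast
  note k = curve_at_const[OF M p] and v = velocity_works(2)[OF M \<gamma> c]
  show "\<omega> p (tangent_class M p \<gamma>) (tangent_class M p (\<lambda>t. p)) = 0"
    "\<omega> p (tangent_class M p (\<lambda>t. p)) (tangent_class M p \<gamma>) = 0"
    using form_tangent_class[OF M c \<gamma> k] form_tangent_class[OF M c k \<gamma>]
      form_coords_zero[OF \<omega> c(1) cmap_in_cimage[OF c(2)] v] by (simp_all add: velocity_const)
qed

lemma zero_tangent_eq_coords:
  assumes "smooth_atlas M" "c \<in> charts M" "p \<in> cdom c"
  shows "zero_tangent M p = tangent_of_coords M c p 0"
proof -
  have "p \<in> points M" using is_chart_cdom_subset[OF charts_is_chart[OF assms(2)]] assms(3) by blast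
  then show ?thesis
    unfolding zero_tangent_def using tangent_class_eq_coords[OF assms curve_at_const[OF assms(1)]]
    by (simp add: velocity_const)
qed

section \<open>Orthogonality of the source and target fibres\<close>

text \<open>
  Curves that run inside \<open>S\<close> represent vectors tangent to \<open>S\<close>, and those lie in the orthogonal of the tangent
  space of \<open>S\<close>.
\<close>

lemma lagrangian_submanifold_isotropic:
  assumes M: "smooth_atlas M" and L: "lagrangian_submanifold M \<omega> S"
    and \<gamma>: "curve_at M p \<gamma>" "\<And>t. \<gamma> t \<in> S" and \<delta>: "curve_at M p \<delta>" "\<And>t. \<delta> t \<in> S"
  shows "\<omega> p (tangent_class M p \<gamma>) (tangent_class M p \<delta>) = 0"
proof -
  have p: "p \<in> S" using \<gamma>(2)[of 0] curve_at_base[OF \<gamma>(1)] by simp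
  obtain k where S: "embedded_submanifold M k S"
    and eq: "symplectic_orthogonal M \<omega> p (submanifold_tangent_space M k S p) = submanifold_tangent_space M k S p"
    using L p unfolding lagrangian_submanifold_def by blast
  have "tangent_class M p \<gamma> \<in> submanifold_tangent_space M k S p"
    "tangent_class M p \<delta> \<in> submanifold_tangent_space M k S p"
    using submanifold_tangent_space_eq[OF M S] curve_at_submanifoldI[OF M S \<gamma>] curve_at_submanifoldI[OF M S \<delta>]
    by blast+
  then show ?thesis using eq unfolding symplectic_orthogonal_def by blast
qed

text \<open>
  The differentials of the two projections send the class of a pair of curves to the classes of its
  components.
\<close>

lemma prod_form_Pair_curves:
  assumes M: "smooth_atlas M" and N: "smooth_atlas N"
    and \<gamma>: "curve_at M p \<gamma>" "curve_at M p \<gamma>'" and \<delta>: "curve_at N q \<delta>" "curve_at N q \<delta>'"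
  shows "prod_form M \<omega> N \<eta> (p, q) (tangent_class (prod_manifold M N) (p, q) (\<lambda>t. (\<gamma> t, \<delta> t)))
      (tangent_class (prod_manifold M N) (p, q) (\<lambda>t. (\<gamma>' t, \<delta>' t)))
    = \<omega> p (tangent_class M p \<gamma>) (tangent_class M p \<gamma>') + \<eta> q (tangent_class N q \<delta>) (tangent_class N q \<delta>')"
proof -
  note MN = smooth_atlas_prod[OF M N]
  have "tangent_map M fst (p, q) (tangent_class (prod_manifold M N) (p, q) (\<lambda>t. (\<gamma> t, \<delta> t))) = tangent_class M p \<gamma>"
    if "curve_at M p \<gamma>" "curve_at N q \<delta>" for \<gamma> \<delta>
    using tangent_map_class[OF MN M smooth_map_fst[OF M N] curve_at_Pair[OF M N that]] by (simp add: o_def)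
  moreover have "tangent_map N snd (p, q) (tangent_class (prod_manifold M N) (p, q) (\<lambda>t. (\<gamma> t, \<delta> t))) = tangent_class N q \<delta>"
    if "curve_at M p \<gamma>" "curve_at N q \<delta>" for \<gamma> \<delta>
    using tangent_map_class[OF MN N smooth_map_snd[OF M N] curve_at_Pair[OF M N that]] by (simp add: o_def)
  ultimately show ?thesis using \<gamma> \<delta> by (simp add: prod_form_def pullback_form_def)
qed

text \<open>
  Let \<open>h\<close> be the unit at \<open>\<beta> g\<close>, and \<open>i\<close> the inverse of \<open>g\<close>. Both \<open>(\<gamma> t, h, \<gamma> t)\<close> and
  \<open>(g, i \<cdot> \<delta> t, \<delta> t)\<close> are curves in the graph of the multiplication starting at \<open>(g, h, g)\<close>. The first is constant in
  the second slot and the other one in the first slot, so only the third slot contributes to the product form,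
  and it contributes \<open>\<omega> (\<gamma>' 0) (\<delta>' 0)\<close>. Since the graph is Lagrangian, this number is 0. Smoothness of the multiplication
  is what makes the second triple a smooth curve.
\<close>

lemma source_target_fibres_orthogonal:
  assumes SG: "symplectic_groupoid G P \<alpha> \<beta> m \<epsilon> \<omega>"
    and \<gamma>: "curve_at G g \<gamma>" "\<And>t. \<gamma> t \<in> points G" "\<And>t. \<beta> (\<gamma> t) = \<beta> g"
    and \<delta>: "curve_at G g \<delta>" "\<And>t. \<delta> t \<in> points G" "\<And>t. \<alpha> (\<delta> t) = \<alpha> g"
  shows "\<omega> g (tangent_class G g \<gamma>) (tangent_class G g \<delta>) = 0"
proof -
  let ?C = "composable_pairs (points G) \<alpha> \<beta>" and ?GG = "prod_manifold G G"
  have gr: "groupoid (points G) (points P) \<alpha> \<beta> m \<epsilon>" and GM: "smooth_manifold G"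
    and sy: "symplectic_manifold G \<omega>"
    using SG by (auto simp: symplectic_groupoid_def lie_groupoid_def)
  have lag: "lagrangian_submanifold (prod_manifold G ?GG)
       (prod_form G (opposite_form \<omega>) ?GG (prod_form G (opposite_form \<omega>) G \<omega>))
       (multiplication_graph (points G) \<alpha> \<beta> m)"
    using SG by (simp add: symplectic_groupoid_def)
  obtain k where C: "embedded_submanifold ?GG k ?C" and sm: "smooth_map (submanifold ?GG k ?C) G (\<lambda>(g, h). m g h)"
    using SG unfolding symplectic_groupoid_def lie_groupoid_def by blast
  have G: "smooth_atlas G" by (rule smooth_manifold_imp_smooth_atlas[OF GM])
  have \<omega>: "smooth_2form G \<omega>" using sy by (simp add: symplectic_manifold_def)
  note GG = smooth_atlas_prod[OF G G]
  note GGG = smooth_atlas_prod[OF G GG]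
  have mul: "\<And>g h. g \<in> points G \<Longrightarrow> h \<in> points G \<Longrightarrow> \<beta> g = \<alpha> h \<Longrightarrow> m g h \<in> points G \<and> \<alpha> (m g h) = \<alpha> g \<and> \<beta> (m g h) = \<beta> h"
    and assoc: "\<And>g h k. g \<in> points G \<Longrightarrow> h \<in> points G \<Longrightarrow> k \<in> points G \<Longrightarrow> \<beta> g = \<alpha> h \<Longrightarrow> \<beta> h = \<alpha> k \<Longrightarrow> m (m g h) k = m g (m h k)"
    and unit: "\<And>q. q \<in> points P \<Longrightarrow> \<epsilon> q \<in> points G \<and> \<alpha> (\<epsilon> q) = q \<and> \<beta> (\<epsilon> q) = q"
    and unit_mul: "\<And>g. g \<in> points G \<Longrightarrow> m (\<epsilon> (\<alpha> g)) g = g \<and> m g (\<epsilon> (\<beta> g)) = g"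
    and pP: "\<And>g. g \<in> points G \<Longrightarrow> \<beta> g \<in> points P"
    using gr unfolding groupoid_def by blast+
  have gG: "g \<in> points G" by (rule curve_at_in_points[OF \<gamma>(1)])
  obtain i where i: "i \<in> points G" "\<alpha> i = \<beta> g" "\<beta> i = \<alpha> g" "m g i = \<epsilon> (\<alpha> g)" "m i g = \<epsilon> (\<beta> g)"
    using gr gG unfolding groupoid_def by blast
  define h where "h = \<epsilon> (\<beta> g)"
  have h: "h \<in> points G" "\<alpha> h = \<beta> g" using unit pP[OF gG] by (auto simp: h_def)
  define \<kappa> where "\<kappa> t = m i (\<delta> t)" for t
  have \<kappa>: "\<kappa> t \<in> points G" "\<alpha> (\<kappa> t) = \<beta> g" "m g (\<kappa> t) = \<delta> t" for t
  proof -
    have "\<beta> i = \<alpha> (\<delta> t)" using \<delta>(3) i(3) by simp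
    then show "\<kappa> t \<in> points G" "\<alpha> (\<kappa> t) = \<beta> g" using mul[OF i(1) \<delta>(2)] i(2) by (auto simp: \<kappa>_def)
    have "m g (\<kappa> t) = m (m g i) (\<delta> t)"
      unfolding \<kappa>_def using assoc[OF gG i(1) \<delta>(2)[of t]] i(2,3) \<delta>(3)[of t] by simp
    then show "m g (\<kappa> t) = \<delta> t" using unit_mul[OF \<delta>(2)[of t]] i(4) \<delta>(3)[of t] by simp
  qed
  have c\<kappa>: "curve_at G h \<kappa>"
  proof -
    have "curve_at ?GG (i, g) (\<lambda>t. (i, \<delta> t))" by (rule curve_at_Pair[OF G G curve_at_const[OF G i(1)] \<delta>(1)])
    then have "curve_at (submanifold ?GG k ?C) (i, g) (\<lambda>t. (i, \<delta> t))"
      by (rule curve_at_submanifoldI[OF GG C]) (use i \<delta> in \<open>auto simp: composable_pairs_def\<close>)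
    from smooth_map_curve[OF smooth_atlas_submanifold[OF GG C] G sm this]
    moreover have "\<kappa> = (\<lambda>t. m i (\<delta> t))" by (simp add: fun_eq_iff \<kappa>_def)
    ultimately show ?thesis using i(5) by (simp add: o_def h_def)
  qed
  let ?A = "\<lambda>t. (\<gamma> t, (h, \<gamma> t))" and ?B = "\<lambda>t. (g, (\<kappa> t, \<delta> t))"
  note cg = curve_at_const[OF G gG] and c_h = curve_at_const[OF G h(1)]
  have cA: "curve_at (prod_manifold G ?GG) (g, (h, g)) ?A"
    by (intro curve_at_Pair G GG \<gamma>(1) c_h)
  have cB: "curve_at (prod_manifold G ?GG) (g, (h, g)) ?B"
    by (intro curve_at_Pair G GG cg c\<kappa> \<delta>(1))
  have A: "?A t \<in> multiplication_graph (points G) \<alpha> \<beta> m" for t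
  proof -
    have "m (\<gamma> t) h = \<gamma> t" using unit_mul[OF \<gamma>(2)[of t]] \<gamma>(3)[of t] by (simp add: h_def)
    then show ?thesis using \<gamma>(2,3) h by (auto simp: multiplication_graph_def composable_pairs_def)
  qed
  have B: "?B t \<in> multiplication_graph (points G) \<alpha> \<beta> m" for t
    using \<kappa>[of t] gG by (auto simp: multiplication_graph_def composable_pairs_def)
  have "0 = prod_form G (opposite_form \<omega>) ?GG (prod_form G (opposite_form \<omega>) G \<omega>) (g, (h, g))
      (tangent_class (prod_manifold G ?GG) (g, (h, g)) ?A) (tangent_class (prod_manifold G ?GG) (g, (h, g)) ?B)"
    using lagrangian_submanifold_isotropic[OF GGG lag cA A cB B] by simp
  also have "\<dots> = opposite_form \<omega> g (tangent_class G g \<gamma>) (tangent_class G g (\<lambda>t. g))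
      + (opposite_form \<omega> h (tangent_class G h (\<lambda>t. h)) (tangent_class G h \<kappa>)
         + \<omega> g (tangent_class G g \<gamma>) (tangent_class G g \<delta>))"
    unfolding prod_form_Pair_curves[OF G GG \<gamma>(1) cg curve_at_Pair[OF G G c_h \<gamma>(1)] curve_at_Pair[OF G G c\<kappa> \<delta>(1)]]
      prod_form_Pair_curves[OF G G c_h c\<kappa> \<gamma>(1) \<delta>(1)] ..
  also have "\<dots> = \<omega> g (tangent_class G g \<gamma>) (tangent_class G g \<delta>)"
    using form_constant_curve[OF G \<omega> \<gamma>(1)] form_constant_curve[OF G \<omega> c\<kappa>] by (simp add: opposite_form_def)
  finally show ?thesis by simp
qed

section \<open>Lagrangian subspaces in coordinates\<close>

text \<open>
  An orthonormal basis of \<open>E\<close> represents \<open>B\<close> as \<open>B v w = A v \<bullet> w\<close> with a linear map \<open>A\<close>, injective on \<open>E\<close> by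
  nondegeneracy and hence mapping \<open>E\<close> onto itself. Then \<open>A\<close> maps \<open>F\<close>, its own orthogonal for \<open>B\<close>, onto the Euclidean
  orthogonal complement of \<open>F\<close> in \<open>E\<close>. The form is only given on \<open>E\<close>; inserting a projection \<open>\<pi>\<close> makes \<open>A\<close>
  linear on the whole space.
\<close>

lemma self_orthogonal_subspace_dim:
  fixes E F :: "'e::euclidean_space set" and B :: "'e \<Rightarrow> 'e \<Rightarrow> real"
  assumes E: "subspace E" and F: "subspace F" "F \<subseteq> E"
    and lin: "\<And>u v w a b. u \<in> E \<Longrightarrow> v \<in> E \<Longrightarrow> w \<in> E \<Longrightarrow> B (a *\<^sub>R u + b *\<^sub>R v) w = a * B u w + b * B v w"
    and anti: "\<And>u v. u \<in> E \<Longrightarrow> v \<in> E \<Longrightarrow> B u v = - B v u"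
    and nondeg: "\<And>u. u \<in> E \<Longrightarrow> (\<And>w. w \<in> E \<Longrightarrow> B u w = 0) \<Longrightarrow> u = 0"
    and self: "{v \<in> E. \<forall>w\<in>F. B v w = 0} = F"
  shows "2 * dim F = dim E"
proof -
  have add: "B (u + v) w = B u w + B v w" and scale: "B (a *\<^sub>R u) w = a * B u w"
    if "u \<in> E" "v \<in> E" "w \<in> E" for u v w a
    using lin[OF that, of 1 1] lin[OF that, of a 0] by simp_all
  have lin2: "B u (\<Sum>i\<in>I. x i *\<^sub>R b i) = (\<Sum>i\<in>I. x i * B u (b i))"
    if "u \<in> E" "finite I" "\<And>i. i \<in> I \<Longrightarrow> b i \<in> E" for u I x and b :: "'e \<Rightarrow> 'e"
    using that(2,3)
  proof (induction I)
    case empty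
    have "0 \<in> E" using E by (rule subspace_0)
    then have "B 0 u = 0" using scale[of u u u 0] that(1) by simp
    then show ?case using anti[OF that(1) \<open>0 \<in> E\<close>] by simp
  next
    case (insert i I)
    have 1: "x i *\<^sub>R b i \<in> E" "(\<Sum>i\<in>I. x i *\<^sub>R b i) \<in> E" "b i \<in> E"
      using E insert.prems by (auto intro: subspace_sum subspace_mul)
    have "B u (x i *\<^sub>R b i + (\<Sum>i\<in>I. x i *\<^sub>R b i)) = - (B (x i *\<^sub>R b i) u + B (\<Sum>i\<in>I. x i *\<^sub>R b i) u)"
      using anti[OF that(1) subspace_add[OF E 1(1,2)]] add[OF 1(1,2) that(1)] by simp
    also have "\<dots> = x i * B u (b i) + B u (\<Sum>i\<in>I. x i *\<^sub>R b i)"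
      using scale[OF 1(3,3) that(1)] anti[OF that(1) 1(3)] anti[OF that(1) 1(2)] by simp
    finally show ?case using insert by simp
  qed
  obtain b where b: "b \<subseteq> E" "pairwise orthogonal b" "\<And>x. x \<in> b \<Longrightarrow> norm x = 1" "independent b" "span b = E"
    using orthonormal_basis_subspace[OF E] by metis
  have fin: "finite b" using b(4) independent_imp_finite by blast
  obtain \<pi> :: "'e \<Rightarrow> 'e" where \<pi>: "range \<pi> \<subseteq> E" "linear \<pi>" "\<And>u. u \<in> E \<Longrightarrow> \<pi> u = u"
    using linear_exists_left_inverse_on[OF linear_id E] by auto
  define A where "A v = (\<Sum>i\<in>b. B (\<pi> v) i *\<^sub>R i)" for v
  have \<pi>E: "\<pi> v \<in> E" for v using \<pi>(1) by blast
  have bE: "i \<in> E" if "i \<in> b" for i using b(1) that by blast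
  have "linear A"
  proof (rule linearI)
    show "A (x + y) = A x + A y" for x y
      unfolding A_def linear_add[OF \<pi>(2)] sum.distrib[symmetric]
      by (rule sum.cong[OF refl]) (simp add: add[OF \<pi>E \<pi>E bE] scaleR_left_distrib)
    show "A (a *\<^sub>R x) = a *\<^sub>R A x" for a x
      unfolding A_def linear_cmul[OF \<pi>(2)] scaleR_sum_right
      by (rule sum.cong[OF refl]) (simp add: scale[OF \<pi>E \<pi>E bE])
  qed
  have AE: "A v \<in> E" for v unfolding A_def using bE E by (intro subspace_sum subspace_mul)
  have AB: "A v \<bullet> w = B v w" if v: "v \<in> E" and w: "w \<in> E" for v w
  proof -
    have "(\<Sum>i\<in>b. (w \<bullet> i) *\<^sub>R i) = w"
      by (rule orthonormal_basis_expand[OF b(2)]) (use b(3,5) w fin in auto)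
    then have "B v w = B v (\<Sum>i\<in>b. (w \<bullet> i) *\<^sub>R i)" by simp
    also have "\<dots> = (\<Sum>i\<in>b. (w \<bullet> i) * B v i)" by (rule lin2[OF v fin bE])
    also have "\<dots> = A v \<bullet> w" unfolding A_def \<pi>(3)[OF v] inner_sum_left
      by (rule sum.cong[OF refl]) (simp add: inner_commute mult.commute)
    finally show ?thesis by simp
  qed
  have inj: "inj_on A E"
    unfolding linear_injective_on_subspace_0[OF \<open>linear A\<close> E]
  proof clarify
    fix v assume "v \<in> E" "A v = 0"
    then show "v = 0" using AB[of v] nondeg[of v] by simp
  qed
  have "A ` E = E"
  proof (rule subspace_dim_equal)
    show "subspace (A ` E)" by (rule linear_subspace_image[OF \<open>linear A\<close> E])
    show "dim E \<le> dim (A ` E)"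
      using dim_image_eq[OF \<open>linear A\<close>, of E] inj by (simp add: span_eq_iff[THEN iffD2, OF E])
  qed (use AE E in auto)
  have "A ` F = {y \<in> E. \<forall>x\<in>F. orthogonal x y}"
  proof (intro equalityI subsetI)
    fix y assume "y \<in> A ` F"
    then obtain v where v: "v \<in> F" "y = A v" by blast
    have "B v x = 0" if "x \<in> F" for x using self v(1) that by blast
    then have "orthogonal x y" if "x \<in> F" for x
      using AB[of v x] v F(2) that by (auto simp: orthogonal_def inner_commute)
    then show "y \<in> {y \<in> E. \<forall>x\<in>F. orthogonal x y}" using AE v(2) by blast
  next
    fix y assume y: "y \<in> {y \<in> E. \<forall>x\<in>F. orthogonal x y}"
    then have "y \<in> A ` E" using \<open>A ` E = E\<close> by simp
    then obtain v where v: "v \<in> E" "y = A v" by blast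
    have "B v w = 0" if "w \<in> F" for w
    proof -
      have "w \<bullet> A v = 0" using y that v(2) by (simp add: orthogonal_def)
      then show ?thesis using AB[OF v(1), of w] F(2) that by (auto simp: inner_commute)
    qed
    then have "v \<in> F" using self v(1) by blast
    then show "y \<in> A ` F" using v(2) by blast
  qed
  then have "dim (A ` F) + dim F = dim E"
    using dim_subspace_orthogonal_to_vectors[OF F(1) E F(2)] by simp
  moreover have "dim (A ` F) = dim F"
  proof (rule dim_image_eq[OF \<open>linear A\<close>])
    show "inj_on A (span F)" using inj F(2) by (simp add: span_eq_iff[THEN iffD2, OF F(1)] inj_on_subset)
  qed
  ultimately show ?thesis by simp
qed

lemma nondegenerate_coords:
  assumes M: "smooth_atlas M" and c: "c \<in> charts M" "p \<in> cdom c" and nd: "nondegenerate_2form M \<omega>"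
    and u: "u \<in> cmodel c" and z: "\<And>w. w \<in> cmodel c \<Longrightarrow> form_coords M \<omega> c (cmap c p) u w = 0"
  shows "u = 0"
proof -
  note ch = charts_is_chart[OF c(1)]
  have pM: "p \<in> points M" using is_chart_cdom_subset[OF ch] c(2) by blast
  let ?t = "tangent_of_coords M c p"
  have "\<omega> p (?t u) v = 0" if v: "v \<in> tangent_space M p" for v
  proof -
    obtain w where w: "w \<in> cmodel c" "v = ?t w"
      using v unfolding tangent_space_eq_coords[OF M c] by blast
    show ?thesis using z[OF w(1)] unfolding form_coords_def cinv_cmap[OF ch c(2)] w(2) .
  qed
  moreover have "?t u \<in> tangent_space M p" unfolding tangent_space_eq_coords[OF M c] using u by blast
  ultimately have "?t u = zero_tangent M p" using nd pM unfolding nondegenerate_2form_def by blast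
  then have "?t u = ?t 0" unfolding zero_tangent_eq_coords[OF M c] .
  then show ?thesis by (rule tangent_of_coords_inj[OF c u])
qed

lemma lagrangian_coords:
  assumes M: "smooth_atlas M" and S: "embedded_submanifold M k S" and p: "p \<in> S" "p \<in> cdom c"
    and s: "slice_chart M k S c F"
    and L: "symplectic_orthogonal M \<omega> p (submanifold_tangent_space M k S p) = submanifold_tangent_space M k S p"
  shows "{v \<in> cmodel c. \<forall>w\<in>F. form_coords M \<omega> c (cmap c p) v w = 0} = F"
proof -
  have c: "c \<in> charts M" and F: "F \<subseteq> cmodel c" using s by (auto simp: slice_chart_def)
  let ?t = "tangent_of_coords M c p"
  have B: "form_coords M \<omega> c (cmap c p) v w = \<omega> p (?t v) (?t w)" for v w
    unfolding form_coords_def cinv_cmap[OF charts_is_chart[OF c] p(2)] ..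
  have "v \<in> F \<longleftrightarrow> (\<forall>w\<in>F. \<omega> p (?t v) (?t w) = 0)" if v: "v \<in> cmodel c" for v
  proof -
    have "v \<in> F \<longleftrightarrow> ?t v \<in> ?t ` F" using tangent_of_coords_inj[OF c p(2) v] by blast
    also have "\<dots> \<longleftrightarrow> ?t v \<in> symplectic_orthogonal M \<omega> p (?t ` F)"
      using L unfolding submanifold_tangent_space_coords[OF M S s p(2,1)] by simp
    also have "\<dots> \<longleftrightarrow> (\<forall>w\<in>F. \<omega> p (?t v) (?t w) = 0)"
      using v unfolding symplectic_orthogonal_def tangent_space_eq_coords[OF M c p(2)] by blast
    finally show ?thesis .
  qed
  then show ?thesis unfolding B using F by blast
qed

section \<open>Transfer between source and target\<close>

text \<open>
  The linear algebra of the theorem, for two maps \<open>\<alpha>\<close> and \<open>\<beta>\<close> whose differentials have mutually orthogonal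
  kernels. Let \<open>A\<close> and \<open>B\<close> be the derivatives of \<open>\<alpha>\<close> and \<open>\<beta>\<close> at \<open>p \<in> S\<close>, and \<open>F\<close> the tangent space of \<open>S\<close>. Bijectivity
  of \<open>A\<close> on \<open>F\<close> implies that every vector is the sum of one in \<open>F\<close> and one in the kernel of \<open>A\<close>. A vector of \<open>F\<close> in the
  kernel of \<open>B\<close> is orthogonal to both summands, hence 0. So \<open>B\<close> is injective on \<open>F\<close>, and by equality of dimensions
  it is bijective.
\<close>

lemma local_diffeomorphism_transfer:
  assumes G: "smooth_manifold G" and P: "smooth_manifold P" and sy: "symplectic_manifold G \<omega>"
    and dim: "mdim G = 2 * d" and lag: "lagrangian_submanifold G \<omega> S"
    and \<alpha>: "smooth_map G P \<alpha>" and \<beta>: "smooth_map G P \<beta>"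
    and orth: "\<And>g \<gamma> \<delta> a b. a \<in> charts P \<Longrightarrow> \<alpha> g \<in> cdom a \<Longrightarrow> b \<in> charts P \<Longrightarrow> \<beta> g \<in> cdom b \<Longrightarrow>
      curve_at G g \<gamma> \<Longrightarrow> curve_at G g \<delta> \<Longrightarrow> velocity a (\<alpha> \<circ> \<gamma>) = 0 \<Longrightarrow> velocity b (\<beta> \<circ> \<delta>) = 0 \<Longrightarrow>
      \<omega> g (tangent_class G g \<gamma>) (tangent_class G g \<delta>) = 0"
    and loc: "local_diffeomorphism (submanifold G d S) P \<alpha>"
  shows "local_diffeomorphism (submanifold G d S) P \<beta>"
proof (cases "S = {}")
  case True
  then show ?thesis by (simp add: local_diffeomorphism_def)
next
  case False
  note G = smooth_manifold_imp_smooth_atlas[OF G] and P = smooth_manifold_imp_smooth_atlas[OF P]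
  have \<omega>: "smooth_2form G \<omega>" and nd: "nondegenerate_2form G \<omega>"
    using sy by (auto simp: symplectic_manifold_def)
  obtain k where Sk: "embedded_submanifold G k S"
    and Lk: "\<And>p. p \<in> S \<Longrightarrow> symplectic_orthogonal G \<omega> p (submanifold_tangent_space G k S p)
                 = submanifold_tangent_space G k S p"
    using lag unfolding lagrangian_submanifold_def by blast
  have bil: "form_coords G \<omega> c (cmap c p) (x *\<^sub>R u + y *\<^sub>R v) w
      = x * form_coords G \<omega> c (cmap c p) u w + y * form_coords G \<omega> c (cmap c p) v w"
    "form_coords G \<omega> c (cmap c p) u v = - form_coords G \<omega> c (cmap c p) v u"
    if "c \<in> charts G" "p \<in> cdom c" "u \<in> cmodel c" "v \<in> cmodel c" "w \<in> cmodel c" for c p u v w x y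
    using form_coords_bilinear[OF \<omega> that(1) cmap_in_cimage[OF that(2)] that(3-5)] by auto
  \<comment> \<open>The dimension in the Lagrangian condition is existentially quantified; a tangent space equal to its
    own orthogonal determines it.\<close>
  have "k = d"
  proof -
    obtain p where p: "p \<in> S" using False by blast
    obtain c F where s: "slice_chart G k S c F" and c: "c \<in> charts G" "p \<in> cdom c"
      by (rule slice_chart_at[OF Sk p]) (rule that)
    have E: "subspace (cmodel c)" "dim (cmodel c) = 2 * d"
      using charts_is_chart[OF c(1)] dim by (auto simp: is_chart_def)
    have F: "subspace F" "F \<subseteq> cmodel c" "dim F = k" using s by (auto simp: slice_chart_def)
    have "2 * dim F = dim (cmodel c)"
      by (rule self_orthogonal_subspace_dim[OF E(1) F(1,2), where B = "form_coords G \<omega> c (cmap c p)"])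
         (fact bil(1)[OF c], rule bil(2)[OF c], assumption, assumption, assumption,
          rule nondegenerate_coords[OF G c nd], assumption, blast,
          fact lagrangian_coords[OF G Sk p c(2) s Lk[OF p]])
    then show ?thesis using E F by simp
  qed
  with Sk Lk have S: "embedded_submanifold G d S"
    and L: "\<And>p. p \<in> S \<Longrightarrow> symplectic_orthogonal G \<omega> p (submanifold_tangent_space G d S p)
                 = submanifold_tangent_space G d S p" by auto
  let ?S = "submanifold G d S"
  note SA = smooth_atlas_submanifold[OF G S]
  show ?thesis
  proof (rule bij_derivative_imp_local_diffeomorphism[OF SA P smooth_map_submanifold[OF G P S \<beta>]])
    fix p assume "p \<in> points ?S"
    then have p: "p \<in> S" using points_submanifold[OF S] by simp
    obtain c F where s: "slice_chart G d S c F" and c: "c \<in> charts G" "p \<in> cdom c"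
      by (rule slice_chart_at[OF S p]) (rule that)
    have pG: "p \<in> points G" using is_chart_cdom_subset[OF charts_is_chart[OF c(1)]] c(2) by blast
    obtain a where a: "a \<in> charts P" "\<alpha> p \<in> cdom a" using chart_at[OF P smooth_map_in_points[OF \<alpha> pG]] by blast
    obtain b where b: "b \<in> charts P" "\<beta> p \<in> cdom b" using chart_at[OF P smooth_map_in_points[OF \<beta> pG]] by blast
    obtain A where A: "linear A" "\<And>\<gamma>. curve_at G p \<gamma> \<Longrightarrow> velocity a (\<alpha> \<circ> \<gamma>) = A (velocity c \<gamma>)" "A ` cmodel c \<subseteq> cmodel a"
      by (rule smooth_map_derivative[OF G P \<alpha> c a]) (rule that)
    obtain B where B: "linear B" "\<And>\<gamma>. curve_at G p \<gamma> \<Longrightarrow> velocity b (\<beta> \<circ> \<gamma>) = B (velocity c \<gamma>)" "B ` cmodel c \<subseteq> cmodel b"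
      by (rule smooth_map_derivative[OF G P \<beta> c b]) (rule that)
    let ?\<omega> = "form_coords G \<omega> c (cmap c p)" and ?c = "slice c S F"
    have E: "subspace (cmodel c)" using charts_is_chart[OF c(1)] by (simp add: is_chart_def)
    have F: "subspace F" "F \<subseteq> cmodel c" using s by (auto simp: slice_chart_def)
    have sc: "?c \<in> charts ?S" "p \<in> cdom ?c" using slice_in_charts[OF G S s] c p by auto
    have vel: "velocity ?c \<gamma> = velocity c \<gamma>" for \<gamma> by (simp add: velocity_def)
    have ker: "?\<omega> u v = 0" if uv: "u \<in> cmodel c" "v \<in> cmodel c" "A u = 0" "B v = 0" for u v
    proof -
      obtain \<gamma> where \<gamma>: "curve_at G p \<gamma>" "velocity c \<gamma> = u" by (rule line_curve_exists[OF c uv(1)]) (rule that)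
      obtain \<delta> where \<delta>: "curve_at G p \<delta>" "velocity c \<delta> = v" by (rule line_curve_exists[OF c uv(2)]) (rule that)
      have "\<omega> p (tangent_class G p \<gamma>) (tangent_class G p \<delta>) = 0"
        by (rule orth[OF a b \<gamma>(1) \<delta>(1)]) (use A(2) B(2) \<gamma> \<delta> uv in auto)
      then show ?thesis unfolding form_tangent_class[OF G c \<gamma>(1) \<delta>(1)] \<gamma>(2) \<delta>(2) .
    qed
    have bijA: "bij_betw A F (cmodel a)"
      using local_diffeomorphism_derivative_bij[OF SA P loc sc a, of A] A(2) curve_at_submanifoldD[OF G S] vel
      by simp
    then have injA: "inj_on A F" by (simp add: bij_betw_def)
    \<comment> \<open>The base has dimension \<open>dim F\<close> because \<open>\<alpha>\<close> is a local diffeomorphism on \<open>S\<close>.\<close>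
    have dims: "dim F = dim (cmodel b)"
    proof -
      have "dim (A ` F) = dim F"
        by (rule dim_image_eq[OF A(1)]) (simp add: span_eq_iff[THEN iffD2, OF F(1)] injA)
      then show ?thesis
        using bijA charts_is_chart[OF a(1)] charts_is_chart[OF b(1)] by (simp add: bij_betw_def is_chart_def)
    qed
    have "u = 0" if u: "u \<in> F" "B u = 0" for u
    proof (rule nondegenerate_coords[OF G c nd])
      show uE: "u \<in> cmodel c" using u F by blast
      fix w assume w: "w \<in> cmodel c"
      \<comment> \<open>Split \<open>w\<close> as \<open>v + (w - v)\<close> with \<open>v\<close> tangent to \<open>S\<close> and \<open>w - v\<close> in the kernel of \<open>A\<close>.\<close>
      have "A w \<in> A ` F" using A(3) w bijA by (auto simp: bij_betw_def)
      then obtain v where v: "v \<in> F" "A w = A v" by blast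
      have vE: "v \<in> cmodel c" using v F by blast
      have wv: "w - v \<in> cmodel c" using E w vE by (rule subspace_diff)
      have "?\<omega> (w - v) u = 0"
        by (rule ker[OF wv uE _ u(2)]) (simp add: linear_diff[OF A(1)] v(2))
      moreover have "?\<omega> v u = 0" using lagrangian_coords[OF G S p c(2) s L[OF p]] v(1) u(1) by blast
      moreover have "?\<omega> (1 *\<^sub>R (w - v) + 1 *\<^sub>R v) u = 1 * ?\<omega> (w - v) u + 1 * ?\<omega> v u"
        by (rule bil(1)[OF c wv vE uE])
      ultimately have "?\<omega> w u = 0" by simp
      then show "?\<omega> u w = 0" using bil(2)[OF c uE w w] by simp
    qed
    then have injB: "inj_on B F" using linear_injective_on_subspace_0[OF B(1) F(1)] by blast
    have "B ` F = cmodel b"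
    proof (rule subspace_dim_equal)
      show "subspace (B ` F)" by (rule linear_subspace_image[OF B(1) F(1)])
      show "subspace (cmodel b)" using charts_is_chart[OF b(1)] by (simp add: is_chart_def)
      show "B ` F \<subseteq> cmodel b" using B(3) F(2) by blast
      have "dim (B ` F) = dim F"
        by (rule dim_image_eq[OF B(1)]) (simp add: span_eq_iff[THEN iffD2, OF F(1)] injB)
      then show "dim (cmodel b) \<le> dim (B ` F)" using dims by simp
    qed
    then have "bij_betw B (cmodel ?c) (cmodel b)" using injB by (simp add: bij_betw_def)
    moreover have "\<forall>\<gamma>. curve_at ?S p \<gamma> \<longrightarrow> velocity b (\<beta> \<circ> \<gamma>) = B (velocity ?c \<gamma>)"
      using B(2) curve_at_submanifoldD[OF G S] vel by simp
    ultimately show "\<exists>c c' D. c \<in> charts ?S \<and> p \<in> cdom c \<and> c' \<in> charts P \<and> \<beta> p \<in> cdom c' \<and>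
      (\<forall>\<gamma>. curve_at ?S p \<gamma> \<longrightarrow> velocity c' (\<beta> \<circ> \<gamma>) = D (velocity c \<gamma>)) \<and> bij_betw D (cmodel c) (cmodel c')"
      using sc b by blast
  qed
qed

theorem theorem2p16:
  fixes G :: "('g, 'e::euclidean_space) manifold"
    and P :: "('p, 'f::euclidean_space) manifold"
    and \<alpha> \<beta> :: "'g \<Rightarrow> 'p"
    and m :: "'g \<Rightarrow> 'g \<Rightarrow> 'g"
    and \<epsilon> :: "'p \<Rightarrow> 'g"
    and \<omega> :: "'g form2"
    and S :: "'g set"
    and d :: nat
  assumes "symplectic_groupoid G P \<alpha> \<beta> m \<epsilon> \<omega>"
    and "mdim G = 2 * d"
    and "lagrangian_submanifold G \<omega> S"
  shows "local_diffeomorphism (submanifold G d S) P \<alpha> \<longleftrightarrow>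
         local_diffeomorphism (submanifold G d S) P \<beta>"
proof -
  have G: "smooth_manifold G" and P: "smooth_manifold P" and sy: "symplectic_manifold G \<omega>"
    and \<alpha>: "submersion G P \<alpha>" and \<beta>: "submersion G P \<beta>"
    using assms(1) by (auto simp: symplectic_groupoid_def lie_groupoid_def)
  note GA = smooth_manifold_imp_smooth_atlas[OF G] and PA = smooth_manifold_imp_smooth_atlas[OF P]
  have \<omega>: "smooth_2form G \<omega>" using sy by (simp add: symplectic_manifold_def)
  have s: "smooth_map G P \<alpha>" "smooth_map G P \<beta>" using \<alpha> \<beta> by (auto simp: submersion_def)
  have orth: "\<omega> g (tangent_class G g \<delta>) (tangent_class G g \<gamma>) = 0 \<and> \<omega> g (tangent_class G g \<gamma>) (tangent_class G g \<delta>) = 0"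
    if a: "a \<in> charts P" "\<alpha> g \<in> cdom a" and b: "b \<in> charts P" "\<beta> g \<in> cdom b"
      and \<gamma>: "curve_at G g \<gamma>" and \<delta>: "curve_at G g \<delta>"
      and z: "velocity a (\<alpha> \<circ> \<gamma>) = 0" "velocity b (\<beta> \<circ> \<delta>) = 0" for g \<gamma> \<delta> a b
  proof -
    obtain c where c: "c \<in> charts G" "g \<in> cdom c" using chart_at[OF GA curve_at_in_points[OF \<gamma>]] by blast
    \<comment> \<open>The form depends on velocities only, so both curves may be replaced by curves in fibres.\<close>
    obtain \<gamma>' where \<gamma>': "curve_at G g \<gamma>'" "velocity c \<gamma>' = velocity c \<gamma>" "\<And>t. \<gamma>' t \<in> points G" "\<And>t. \<alpha> (\<gamma>' t) = \<alpha> g"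
      by (rule submersion_fibre_curve[OF GA PA \<alpha> c a \<gamma> z(1)]) (rule that)
    obtain \<delta>' where \<delta>': "curve_at G g \<delta>'" "velocity c \<delta>' = velocity c \<delta>" "\<And>t. \<delta>' t \<in> points G" "\<And>t. \<beta> (\<delta>' t) = \<beta> g"
      by (rule submersion_fibre_curve[OF GA PA \<beta> c b \<delta> z(2)]) (rule that)
    have "\<omega> g (tangent_class G g \<delta>') (tangent_class G g \<gamma>') = 0"
      by (rule source_target_fibres_orthogonal[OF assms(1) \<delta>'(1,3,4) \<gamma>'(1,3,4)])
    then have 1: "form_coords G \<omega> c (cmap c g) (velocity c \<delta>) (velocity c \<gamma>) = 0"
      unfolding form_tangent_class[OF GA c \<delta>'(1) \<gamma>'(1)] \<gamma>'(2) \<delta>'(2) .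
    note v = velocity_works(2)[OF GA \<gamma> c] velocity_works(2)[OF GA \<delta> c]
    have 2: "form_coords G \<omega> c (cmap c g) (velocity c \<gamma>) (velocity c \<delta>) = 0"
      using form_coords_bilinear(2)[OF \<omega> c(1) cmap_in_cimage[OF c(2)] v v(1)] 1 by simp
    show ?thesis
      unfolding form_tangent_class[OF GA c \<delta> \<gamma>] form_tangent_class[OF GA c \<gamma> \<delta>] using 1 2 by blast
  qed
  show ?thesis
  proof
    assume "local_diffeomorphism (submanifold G d S) P \<alpha>"
    then show "local_diffeomorphism (submanifold G d S) P \<beta>"
      by (rule local_diffeomorphism_transfer[OF G P sy assms(2,3) s, rotated]) (use orth in blast)
  next
    assume "local_diffeomorphism (submanifold G d S) P \<beta>"
    then show "local_diffeomorphism (submanifold G d S) P \<alpha>"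
      by (rule local_diffeomorphism_transfer[OF G P sy assms(2,3) s(2,1), rotated]) (use orth in blast)
  qed
qed

end
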